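(* Let $\mathcal H$, $\mathcal L$, $\mathrm H^{-\infty}_{(s)}$ and very weak solutions be as in the context, and let $T>0$. Consider $$\partial_t^2u(t)+a(t)\mathcal L u(t)=f(t),\ t\in[0,T],\qquad u(0)=u_0,\quad\partial_tu(0)=u_1.\quad(\ast)$$ (II.3) Assume $a\in C^\alpha([0,T])$ with $0<\alpha<1$ and $a(t)\ge a_0>0$. Let $1\le s<1+\frac{\alpha}{1-\alpha}$, $u_0,u_1\in\mathrm H^{-\infty}_{(s)}$ and $f\in C([0,T];\mathrm H^{-\infty}_{(s)})$. Let $(u_\varepsilon)_\varepsilon$ be a very weak solution of $\mathrm H^{-\infty}_{(s)}$-type of $(\ast)$. Then for any regularising families $a_\varepsilon,f_\varepsilon$ as in the definition, $u_\varepsilon$ converges in $C^2([0,T];\mathrm H^{-\infty}_{(s)})$ as $\varepsilon\to0$ to the unique classical solution in $C^2([0,T];\mathrm H^{-\infty}_{(s)})$ of $(\ast)$. (II.4) Assume $a\in C^\alpha([0,T])$ with $0<\alpha<2$ and $a(t)\ge0$. Let $1\le s<1+\frac{\alpha}{2}$, $u_0,u_1\in\mathrm H^{-\infty}_{(s)}$ and $f\in C([0,T];\mathrm H^{-\infty}_{(s)})$. Let $(u_\varepsilon)_\varepsilon$ be a very weak solution of $\mathrm H^{-\infty}_{(s)}$-type of $(\ast)$. Then for any regularising families $a_\varepsilon,f_\varepsilon$ as in the definition, $u_\varepsilon$ converges in $C^2([0,T];\mathrm H^{-\infty}_{(s)})$ as $\varepsilon\to0$ to the unique classical solution in $C^2([0,T];\mathrm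 H^{-\infty}_{(s)})$ of $(\ast)$.
   Context: Setting: $\mathcal H$ is a complex Hilbert space; $\mathcal L$ is a densely defined linear operator in $\mathcal H$ with discrete spectrum $\{\lambda_\xi\ge0:\xi\in\mathcal I\}$, $\mathcal I$ countable, whose eigenfunctions $e_\xi$ form a basis of $\mathcal H$; $\{e^*_\xi\}$ is the biorthogonal system and $\widehat f(\xi)=(f,e^*_\xi)$ the $\mathcal L$-Fourier coefficients (extended by duality); zero eigenvalues are replaced by a constant $c>0$. $\gamma^{(s)}_{\mathcal L}=\{f:\forall A>0,\ \sum_\xi e^{2A\lambda_\xi^{1/(2s)}}|\widehat f(\xi)|^2<\infty\}$, and $\mathrm H^{-\infty}_{(s)}$ is its dual, characterised by $u\in\mathrm H^{-\infty}_{(s)}$ iff $\exists\eta>0$: $\|e^{-\eta\mathcal L^{1/(2s)}}u\|^2_{\mathcal H}:=\sum_\xi e^{-2\eta\lambda_\xi^{1/(2s)}}|\widehat u(\xi)|^2<\infty$. Regularisations: $\psi\in C_0^\infty(\mathbb R)$, $\psi\ge0$, $\int\psi=1$, $\omega(\varepsilon)>0$, $\omega(\varepsilon)\to0$; $\psi_{\omega(\varepsilon)}(t)=\omega(\varepsilon)^{-1}\psi(t/\omega(\varepsilon))$, $a_\varepsilon=a*\psi_{\omega(\varepsilon)}$, $f_\varepsilon=f(\cdot)*\psi_{\omega(\varepsilon)}$. A net $(g_\varepsilon)$ of smooth functions is $C^\infty$-moderate if for each compact $K$ and $\alpha\in\mathbb N_0$ there are $N,c$ with $\sup_K|\partial^\alpha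 g_\varepsilon|\le c\varepsilon^{-N-\alpha}$ for $\varepsilon\in(0,1]$; $(u_\varepsilon)$ is $C^\infty([0,T];\mathrm H^{-\infty}_{(s)})$-moderate if $\exists\eta>0$ and for each $p\in\mathbb N_0$ there are $c_p,N_p>0$ with $\|e^{-\eta\mathcal L^{1/(2s)}}\partial_t^pu_\varepsilon(t)\|_{\mathcal H}\le c_p\varepsilon^{-N_p-p}$ for all $t\in[0,T]$, $\varepsilon\in(0,1]$. A net $(u_\varepsilon)\subset C^\infty([0,T];\mathrm H^{-\infty}_{(s)})$ is a very weak solution of $\mathrm H^{-\infty}_{(s)}$-type of $(\ast)$ if there exist a $C^\infty$-moderate regularisation $a_\varepsilon$ of $a$ and a $C^\infty([0,T];\mathrm H^{-\infty}_{(s)})$-moderate regularisation $f_\varepsilon$ of $f$ such that each $u_\varepsilon$ solves $\partial_t^2u_\varepsilon+a_\varepsilon\mathcal Lu_\varepsilon=f_\varepsilon$, $u_\varepsilon(0)=u_0$, $\partial_tu_\varepsilon(0)=u_1$, and $(u_\varepsilon)$ is $C^\infty([0,T];\mathrm H^{-\infty}_{(s)})$-moderate. *)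

theory Defs
  imports "HOL-Analysis.Analysis"
begin

text \<open>Everything is expressed on the L-Fourier side: an (ultra)distribution u
is represented by its coefficient function (xi |-> u-hat(xi)) :: 'i => complex,
and L acts by multiplication with the eigenvalue lam xi.
Time-dependent families carry their time derivatives explicitly:
D p t = p-th time derivative at time t.\<close>

definition mu_of :: "('i \<Rightarrow> real) \<Rightarrow> real \<Rightarrow> 'i \<Rightarrow> real" where
  "mu_of lam c \<xi> = (if lam \<xi> = 0 then c else lam \<xi>)"

definition wt :: "real \<Rightarrow> ('i \<Rightarrow> real) \<Rightarrow> real \<Rightarrow> 'i \<Rightarrow> real" where
  "wt s mu \<eta> \<xi> = exp (- 2 * \<eta> * (mu \<xi>) powr (1 / (2 * s)))"

definition Hw :: "('i \<Rightarrow> real) \<Rightarrow> ('i \<Rightarrow> complex) \<Rightarrow> bool" where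
  "Hw w v \<longleftrightarrow> (\<lambda>\<xi>. w \<xi> * (cmod (v \<xi>))\<^sup>2) summable_on UNIV"

definition nw :: "('i \<Rightarrow> real) \<Rightarrow> ('i \<Rightarrow> complex) \<Rightarrow> real" where
  "nw w v = sqrt (infsum (\<lambda>\<xi>. w \<xi> * (cmod (v \<xi>))\<^sup>2) UNIV)"

definition Hneg :: "real \<Rightarrow> ('i \<Rightarrow> real) \<Rightarrow> ('i \<Rightarrow> complex) \<Rightarrow> bool" where
  "Hneg s mu v \<longleftrightarrow> (\<exists>\<eta>>0. Hw (wt s mu \<eta>) v)"

definition ck_family :: "('i \<Rightarrow> real) \<Rightarrow> real \<Rightarrow> nat \<Rightarrow> (nat \<Rightarrow> real \<Rightarrow> 'i \<Rightarrow> complex) \<Rightarrow> bool" where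
  "ck_family w T k D \<longleftrightarrow>
     (\<forall>p\<le>k. \<forall>t\<in>{0..T}. Hw w (D p t)) \<and>
     (\<forall>p\<le>k. \<forall>t\<in>{0..T}.
        ((\<lambda>t'. nw w (\<lambda>\<xi>. D p t' \<xi> - D p t \<xi>)) \<longlongrightarrow> 0) (at t within {0..T})) \<and>
     (\<forall>p<k. \<forall>t\<in>{0..T}.
        ((\<lambda>h. nw w (\<lambda>\<xi>. (D p (t + h) \<xi> - D p t \<xi>) / complex_of_real h - D (Suc p) t \<xi>))
           \<longlongrightarrow> 0) (at 0 within {h. t + h \<in> {0..T}}))"

definition cinf_family :: "('i \<Rightarrow> real) \<Rightarrow> real \<Rightarrow> (nat \<Rightarrow> real \<Rightarrow> 'i \<Rightarrow> complex) \<Rightarrow> bool" where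
  "cinf_family w T D \<longleftrightarrow> (\<forall>k. ck_family w T k D)"

definition moderate_family :: "real \<Rightarrow> ('i \<Rightarrow> real) \<Rightarrow> real \<Rightarrow>
    (real \<Rightarrow> nat \<Rightarrow> real \<Rightarrow> 'i \<Rightarrow> complex) \<Rightarrow> bool" where
  "moderate_family s mu T D \<longleftrightarrow>
     (\<exists>\<eta>>0. \<forall>p. \<exists>c N. c > 0 \<and> N > 0 \<and>
        (\<forall>\<epsilon>\<in>{0<..1}. \<forall>t\<in>{0..T}.
           Hw (wt s mu \<eta>) (D \<epsilon> p t) \<and> nw (wt s mu \<eta>) (D \<epsilon> p t) \<le> c * \<epsilon> powr (- N - real p)))"

definition cinf_moderate :: "(real \<Rightarrow> real \<Rightarrow> real) \<Rightarrow> bool" where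
  "cinf_moderate g \<longleftrightarrow>
     (\<forall>K. compact K \<longrightarrow> (\<forall>k. \<exists>c N. \<forall>\<epsilon>\<in>{0<..1}. \<forall>x\<in>K.
        \<bar>(deriv ^^ k) (g \<epsilon>) x\<bar> \<le> c * \<epsilon> powr (- N - real k)))"

definition hoelder_on :: "real \<Rightarrow> real set \<Rightarrow> (real \<Rightarrow> real) \<Rightarrow> bool" where
  "hoelder_on \<beta> S g \<longleftrightarrow> (\<exists>C. \<forall>x\<in>S. \<forall>y\<in>S. \<bar>g x - g y\<bar> \<le> C * \<bar>x - y\<bar> powr \<beta>)"

definition C_alpha :: "real \<Rightarrow> real \<Rightarrow> (real \<Rightarrow> real) \<Rightarrow> bool" where
  "C_alpha \<alpha> T g \<longleftrightarrow>
     (\<alpha> < 1 \<and> hoelder_on \<alpha> {0..T} g) \<or>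
     (1 \<le> \<alpha> \<and> \<alpha> < 2 \<and> (\<exists>g'. (\<forall>t\<in>{0..T}. (g has_real_derivative g' t) (at t within {0..T})) \<and>
        continuous_on {0..T} g' \<and> hoelder_on (\<alpha> - 1) {0..T} g'))"

definition mollifier :: "(real \<Rightarrow> real) \<Rightarrow> bool" where
  "mollifier \<psi> \<longleftrightarrow>
     (\<forall>k x. ((deriv ^^ k) \<psi> has_real_derivative (deriv ^^ Suc k) \<psi> x) (at x)) \<and>
     (\<exists>R. \<forall>x. R < \<bar>x\<bar> \<longrightarrow> \<psi> x = 0) \<and> (\<forall>x. 0 \<le> \<psi> x) \<and> (\<psi> has_integral 1) UNIV"

text \<open>extension of a function given on [0,T] to R by constants\<close>
definition clamp :: "real \<Rightarrow> real \<Rightarrow> real" where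
  "clamp T t = max 0 (min T t)"

definition reg_a :: "(real \<Rightarrow> real) \<Rightarrow> (real \<Rightarrow> real) \<Rightarrow> real \<Rightarrow> (real \<Rightarrow> real) \<Rightarrow> real \<Rightarrow> real \<Rightarrow> real" where
  "reg_a \<psi> \<omega> T a \<epsilon> t =
     integral UNIV (\<lambda>\<tau>. a (clamp T (t - \<tau>)) * (\<psi> (\<tau> / \<omega> \<epsilon>) / \<omega> \<epsilon>))"

definition reg_f :: "(real \<Rightarrow> real) \<Rightarrow> (real \<Rightarrow> real) \<Rightarrow> real \<Rightarrow> (real \<Rightarrow> 'i \<Rightarrow> complex) \<Rightarrow>
    real \<Rightarrow> real \<Rightarrow> 'i \<Rightarrow> complex" where
  "reg_f \<psi> \<omega> T f \<epsilon> t \<xi> =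
     integral UNIV (\<lambda>\<tau>. f (clamp T (t - \<tau>)) \<xi> * complex_of_real (\<psi> (\<tau> / \<omega> \<epsilon>) / \<omega> \<epsilon>))"

text \<open>u :: eps |-> p |-> t |-> coefficients of d_t^p u_eps(t)\<close>
definition very_weak_solution :: "real \<Rightarrow> ('i \<Rightarrow> real) \<Rightarrow> real \<Rightarrow> real \<Rightarrow> (real \<Rightarrow> real) \<Rightarrow> (real \<Rightarrow> real) \<Rightarrow>
    (real \<Rightarrow> real) \<Rightarrow> (real \<Rightarrow> 'i \<Rightarrow> complex) \<Rightarrow> ('i \<Rightarrow> complex) \<Rightarrow> ('i \<Rightarrow> complex) \<Rightarrow>
    (real \<Rightarrow> nat \<Rightarrow> real \<Rightarrow> 'i \<Rightarrow> complex) \<Rightarrow> bool" where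
  "very_weak_solution s lam c T \<psi> \<omega> a f u0 u1 u \<longleftrightarrow>
     cinf_moderate (reg_a \<psi> \<omega> T a) \<and>
     (\<exists>F. (\<forall>\<epsilon>\<in>{0<..1}. \<forall>t\<in>{0..T}. F \<epsilon> 0 t = reg_f \<psi> \<omega> T f \<epsilon> t) \<and>
          (\<forall>\<epsilon>\<in>{0<..1}. \<exists>\<eta>>0. cinf_family (wt s (mu_of lam c) \<eta>) T (F \<epsilon>)) \<and>
          moderate_family s (mu_of lam c) T F) \<and>
     (\<forall>\<epsilon>\<in>{0<..1}. \<exists>\<eta>>0. cinf_family (wt s (mu_of lam c) \<eta>) T (u \<epsilon>)) \<and>
     (\<forall>\<epsilon>\<in>{0<..1}.
        (\<forall>t\<in>{0..T}. \<forall>\<xi>. u \<epsilon> 2 t \<xi> + complex_of_real (reg_a \<psi> \<omega> T a \<epsilon> t * lam \<xi>) * u \<epsilon> 0 t \<xi>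
                          = reg_f \<psi> \<omega> T f \<epsilon> t \<xi>) \<and>
        u \<epsilon> 0 0 = u0 \<and> u \<epsilon> 1 0 = u1) \<and>
     moderate_family s (mu_of lam c) T u"

definition classical_solution :: "real \<Rightarrow> ('i \<Rightarrow> real) \<Rightarrow> real \<Rightarrow> real \<Rightarrow> (real \<Rightarrow> real) \<Rightarrow>
    (real \<Rightarrow> 'i \<Rightarrow> complex) \<Rightarrow> ('i \<Rightarrow> complex) \<Rightarrow> ('i \<Rightarrow> complex) \<Rightarrow>
    (nat \<Rightarrow> real \<Rightarrow> 'i \<Rightarrow> complex) \<Rightarrow> bool" where
  "classical_solution s lam c T a f u0 u1 V \<longleftrightarrow>
     (\<exists>\<eta>>0. ck_family (wt s (mu_of lam c) \<eta>) T 2 V) \<and>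
     (\<forall>t\<in>{0..T}. \<forall>\<xi>. V 2 t \<xi> + complex_of_real (a t * lam \<xi>) * V 0 t \<xi> = f t \<xi>) \<and>
     V 0 0 = u0 \<and> V 1 0 = u1"

definition converges_C2 :: "real \<Rightarrow> ('i \<Rightarrow> real) \<Rightarrow> real \<Rightarrow>
    (real \<Rightarrow> nat \<Rightarrow> real \<Rightarrow> 'i \<Rightarrow> complex) \<Rightarrow> (nat \<Rightarrow> real \<Rightarrow> 'i \<Rightarrow> complex) \<Rightarrow> bool" where
  "converges_C2 s mu T u V \<longleftrightarrow>
     (\<exists>\<eta>>0. \<forall>e>0. \<exists>\<delta>>0. \<forall>\<epsilon>. 0 < \<epsilon> \<and> \<epsilon> < \<delta> \<longrightarrow>
        (\<forall>t\<in>{0..T}. \<forall>k\<le>2.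
           Hw (wt s mu \<eta>) (\<lambda>\<xi>. u \<epsilon> k t \<xi> - V k t \<xi>) \<and>
           nw (wt s mu \<eta>) (\<lambda>\<xi>. u \<epsilon> k t \<xi> - V k t \<xi>) < e))"

definition conclusion_4p5 where
  "conclusion_4p5 s lam c T a f u0 u1 u \<longleftrightarrow>
     (\<exists>V. classical_solution s lam c T a f u0 u1 V \<and>
          (\<forall>W. classical_solution s lam c T a f u0 u1 W \<longrightarrow> (\<forall>t\<in>{0..T}. W 0 t = V 0 t)) \<and>
          converges_C2 s (mu_of lam c) T u V)"

end

theory Submission
  imports Defs
begin

text \<open>Each Fourier mode solves v'' + b(t) l v = g. If B is a positive differentiable approximation of the
  coefficient b, the energy |v'|^2 + (1 + l B) |v|^2 grows at most like exp(2t + \<integral>\<theta>) with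
  \<theta> = |B'|/B + sqrt l |B - b|/sqrt B. The approximation B is a moving average of b over a length adapted to
  the frequency l, shifted by a small positive constant if b may vanish. Then \<integral>\<theta> is at most a constant times
  1 + l^(1/(2s)), exactly the loss that the weights absorb, and the constant is the same for all mollified
  coefficients, because the pointwise inequalities defining the admissible class survive convolution.

  Applied to differences of the regularised solutions, the uniform estimate shows that they are Cauchy in a
  sufficiently weak weighted space; their limit is the classical solution, so no existence theorem for
  ordinary differential equations is needed. Uniqueness is mode by mode, with B = 1.\<close>

section \<open>Weighted square-summability\<close>


text \<open>The averaging length \<rho> comes from balancing the two parts of \<theta>. For an
  \<alpha>-Hoelder coefficient bounded below they are of order \<rho>^(\<alpha> - 1) and sqrt l *
  \<rho>^\<alpha>; so \<rho> = l^(-1/2), and the loss l^((1 - \<alpha>)/2) fits s < 1/(1 -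
  \<alpha>). If the coefficient may vanish, the shift is \<delta> = \<rho>^\<alpha> and the parts
  are of order 1/\<rho> and sqrt (l \<delta>); so \<rho> = l^(-1/(2 + \<alpha>)), and the loss
  l^(1/(2 + \<alpha>)) fits 2s < 2 + \<alpha>.

  The obstacle is the order 1/\<rho> when \<alpha> \<ge> 1. It rests on Glaeser's inequality, for
  which a nonnegative function must be differentiable on both sides of the point, whereas the
  constant extension beyond [0, T] may have corners at the endpoints. Near them the increments are
  bounded only in total. This costs \<rho>/\<delta> = \<rho>^(1 - \<alpha>), which stays below
  1/\<rho> because \<alpha> < 2.\<close>

definition wbound :: "('i \<Rightarrow> real) \<Rightarrow> ('i \<Rightarrow> complex) \<Rightarrow> real \<Rightarrow> bool" where
  "wbound w v M \<longleftrightarrow> (\<forall>F. finite F \<longrightarrow> L2_set (\<lambda>\<xi>. sqrt (w \<xi>) * cmod (v \<xi>)) F \<le> M)"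

lemma wboundI: "(\<And>F. finite F \<Longrightarrow> L2_set (\<lambda>\<xi>. sqrt (w \<xi>) * cmod (v \<xi>)) F \<le> M) \<Longrightarrow> wbound w v M"
  by (simp add: wbound_def)

lemma wboundD: "wbound w v M \<Longrightarrow> finite F \<Longrightarrow> L2_set (\<lambda>\<xi>. sqrt (w \<xi>) * cmod (v \<xi>)) F \<le> M"
  by (simp add: wbound_def)

lemma wbound_nonneg: "wbound w v M \<Longrightarrow> 0 \<le> M"
  using wboundD[of w v M "{}"] by simp

lemma wbound_mono: "wbound w v M \<Longrightarrow> M \<le> N \<Longrightarrow> wbound w v N"
  unfolding wbound_def by force

lemma wbound_zero: "0 \<le> M \<Longrightarrow> wbound w (\<lambda>_. 0) M"
  by (auto simp: wbound_def L2_set_def)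

lemma wbound_component: "wbound w v M \<Longrightarrow> sqrt (w \<xi>) * cmod (v \<xi>) \<le> M"
  using wboundD[of w v M "{\<xi>}"] by (auto simp: L2_set_def)

lemma L2_set_weighted:
  assumes "\<And>\<xi>. 0 \<le> w \<xi>"
  shows "L2_set (\<lambda>\<xi>. sqrt (w \<xi>) * cmod (v \<xi>)) F = sqrt (\<Sum>\<xi>\<in>F. w \<xi> * (cmod (v \<xi>))\<^sup>2)"
  using assms by (simp add: L2_set_def power_mult_distrib)

lemma wboundI_sum:
  assumes "\<And>\<xi>. 0 \<le> w \<xi>" "0 \<le> M"
    and "\<And>F. finite F \<Longrightarrow> (\<Sum>\<xi>\<in>F. w \<xi> * (cmod (v \<xi>))\<^sup>2) \<le> M\<^sup>2"
  shows "wbound w v M"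
  using assms by (intro wboundI) (auto simp: L2_set_weighted intro!: real_le_lsqrt sum_nonneg)

lemma wboundD_sum:
  assumes "\<And>\<xi>. 0 \<le> w \<xi>" "wbound w v M" "finite F"
  shows "(\<Sum>\<xi>\<in>F. w \<xi> * (cmod (v \<xi>))\<^sup>2) \<le> M\<^sup>2"
  using wboundD[OF assms(2,3)] wbound_nonneg[OF assms(2)] assms(1)
  by (metis L2_set_weighted real_sqrt_le_iff real_sqrt_abs abs_of_nonneg)

text \<open>A bound on all finite partial sums carries summability and the norm bound in one
  statement, so that sums and limits reduce to finite-dimensional facts. This lemma translates back
  to \<open>Hw\<close> and \<open>nw\<close>.\<close>

lemma wbound_iff:
  assumes w: "\<And>\<xi>. 0 \<le> w \<xi>"
  shows "wbound w v M \<longleftrightarrow> 0 \<le> M \<and> Hw w v \<and> nw w v \<le> M"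
proof
  assume b: "wbound w v M"
  have M: "0 \<le> M" using wbound_nonneg[OF b] .
  note s = wboundD_sum[OF w b]
  have H: "Hw w v"
    unfolding Hw_def
    by (rule nonneg_bounded_partial_sums_imp_summable_on[where C = "M\<^sup>2"])
       (use s w in \<open>auto simp: eventually_finite_subsets_at_top\<close>)
  have "infsum (\<lambda>\<xi>. w \<xi> * (cmod (v \<xi>))\<^sup>2) UNIV \<le> M\<^sup>2"
    using H s unfolding Hw_def by (intro infsum_le_finite_sums) auto
  hence "nw w v \<le> M"
    unfolding nw_def using M by (metis real_sqrt_le_iff real_sqrt_abs abs_of_nonneg)
  with M H show "0 \<le> M \<and> Hw w v \<and> nw w v \<le> M" by blast
next
  assume a: "0 \<le> M \<and> Hw w v \<and> nw w v \<le> M"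
  show "wbound w v M"
  proof (rule wboundI_sum[OF w])
    fix F :: "'a set" assume F: "finite F"
    have "(\<Sum>\<xi>\<in>F. w \<xi> * (cmod (v \<xi>))\<^sup>2) \<le> infsum (\<lambda>\<xi>. w \<xi> * (cmod (v \<xi>))\<^sup>2) UNIV"
      using a F w unfolding Hw_def by (intro finite_sum_le_infsum) auto
    also have "\<dots> \<le> M\<^sup>2"
      using a unfolding nw_def by (metis real_sqrt_le_iff real_sqrt_abs abs_of_nonneg)
    finally show "(\<Sum>\<xi>\<in>F. w \<xi> * (cmod (v \<xi>))\<^sup>2) \<le> M\<^sup>2" .
  qed (use a in simp)
qed

lemma nw_nonneg: "(\<And>\<xi>. 0 \<le> w \<xi>) \<Longrightarrow> 0 \<le> nw w v"
  by (auto simp: nw_def intro!: infsum_nonneg)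

lemma Hw_imp_wbound: "(\<And>\<xi>. 0 \<le> w \<xi>) \<Longrightarrow> Hw w v \<Longrightarrow> wbound w v (nw w v)"
  by (simp add: wbound_iff nw_nonneg)

lemma wbound_add:
  assumes w: "\<And>\<xi>. 0 \<le> w \<xi>" and "wbound w u M" "wbound w v N"
  shows "wbound w (\<lambda>\<xi>. u \<xi> + v \<xi>) (M + N)"
proof (rule wboundI)
  fix F :: "'a set" assume F: "finite F"
  have "L2_set (\<lambda>\<xi>. sqrt (w \<xi>) * cmod (u \<xi> + v \<xi>)) F
      \<le> L2_set (\<lambda>\<xi>. sqrt (w \<xi>) * cmod (u \<xi>) + sqrt (w \<xi>) * cmod (v \<xi>)) F"
    using w by (intro L2_set_mono) (auto simp flip: distrib_left intro: mult_left_mono norm_triangle_ineq)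
  also have "\<dots> \<le> L2_set (\<lambda>\<xi>. sqrt (w \<xi>) * cmod (u \<xi>)) F + L2_set (\<lambda>\<xi>. sqrt (w \<xi>) * cmod (v \<xi>)) F"
    by (rule L2_set_triangle_ineq)
  finally show "L2_set (\<lambda>\<xi>. sqrt (w \<xi>) * cmod (u \<xi> + v \<xi>)) F \<le> M + N"
    using wboundD[OF assms(2) F] wboundD[OF assms(3) F] by linarith
qed

text \<open>Different weights on the two sides allow an unbounded multiplier, such as the
  eigenvalue, to be absorbed by weakening the norm.\<close>

lemma wbound_mult:
  assumes w: "\<And>\<xi>. 0 \<le> w' \<xi>" and k: "\<And>\<xi>. sqrt (w' \<xi>) * cmod (k \<xi>) \<le> C * sqrt (w \<xi>)"
    and C: "0 \<le> C" and b: "wbound w v M"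
  shows "wbound w' (\<lambda>\<xi>. k \<xi> * v \<xi>) (C * M)"
proof (rule wboundI)
  fix F :: "'a set" assume F: "finite F"
  have "L2_set (\<lambda>\<xi>. sqrt (w' \<xi>) * cmod (k \<xi> * v \<xi>)) F
      \<le> L2_set (\<lambda>\<xi>. C * (sqrt (w \<xi>) * cmod (v \<xi>))) F"
  proof (rule L2_set_mono)
    fix \<xi>
    show "sqrt (w' \<xi>) * cmod (k \<xi> * v \<xi>) \<le> C * (sqrt (w \<xi>) * cmod (v \<xi>))"
      using mult_right_mono[OF k[of \<xi>], of "cmod (v \<xi>)"] by (simp add: norm_mult mult_ac)
  qed (use w in simp)
  also have "\<dots> = C * L2_set (\<lambda>\<xi>. sqrt (w \<xi>) * cmod (v \<xi>)) F"
    using C by (simp add: L2_set_right_distrib)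
  also have "\<dots> \<le> C * M"
    using wboundD[OF b F] C by (rule mult_left_mono)
  finally show "L2_set (\<lambda>\<xi>. sqrt (w' \<xi>) * cmod (k \<xi> * v \<xi>)) F \<le> C * M" .
qed

lemma wbound_scale:
  assumes w: "\<And>\<xi>. 0 \<le> w \<xi>" and "wbound w v M"
  shows "wbound w (\<lambda>\<xi>. z * v \<xi>) (cmod z * M)"
  using w assms(2) by (intro wbound_mult[where w = w]) (auto simp: mult.commute)

lemma wbound_minus: "wbound w v M \<Longrightarrow> wbound w (\<lambda>\<xi>. - v \<xi>) M"
  by (simp add: wbound_def)

lemma wbound_diff:
  assumes w: "\<And>\<xi>. 0 \<le> w \<xi>" and "wbound w u M" "wbound w v N"
  shows "wbound w (\<lambda>\<xi>. u \<xi> - v \<xi>) (M + N)"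
  using wbound_add[OF w assms(2) wbound_minus[OF assms(3)]] by simp

lemma wbound_diff_commute: "wbound w (\<lambda>\<xi>. u \<xi> - v \<xi>) M \<Longrightarrow> wbound w (\<lambda>\<xi>. v \<xi> - u \<xi>) M"
  by (simp add: wbound_def norm_minus_commute)

lemma wbound_weight_mono:
  assumes "\<And>\<xi>. 0 \<le> w' \<xi>" "\<And>\<xi>. w' \<xi> \<le> w \<xi>" "wbound w v M"
  shows "wbound w' v M"
  using wbound_mult[of w' "\<lambda>_. 1" 1 w v M] assms by simp

text \<open>A Fatou property: a finite sum depends continuously on its finitely many coefficients,
  so coefficientwise convergence preserves the bound even without convergence in norm.\<close>

lemma wbound_tendsto:
  fixes v :: "'b \<Rightarrow> 'i \<Rightarrow> complex"
  assumes lim: "\<And>\<xi>. ((\<lambda>x. v x \<xi>) \<longlongrightarrow> l \<xi>) F" and F: "F \<noteq> bot"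
    and b: "eventually (\<lambda>x. wbound w (v x) M) F"
  shows "wbound w l M"
proof (rule wboundI)
  fix A :: "'i set" assume A: "finite A"
  have "((\<lambda>x. L2_set (\<lambda>\<xi>. sqrt (w \<xi>) * cmod (v x \<xi>)) A)
       \<longlongrightarrow> L2_set (\<lambda>\<xi>. sqrt (w \<xi>) * cmod (l \<xi>)) A) F"
    unfolding L2_set_def by (intro tendsto_intros lim)
  thus "L2_set (\<lambda>\<xi>. sqrt (w \<xi>) * cmod (l \<xi>)) A \<le> M"
    by (rule tendsto_upperbound[OF _ _ F]) (use b A in \<open>auto elim!: eventually_mono dest: wboundD\<close>)
qed

text \<open>Testing against v itself; this transfers scalar mean value and averaging arguments to the
  weighted norm.\<close>

lemma wbound_dual:
  assumes w: "\<And>\<xi>. 0 \<le> w \<xi>" and M: "0 \<le> M"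
    and d: "\<And>F c. finite F \<Longrightarrow> (\<And>x. wbound w x M \<Longrightarrow> 
        (\<Sum>\<xi>\<in>F. w \<xi> * Re (cnj (c \<xi>) * x \<xi>)) \<le> M * sqrt (\<Sum>\<xi>\<in>F. w \<xi> * (cmod (c \<xi>))\<^sup>2)) \<Longrightarrow>
        (\<Sum>\<xi>\<in>F. w \<xi> * Re (cnj (c \<xi>) * v \<xi>)) \<le> M * sqrt (\<Sum>\<xi>\<in>F. w \<xi> * (cmod (c \<xi>))\<^sup>2)"
  shows "wbound w v M"
proof (rule wboundI)
  fix F :: "'a set" assume F: "finite F"
  let ?S = "sqrt (\<Sum>\<xi>\<in>F. w \<xi> * (cmod (v \<xi>))\<^sup>2)"
  have S0: "0 \<le> (\<Sum>\<xi>\<in>F. w \<xi> * (cmod (v \<xi>))\<^sup>2)" using w by (intro sum_nonneg) auto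
  have le: "(\<Sum>\<xi>\<in>F. w \<xi> * Re (cnj (v \<xi>) * v \<xi>)) \<le> M * ?S"
  proof (rule d[OF F])
    fix x assume x: "wbound w x M"
    have "(\<Sum>\<xi>\<in>F. w \<xi> * Re (cnj (v \<xi>) * x \<xi>))
      \<le> (\<Sum>\<xi>\<in>F. (sqrt (w \<xi>) * cmod (x \<xi>)) * (sqrt (w \<xi>) * cmod (v \<xi>)))"
    proof (rule sum_mono)
      fix \<xi>
      have "w \<xi> * Re (cnj (v \<xi>) * x \<xi>) \<le> w \<xi> * (cmod (v \<xi>) * cmod (x \<xi>))"
        using w[of \<xi>] complex_Re_le_cmod[of "cnj (v \<xi>) * x \<xi>"]
        by (intro mult_left_mono) (auto simp: norm_mult)
      also have "\<dots> = (sqrt (w \<xi>) * sqrt (w \<xi>)) * (cmod (v \<xi>) * cmod (x \<xi>))"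
        using w[of \<xi>] by simp
      finally show "w \<xi> * Re (cnj (v \<xi>) * x \<xi>) \<le> (sqrt (w \<xi>) * cmod (x \<xi>)) * (sqrt (w \<xi>) * cmod (v \<xi>))"
        by (simp only: mult_ac)
    qed
    also have "\<dots> \<le> (\<Sum>\<xi>\<in>F. \<bar>sqrt (w \<xi>) * cmod (x \<xi>)\<bar> * \<bar>sqrt (w \<xi>) * cmod (v \<xi>)\<bar>)"
      using w by (intro sum_mono) auto
    also have "\<dots> \<le> L2_set (\<lambda>\<xi>. sqrt (w \<xi>) * cmod (x \<xi>)) F * L2_set (\<lambda>\<xi>. sqrt (w \<xi>) * cmod (v \<xi>)) F"
      by (rule L2_set_mult_ineq)
    also have "\<dots> \<le> M * ?S"
      using wboundD[OF x F] S0 by (simp add: L2_set_weighted[OF w, where v = v] mult_right_mono)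
    finally show "(\<Sum>\<xi>\<in>F. w \<xi> * Re (cnj (v \<xi>) * x \<xi>)) \<le> M * ?S" .
  qed
  have "Re (cnj z * z) = (cmod z)\<^sup>2" for z
    by (simp only: cmod_power2) (simp add: power2_eq_square)
  hence "(\<Sum>\<xi>\<in>F. w \<xi> * Re (cnj (v \<xi>) * v \<xi>)) = ?S * ?S"
    using S0 by (simp only: real_sqrt_mult_self abs_of_nonneg)
  with le have "?S * ?S \<le> M * ?S" by metis
  have "x \<le> M" if "x * x \<le> M * x" "0 \<le> x" for x
    using that M by (cases "x = 0") auto
  from this[OF \<open>?S * ?S \<le> M * ?S\<close>] have "?S \<le> M" using S0 by simp
  thus "L2_set (\<lambda>\<xi>. sqrt (w \<xi>) * cmod (v \<xi>)) F \<le> M"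
    by (simp add: L2_set_weighted[OF w])
qed

text \<open>Pairing with a fixed finite vector gives a real function, to which the scalar mean value
  theorem applies. The intermediate time may depend on that vector, because \<open>D'\<close> is
  bounded at every time.\<close>

lemma wbound_mvt:
  fixes D D' :: "real \<Rightarrow> 'i \<Rightarrow> complex"
  assumes w: "\<And>\<xi>. 0 \<le> w \<xi>" and ab: "a \<le> b"
    and der: "\<And>t \<xi>. t \<in> {a..b} \<Longrightarrow> ((\<lambda>t. D t \<xi>) has_vector_derivative D' t \<xi>) (at t within {a..b})"
    and b: "\<And>t. t \<in> {a..b} \<Longrightarrow> wbound w (D' t) M"
  shows "wbound w (\<lambda>\<xi>. D b \<xi> - D a \<xi>) (M * (b - a))"
proof (cases "a = b")
  case True
  thus ?thesis by (simp add: wbound_zero)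
next
  case False
  hence lt: "a < b" using ab by simp
  have M: "0 \<le> M" using b[of a] ab by (auto intro: wbound_nonneg)
  let ?v = "\<lambda>\<xi>. (D b \<xi> - D a \<xi>) / complex_of_real (b - a)"
  have "wbound w ?v M"
  proof (rule wbound_dual[OF w M])
    fix F :: "'i set" and c :: "'i \<Rightarrow> complex"
    assume F: "finite F"
    assume test: "\<And>x. wbound w x M \<Longrightarrow> 
        (\<Sum>\<xi>\<in>F. w \<xi> * Re (cnj (c \<xi>) * x \<xi>)) \<le> M * sqrt (\<Sum>\<xi>\<in>F. w \<xi> * (cmod (c \<xi>))\<^sup>2)"
    define h where "h t = (\<Sum>\<xi>\<in>F. w \<xi> * Re (cnj (c \<xi>) * D t \<xi>))" for t
    define h' where "h' t = (\<Sum>\<xi>\<in>F. w \<xi> * Re (cnj (c \<xi>) * D' t \<xi>))" for t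
    have dh: "(h has_derivative (\<lambda>x. h' t * x)) (at t within {a..b})" if "a \<le> t" "t \<le> b" for t
    proof -
      have "(h has_vector_derivative h' t) (at t within {a..b})"
        unfolding h_def h'_def
        by (intro has_vector_derivative_sum has_vector_derivative_mult_left bounded_linear.has_vector_derivative[OF bounded_linear_Re] derivative_intros der)
           (use that in auto)
      thus ?thesis by (simp add: has_vector_derivative_def mult.commute)
    qed
    obtain x where x: "x \<in> {a<..<b}" "h b - h a = h' x * (b - a)"
      using mvt_simple[OF lt dh] by blast
    have "(\<Sum>\<xi>\<in>F. w \<xi> * Re (cnj (c \<xi>) * ?v \<xi>)) = (h b - h a) / (b - a)"
      unfolding h_def sum_subtractf[symmetric] sum_divide_distrib
      using lt by (intro sum.cong refl) 
       (simp add: Re_divide_of_real[symmetric] field_simps del: of_real_diff Re_divide_of_real)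
    also have "\<dots> = h' x" using x lt by simp
    also have "\<dots> \<le> M * sqrt (\<Sum>\<xi>\<in>F. w \<xi> * (cmod (c \<xi>))\<^sup>2)"
      unfolding h'_def using x by (intro test b) auto
    finally show "(\<Sum>\<xi>\<in>F. w \<xi> * Re (cnj (c \<xi>) * ?v \<xi>)) \<le> M * sqrt (\<Sum>\<xi>\<in>F. w \<xi> * (cmod (c \<xi>))\<^sup>2)" .
  qed
  from wbound_scale[OF w this, of "complex_of_real (b - a)"]
  show ?thesis using lt by (simp add: mult.commute del: of_real_diff)
qed

text \<open>Balls are convex: after pairing with a fixed vector this is a real inequality integrated
  against a density of mass one.\<close>

lemma wbound_average:
  fixes g :: "real \<Rightarrow> 'i \<Rightarrow> complex" and k :: "real \<Rightarrow> real"
  assumes w: "\<And>\<xi>. 0 \<le> w \<xi>"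
    and cg: "\<And>\<xi>. continuous_on {l..r} (\<lambda>t. g t \<xi>)" and ck: "continuous_on {l..r} k"
    and k: "\<And>t. 0 \<le> k t" "(k has_integral 1) {l..r}"
    and b: "\<And>t. t \<in> {l..r} \<Longrightarrow> wbound w (g t) M" and M: "0 \<le> M"
  shows "wbound w (\<lambda>\<xi>. integral {l..r} (\<lambda>t. g t \<xi> * complex_of_real (k t))) M"
proof (rule wbound_dual[OF w M])
  fix F :: "'i set" and c :: "'i \<Rightarrow> complex"
  assume F: "finite F"
  let ?N = "sqrt (\<Sum>\<xi>\<in>F. w \<xi> * (cmod (c \<xi>))\<^sup>2)"
  assume test: "\<And>x. wbound w x M \<Longrightarrow> (\<Sum>\<xi>\<in>F. w \<xi> * Re (cnj (c \<xi>) * x \<xi>)) \<le> M * ?N"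
  let ?I = "\<lambda>\<xi>. integral {l..r} (\<lambda>t. g t \<xi> * complex_of_real (k t))"
  have "((\<lambda>t. g t \<xi> * complex_of_real (k t)) has_integral ?I \<xi>) {l..r}" for \<xi>
    by (intro integrable_integral integrable_continuous_real continuous_intros cg ck)
  hence "((\<lambda>t. \<Sum>\<xi>\<in>F. w \<xi> * Re (cnj (c \<xi>) * (g t \<xi> * complex_of_real (k t)))) 
     has_integral (\<Sum>\<xi>\<in>F. w \<xi> * Re (cnj (c \<xi>) * ?I \<xi>))) {l..r}"
    by (intro has_integral_sum F has_integral_mult_right has_integral_Re)
  moreover have "((\<lambda>t. M * ?N * k t) has_integral (M * ?N * 1)) {l..r}"
    by (intro has_integral_mult_right k)
  moreover have "(\<Sum>\<xi>\<in>F. w \<xi> * Re (cnj (c \<xi>) * (g t \<xi> * complex_of_real (k t)))) \<le> M * ?N * k t"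
    if "t \<in> {l..r}" for t
  proof -
    have "(\<Sum>\<xi>\<in>F. w \<xi> * Re (cnj (c \<xi>) * (g t \<xi> * complex_of_real (k t)))) 
       = (\<Sum>\<xi>\<in>F. w \<xi> * Re (cnj (c \<xi>) * g t \<xi>)) * k t"
      unfolding sum_distrib_right by (intro sum.cong refl) (simp add: algebra_simps)
    also have "\<dots> \<le> M * ?N * k t"
      using test[OF b[OF that]] k(1) by (rule mult_right_mono)
    finally show ?thesis .
  qed
  ultimately show "(\<Sum>\<xi>\<in>F. w \<xi> * Re (cnj (c \<xi>) * ?I \<xi>)) \<le> M * ?N"
    by (metis (no_types, lifting) has_integral_le mult.right_neutral)
qed

section \<open>The energy estimate\<close>


text \<open>\<open>\<Theta>\<close> is a primitive of the growth rate \<open>\<theta>\<close>, so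
  \<open>L\<close> bounds its integral over any initial interval up to the starting value. Carrying
  the primitive instead of an integral avoids any integrability question for \<open>B'\<close>, and
  the rate may be large at single times as long as \<open>\<Theta>\<close> stays below
  \<open>L\<close>.\<close>

definition admissible :: "(real \<Rightarrow> real) \<Rightarrow> real \<Rightarrow> real \<Rightarrow> real \<Rightarrow> real \<Rightarrow> bool" where
  "admissible b T l L K \<longleftrightarrow> (\<exists>B B' \<Theta> \<theta>. \<forall>t\<in>{0..T}.
     (B has_real_derivative B' t) (at t within {0..T}) \<and>
     (\<Theta> has_real_derivative \<theta> t) (at t within {0..T}) \<and>
     0 < B t \<and> B t \<le> K \<and> 0 \<le> \<Theta> t \<and> \<Theta> t \<le> L \<and>
     \<bar>B' t\<bar> / B t + sqrt l * \<bar>B t - b t\<bar> / sqrt (B t) \<le> \<theta> t)"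

lemma cmod_power2_has_real_derivative:
  assumes "(v has_vector_derivative v') (at t within S)"
  shows "((\<lambda>t. (cmod (v t))\<^sup>2) has_real_derivative 2 * (v t \<bullet> v')) (at t within S)"
proof -
  have "((\<lambda>t. v t \<bullet> v t) has_derivative (\<lambda>h. v t \<bullet> (h *\<^sub>R v') + (h *\<^sub>R v') \<bullet> v t)) (at t within S)"
    using assms unfolding has_vector_derivative_def by (intro has_derivative_inner) auto
  thus ?thesis
    unfolding has_field_derivative_def power2_norm_eq_inner
    by (rule has_derivative_eq_rhs) (auto simp: fun_eq_iff inner_commute)
qed

text \<open>The left side is the derivative of |y|^2 + (1 + l B) |x|^2 along x' = y, y' = g - b l x.
  The term with B' and the cross term 2 l (B - b) (x . y), left over because the energy contains B
  and not b, give the two parts of \<open>\<theta>\<close>. The added 2 pays for the pairing with g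
  and for the 1 in the energy, which keeps control of |x| when l = 0.\<close>

lemma energy_inequality:
  fixes x y g :: complex and l b B B' :: real
  assumes l: "0 \<le> l" and B: "0 < B"
    and \<theta>: "\<bar>B'\<bar> / B + sqrt l * \<bar>B - b\<bar> / sqrt B \<le> \<theta>"
  shows "2 * (y \<bullet> (g - complex_of_real (b * l) * x)) + (l * B') * (cmod x)\<^sup>2 + (1 + l * B) * (2 * (x \<bullet> y))
    \<le> (cmod g)\<^sup>2 + (\<theta> + 2) * ((cmod y)\<^sup>2 + (1 + l * B) * (cmod x)\<^sup>2)"
proof -
  define p q where "p = cmod x" and "q = cmod y"
  define t1 t2 where "t1 = \<bar>B'\<bar> / B" and "t2 = sqrt l * \<bar>B - b\<bar> / sqrt B"
  have nn: "0 \<le> p" "0 \<le> q" "0 \<le> t1" "0 \<le> t2" using l B by (auto simp: p_def q_def t1_def t2_def)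
  have xy: "\<bar>x \<bullet> y\<bar> \<le> p * q" unfolding p_def q_def by (rule Cauchy_Schwarz_ineq2)
  have eq: "y \<bullet> (g - complex_of_real (b * l) * x) = y \<bullet> g - b * l * (x \<bullet> y)"
    by (simp add: inner_diff_right inner_complex_def algebra_simps)
  have 1: "2 * (y \<bullet> g) \<le> q\<^sup>2 + (cmod g)\<^sup>2"
  proof -
    have "y \<bullet> g \<le> q * cmod g" unfolding q_def by (rule norm_cauchy_schwarz)
    thus ?thesis using sum_squares_bound[of q "cmod g"] by (simp add: mult_ac)
  qed
  have 2: "2 * (x \<bullet> y) \<le> p\<^sup>2 + q\<^sup>2"
    using xy sum_squares_bound[of p q] by linarith
  have 3: "l * B' * p\<^sup>2 \<le> t1 * (l * B * p\<^sup>2)"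
  proof -
    have "t1 * (l * B * p\<^sup>2) = l * \<bar>B'\<bar> * p\<^sup>2" using B by (simp add: t1_def)
    moreover have "l * B' * p\<^sup>2 \<le> l * \<bar>B'\<bar> * p\<^sup>2"
      using l by (intro mult_right_mono mult_left_mono) auto
    ultimately show ?thesis by linarith
  qed
  have 4: "2 * l * (B - b) * (x \<bullet> y) \<le> t2 * (l * B * p\<^sup>2 + q\<^sup>2)"
  proof -
    have "2 * l * (B - b) * (x \<bullet> y) \<le> 2 * l * \<bar>B - b\<bar> * (p * q)"
    proof -
      have "(B - b) * (x \<bullet> y) \<le> \<bar>B - b\<bar> * \<bar>x \<bullet> y\<bar>"
        by (simp flip: abs_mult)
      also have "\<dots> \<le> \<bar>B - b\<bar> * (p * q)"
        using xy by (rule mult_left_mono) simp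
      finally have "2 * l * ((B - b) * (x \<bullet> y)) \<le> 2 * l * (\<bar>B - b\<bar> * (p * q))"
        using l by (intro mult_left_mono) auto
      thus ?thesis by (simp only: mult.assoc)
    qed
    \<comment> \<open>The factor l is split so that sqrt (l B) |x| meets |y|, two quantities that
      the energy controls; hence sqrt B, and not B, in the denominator of \<open>t2\<close>.\<close>
    also have "\<dots> = t2 * (2 * (sqrt l * sqrt B * p) * q)"
    proof -
      have "l * \<bar>B - b\<bar> = t2 * (sqrt l * sqrt B)"
        using l B by (simp add: t2_def)
      thus ?thesis by (simp add: algebra_simps)
    qed
    also have "\<dots> \<le> t2 * ((sqrt l * sqrt B * p)\<^sup>2 + q\<^sup>2)"
      using sum_squares_bound nn by (intro mult_left_mono) auto
    also have "(sqrt l * sqrt B * p)\<^sup>2 = l * B * p\<^sup>2"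
      using l B by (simp add: power_mult_distrib)
    finally show ?thesis .
  qed
  have lB: "0 \<le> l * B * p\<^sup>2" using l B by simp
  have "t1 * (l * B * p\<^sup>2) + t2 * (l * B * p\<^sup>2 + q\<^sup>2) \<le> (t1 + t2) * (q\<^sup>2 + (1 + l * B) * p\<^sup>2)"
    using nn lB by (simp add: algebra_simps)
  also have "\<dots> \<le> \<theta> * (q\<^sup>2 + (1 + l * B) * p\<^sup>2)"
    using \<theta> lB l B unfolding t1_def t2_def by (intro mult_right_mono) auto
  finally have "t1 * (l * B * p\<^sup>2) + t2 * (l * B * p\<^sup>2 + q\<^sup>2) \<le> \<theta> * (q\<^sup>2 + (1 + l * B) * p\<^sup>2)" .
  moreover have "q\<^sup>2 + (p\<^sup>2 + q\<^sup>2) \<le> 2 * (q\<^sup>2 + (1 + l * B) * p\<^sup>2)"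
    using lB by (simp add: algebra_simps)
  ultimately show ?thesis
    using 1 2 3 4 unfolding eq p_def[symmetric] q_def[symmetric] by (simp add: algebra_simps)
qed

text \<open>The integrating factor exp (- \<Theta> - 2t) reduces the energy inequality to E' \<le>
  |g|^2; since 0 \<le> \<Theta> \<le> L, it lies between exp (- L - 2T) and 1. The result is left in
  differential form so that modes can be summed before integrating in time.\<close>

lemma mode_energy:
  fixes v0 v1 v2 g :: "real \<Rightarrow> complex"
  assumes l: "0 \<le> l" and adm: "admissible b T l L K" and T: "0 \<le> T"
    and d0: "\<And>t. t \<in> {0..T} \<Longrightarrow> (v0 has_vector_derivative v1 t) (at t within {0..T})"
    and d1: "\<And>t. t \<in> {0..T} \<Longrightarrow> (v1 has_vector_derivative v2 t) (at t within {0..T})"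
    and eq: "\<And>t. t \<in> {0..T} \<Longrightarrow> v2 t = g t - complex_of_real (b t * l) * v0 t"
  shows "\<exists>E E'. (\<forall>t\<in>{0..T}. (E has_real_derivative E' t) (at t within {0..T}) \<and> E' t \<le> (cmod (g t))\<^sup>2 \<and>
           exp (- L - 2 * T) * ((cmod (v0 t))\<^sup>2 + (cmod (v1 t))\<^sup>2) \<le> E t) \<and>
           E 0 \<le> (1 + l * K) * (cmod (v0 0))\<^sup>2 + (cmod (v1 0))\<^sup>2"
proof -
  from adm obtain B B' \<Theta> \<theta> where a: "\<And>t. t \<in> {0..T} \<Longrightarrow>
     (B has_real_derivative B' t) (at t within {0..T}) \<and>
     (\<Theta> has_real_derivative \<theta> t) (at t within {0..T}) \<and>
     0 < B t \<and> B t \<le> K \<and> 0 \<le> \<Theta> t \<and> \<Theta> t \<le> L \<and>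
     \<bar>B' t\<bar> / B t + sqrt l * \<bar>B t - b t\<bar> / sqrt (B t) \<le> \<theta> t"
    unfolding admissible_def by metis
  define Q where "Q t = (cmod (v1 t))\<^sup>2 + (1 + l * B t) * (cmod (v0 t))\<^sup>2" for t
  define Q' where "Q' t = 2 * (v1 t \<bullet> v2 t) + ((1 + l * B t) * (2 * (v0 t \<bullet> v1 t)) + (l * B' t) * (cmod (v0 t))\<^sup>2)" for t
  define W where "W t = exp (- \<Theta> t - 2 * t)" for t
  define E where "E t = W t * Q t" for t
  define E' where "E' t = W t * (Q' t - (\<theta> t + 2) * Q t)" for t
  have Qd: "(Q has_real_derivative Q' t) (at t within {0..T})" if "t \<in> {0..T}" for t
  proof -
    have "((\<lambda>t. 1 + l * B t) has_real_derivative l * B' t) (at t within {0..T})"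
      using a[OF that] by (auto intro!: derivative_eq_intros)
    thus ?thesis
      unfolding Q_def Q'_def
      by (intro DERIV_add DERIV_mult' cmod_power2_has_real_derivative d0[OF that] d1[OF that])
  qed
  have Wd: "(W has_real_derivative - (\<theta> t + 2) * W t) (at t within {0..T})" if "t \<in> {0..T}" for t
    unfolding W_def using a[OF that] by (auto intro!: derivative_eq_intros)
  have W1: "W t \<le> 1" "exp (- L - 2 * T) \<le> W t" "0 \<le> W t" if "t \<in> {0..T}" for t
    using a[OF that] that by (auto simp: W_def)
  have 1: "(E has_real_derivative E' t) (at t within {0..T})" if "t \<in> {0..T}" for t
    unfolding E_def E'_def using DERIV_mult'[OF Wd[OF that] Qd[OF that]] by (simp add: algebra_simps)
  have 2: "E' t \<le> (cmod (g t))\<^sup>2" if t: "t \<in> {0..T}" for t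
  proof -
    have "Q' t \<le> (cmod (g t))\<^sup>2 + (\<theta> t + 2) * Q t"
      using energy_inequality[OF l, of "B t" "B' t" "b t" "\<theta> t" "v1 t" "g t" "v0 t"] a[OF t]
      unfolding Q'_def Q_def eq[OF t] by simp
    hence "E' t \<le> W t * (cmod (g t))\<^sup>2"
      unfolding E'_def using W1(3)[OF t] by (intro mult_left_mono) auto
    also have "\<dots> \<le> 1 * (cmod (g t))\<^sup>2" using W1[OF t] by (intro mult_right_mono) auto
    finally show ?thesis by simp
  qed
  have lB: "0 \<le> l * B t" if "t \<in> {0..T}" for t using a[OF that] l by simp
  have 3: "exp (- L - 2 * T) * ((cmod (v0 t))\<^sup>2 + (cmod (v1 t))\<^sup>2) \<le> E t" if t: "t \<in> {0..T}" for t
  proof -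
    have "(cmod (v0 t))\<^sup>2 + (cmod (v1 t))\<^sup>2 \<le> Q t"
      unfolding Q_def using mult_nonneg_nonneg[OF lB[OF t] zero_le_power2, of "cmod (v0 t)"]
      by (simp add: algebra_simps)
    thus ?thesis unfolding E_def using W1[OF t] by (intro mult_mono) auto
  qed
  have 4: "E 0 \<le> (1 + l * K) * (cmod (v0 0))\<^sup>2 + (cmod (v1 0))\<^sup>2"
  proof -
    have z: "0 \<in> {0..T}" using T by simp
    have "E 0 \<le> 1 * Q 0"
      unfolding E_def using W1[OF z] lB[OF z] by (intro mult_right_mono) (auto simp: Q_def)
    also have "l * B 0 \<le> l * K" using a[OF z] l by (intro mult_left_mono) auto
    hence "1 * Q 0 \<le> (1 + l * K) * (cmod (v0 0))\<^sup>2 + (cmod (v1 0))\<^sup>2"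
      unfolding Q_def by (simp add: mult_right_mono)
    finally show ?thesis .
  qed
  from 1 2 3 4 show ?thesis by blast
qed

text \<open>The mean value theorem is applied to a finite sum over the modes and not to each mode.
  The intermediate time is then common to all of them, and the norm bound M on the source at this
  one time is enough; times depending on the mode would leave the sum of the |g|^2
  uncontrolled.\<close>

lemma energy_wbound:
  fixes D :: "nat \<Rightarrow> real \<Rightarrow> 'i \<Rightarrow> complex"
  assumes l: "\<And>\<xi>. 0 \<le> l \<xi>" and T: "0 \<le> T" and w: "\<And>\<xi>. 0 \<le> w \<xi>"
    and adm: "\<And>\<xi>. admissible b T (l \<xi>) (L \<xi>) K" and K: "0 \<le> K"
    and d0: "\<And>t \<xi>. t \<in> {0..T} \<Longrightarrow> ((\<lambda>t. D 0 t \<xi>) has_vector_derivative D 1 t \<xi>) (at t within {0..T})"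
    and d1: "\<And>t \<xi>. t \<in> {0..T} \<Longrightarrow> ((\<lambda>t. D 1 t \<xi>) has_vector_derivative D 2 t \<xi>) (at t within {0..T})"
    and eq: "\<And>t \<xi>. t \<in> {0..T} \<Longrightarrow> D 2 t \<xi> = g t \<xi> - complex_of_real (b t * l \<xi>) * D 0 t \<xi>"
    and g: "\<And>t. t \<in> {0..T} \<Longrightarrow> wbound w (g t) M"
    and M0: "wbound w (\<lambda>\<xi>. complex_of_real (sqrt (1 + l \<xi> * K)) * D 0 0 \<xi>) M0"
    and M1: "wbound w (D 1 0) M1"
    and w': "\<And>\<xi>. 0 \<le> w' \<xi>" "\<And>\<xi>. w' \<xi> \<le> w \<xi> * exp (- L \<xi> - 2 * T)"
    and t: "t \<in> {0..T}" and i: "i \<le> 1"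
  shows "wbound w' (D i t) (M0 + M1 + sqrt T * M)"
proof -
  have "\<exists>E E'. (\<forall>t\<in>{0..T}. (E has_real_derivative E' t) (at t within {0..T}) \<and> E' t \<le> (cmod (g t \<xi>))\<^sup>2 \<and>
           exp (- L \<xi> - 2 * T) * ((cmod (D 0 t \<xi>))\<^sup>2 + (cmod (D 1 t \<xi>))\<^sup>2) \<le> E t) \<and>
           E 0 \<le> (1 + l \<xi> * K) * (cmod (D 0 0 \<xi>))\<^sup>2 + (cmod (D 1 0 \<xi>))\<^sup>2" for \<xi>
    by (rule mode_energy[OF l adm T d0 d1 eq])
  then obtain E E' where
    E: "\<And>\<xi> t. t \<in> {0..T} \<Longrightarrow> (E \<xi> has_real_derivative E' \<xi> t) (at t within {0..T})"
    and E': "\<And>\<xi> t. t \<in> {0..T} \<Longrightarrow> E' \<xi> t \<le> (cmod (g t \<xi>))\<^sup>2"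
    and Elow: "\<And>\<xi> t. t \<in> {0..T} \<Longrightarrow> exp (- L \<xi> - 2 * T) * ((cmod (D 0 t \<xi>))\<^sup>2 + (cmod (D 1 t \<xi>))\<^sup>2) \<le> E \<xi> t"
    and E0: "\<And>\<xi>. E \<xi> 0 \<le> (1 + l \<xi> * K) * (cmod (D 0 0 \<xi>))\<^sup>2 + (cmod (D 1 0 \<xi>))\<^sup>2"
    by metis
  have nn: "0 \<le> M0" "0 \<le> M1" "0 \<le> M"
    using wbound_nonneg[OF M0] wbound_nonneg[OF M1] wbound_nonneg[OF g[OF t]] by auto
  show ?thesis
  proof (rule wboundI_sum[OF w'(1)])
    show "0 \<le> M0 + M1 + sqrt T * M" using nn T by simp
    fix F :: "'i set" assume F: "finite F"
    define \<Phi> where "\<Phi> t = (\<Sum>\<xi>\<in>F. w \<xi> * E \<xi> t)" for t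
    define \<Phi>' where "\<Phi>' t = (\<Sum>\<xi>\<in>F. w \<xi> * E' \<xi> t)" for t
    have d\<Phi>: "(\<Phi> has_derivative (\<lambda>x. \<Phi>' s * x)) (at s within {0..t})" if "0 \<le> s" "s \<le> t" for s
    proof -
      have s: "s \<in> {0..T}" using t that by simp
      have "(\<Phi> has_real_derivative \<Phi>' s) (at s within {0..T})"
        unfolding \<Phi>_def \<Phi>'_def by (intro DERIV_sum DERIV_cmult E s)
      hence "(\<Phi> has_real_derivative \<Phi>' s) (at s within {0..t})"
        by (rule DERIV_subset) (use t in auto)
      thus ?thesis by (simp add: has_field_derivative_def)
    qed
    have \<Phi>'_le: "\<Phi>' s \<le> M\<^sup>2" if "s \<in> {0..T}" for s
    proof -
      have "\<Phi>' s \<le> (\<Sum>\<xi>\<in>F. w \<xi> * (cmod (g s \<xi>))\<^sup>2)"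
        unfolding \<Phi>'_def by (intro sum_mono mult_left_mono E' w that)
      also have "\<dots> \<le> M\<^sup>2" by (rule wboundD_sum[OF w g[OF that] F])
      finally show ?thesis .
    qed
    have "\<Phi> t \<le> \<Phi> 0 + T * M\<^sup>2"
    proof (cases "t = 0")
      case False
      hence "0 < t" using t by simp
      then obtain x where x: "x \<in> {0<..<t}" "\<Phi> t - \<Phi> 0 = \<Phi>' x * (t - 0)"
        using mvt_simple[of 0 t \<Phi> "\<lambda>t x. \<Phi>' t * x"] d\<Phi> by blast
      have "\<Phi>' x * t \<le> M\<^sup>2 * t" using x t by (intro mult_right_mono \<Phi>'_le) auto
      also have "\<dots> \<le> M\<^sup>2 * T" using t by (intro mult_left_mono) auto
      finally show ?thesis using x by (simp add: mult_ac)
    qed (use T in simp)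
    also have "\<Phi> 0 \<le> M0\<^sup>2 + M1\<^sup>2"
    proof -
      have "\<Phi> 0 \<le> (\<Sum>\<xi>\<in>F. w \<xi> * ((1 + l \<xi> * K) * (cmod (D 0 0 \<xi>))\<^sup>2 + (cmod (D 1 0 \<xi>))\<^sup>2))"
        unfolding \<Phi>_def by (intro sum_mono mult_left_mono E0 w)
      also have "\<dots> = (\<Sum>\<xi>\<in>F. w \<xi> * (cmod (complex_of_real (sqrt (1 + l \<xi> * K)) * D 0 0 \<xi>))\<^sup>2)
          + (\<Sum>\<xi>\<in>F. w \<xi> * (cmod (D 1 0 \<xi>))\<^sup>2)"
        using l K by (simp add: norm_mult power_mult_distrib distrib_left sum.distrib)
      also have "\<dots> \<le> M0\<^sup>2 + M1\<^sup>2"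
        by (intro add_mono wboundD_sum w M0 M1 F)
      finally show ?thesis .
    qed
    also have "(\<Sum>\<xi>\<in>F. w' \<xi> * (cmod (D i t \<xi>))\<^sup>2) \<le> \<Phi> t"
      unfolding \<Phi>_def
    proof (rule sum_mono)
      fix \<xi>
      have "w' \<xi> * (cmod (D i t \<xi>))\<^sup>2 \<le> (w \<xi> * exp (- L \<xi> - 2 * T)) * ((cmod (D 0 t \<xi>))\<^sup>2 + (cmod (D 1 t \<xi>))\<^sup>2)"
        using w'[of \<xi>] w[of \<xi>] i by (intro mult_mono) (auto simp: le_Suc_eq)
      also have "\<dots> \<le> w \<xi> * E \<xi> t"
        using Elow[OF t, of \<xi>] w[of \<xi>] by (simp add: mult.assoc mult_left_mono)
      finally show "w' \<xi> * (cmod (D i t \<xi>))\<^sup>2 \<le> w \<xi> * E \<xi> t" .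
    qed
    finally have "(\<Sum>\<xi>\<in>F. w' \<xi> * (cmod (D i t \<xi>))\<^sup>2) \<le> M0\<^sup>2 + M1\<^sup>2 + T * M\<^sup>2" by simp
    also have "\<dots> \<le> (M0 + M1 + sqrt T * M)\<^sup>2"
    proof -
      have "a\<^sup>2 + b\<^sup>2 + c\<^sup>2 \<le> (a + b + c)\<^sup>2" if "0 \<le> a" "0 \<le> b" "0 \<le> c" for a b c :: real
      proof -
        have "(a + b + c)\<^sup>2 = a\<^sup>2 + b\<^sup>2 + c\<^sup>2 + 2 * (a * b + a * c + b * c)"
          by (simp add: power2_eq_square algebra_simps)
        thus ?thesis using that by simp
      qed
      from this[of M0 M1 "sqrt T * M"] show ?thesis using nn T by (simp add: power_mult_distrib)
    qed
    finally show "(\<Sum>\<xi>\<in>F. w' \<xi> * (cmod (D i t \<xi>))\<^sup>2) \<le> (M0 + M1 + sqrt T * M)\<^sup>2" .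
  qed
qed


section \<open>Exponential weights and the loss in the exponent\<close>

lemma wt_nonneg: "0 \<le> wt s mu \<eta> \<xi>"
  by (simp add: wt_def)

lemma sqrt_wt: "sqrt (wt s mu \<eta> \<xi>) = exp (- (\<eta> * mu \<xi> powr (1 / (2 * s))))"
  unfolding wt_def by (rule real_sqrt_unique) (simp_all flip: exp_double)

lemma wt_add: "wt s mu (\<eta> + d) \<xi> = wt s mu \<eta> \<xi> * exp (- (2 * d * mu \<xi> powr (1 / (2 * s))))"
  by (simp add: wt_def algebra_simps flip: exp_add)

lemma wt_antimono: "\<eta> \<le> \<eta>' \<Longrightarrow> wt s mu \<eta>' \<xi> \<le> wt s mu \<eta> \<xi>"
  by (simp add: wt_def mult_right_mono)

lemma wbound_wt_mono: "wbound (wt s mu \<eta>) v M \<Longrightarrow> \<eta> \<le> \<eta>' \<Longrightarrow> wbound (wt s mu \<eta>') v M"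
  by (rule wbound_weight_mono[OF wt_nonneg wt_antimono])

text \<open>With y = x powr (1/(2s)) this is the inequality z \<le> exp z at z = d y/(2s), raised to
  the power 2s.\<close>

lemma mult_exp_powr_le:
  fixes d s :: real
  assumes "0 < d" "0 < s" "0 < x"
  shows "x * exp (- (d * x powr (1 / (2 * s)))) \<le> (2 * s / d) powr (2 * s)"
proof -
  define y where "y = x powr (1 / (2 * s))"
  have x: "x = y powr (2 * s)" using assms by (simp add: y_def powr_powr)
  have y: "0 < y" using assms by (simp add: y_def)
  have "x = (2 * s / d * (d * y / (2 * s))) powr (2 * s)" using assms by (simp add: x)
  also have "\<dots> = (2 * s / d) powr (2 * s) * (d * y / (2 * s)) powr (2 * s)"
    using assms y by (subst powr_mult) auto
  also have "(d * y / (2 * s)) powr (2 * s) \<le> exp (d * y / (2 * s)) powr (2 * s)"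
  proof (rule powr_mono2)
    show "d * y / (2 * s) \<le> exp (d * y / (2 * s))"
      using exp_ge_add_one_self[of "d * y / (2 * s)"] by linarith
  qed (use assms y in auto)
  also have "exp (d * y / (2 * s)) powr (2 * s) = exp (d * y)"
    using assms by (simp add: powr_def)
  finally have "x \<le> (2 * s / d) powr (2 * s) * exp (d * y)" by (simp add: mult_left_mono)
  thus ?thesis
    unfolding y_def by (simp add: exp_minus field_simps)
qed

text \<open>Linear growth in the eigenvalue costs an arbitrarily small increase d of the exponent.
  The dual space allows every positive exponent, so one may multiply by the eigenvalue finitely
  often.\<close>

lemma wbound_wt_mult:
  assumes s: "0 < s" and d: "0 < d" and mu: "\<And>\<xi>. 0 < mu \<xi>"
    and k: "\<And>\<xi>. cmod (k \<xi>) \<le> p + q * mu \<xi>" and pq: "0 \<le> p" "0 \<le> q"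
    and b: "wbound (wt s mu \<eta>) v M"
  shows "wbound (wt s mu (\<eta> + d)) (\<lambda>\<xi>. k \<xi> * v \<xi>) ((p + q * (2 * s / d) powr (2 * s)) * M)"
proof (rule wbound_mult[OF wt_nonneg _ _ b])
  fix \<xi>
  let ?e = "exp (- (d * mu \<xi> powr (1 / (2 * s))))"
  have e: "?e \<le> 1" using d by simp
  have "sqrt (wt s mu (\<eta> + d) \<xi>) * cmod (k \<xi>) = (cmod (k \<xi>) * ?e) * sqrt (wt s mu \<eta> \<xi>)"
    by (simp add: sqrt_wt algebra_simps flip: exp_add)
  also have "cmod (k \<xi>) * ?e \<le> (p + q * mu \<xi>) * ?e" by (intro mult_right_mono k) auto
  also have "\<dots> = p * ?e + q * (mu \<xi> * ?e)" by (simp add: algebra_simps)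
  also have "\<dots> \<le> p * 1 + q * (2 * s / d) powr (2 * s)"
    using mult_exp_powr_le[OF d s mu] e pq by (intro add_mono mult_left_mono) auto
  finally show "sqrt (wt s mu (\<eta> + d) \<xi>) * cmod (k \<xi>) \<le> (p + q * (2 * s / d) powr (2 * s)) * sqrt (wt s mu \<eta> \<xi>)"
    by (simp add: mult_right_mono wt_nonneg)
qed (use pq in simp)

text \<open>\<open>C\<close> is chosen before \<open>b\<close>, \<open>g\<close> and
  \<open>D\<close>, hence uniformly over all regularisations. The exponent grows by 1 for the factor
  sqrt (1 + lam K) on the initial position, and by C0/2 for exp (- L), where the half reflects that
  the weights contain 2 \<eta>.\<close>

lemma energy_wt:
  fixes mu lam :: "'i \<Rightarrow> real" and s T K C0 :: real
  assumes s: "0 < s" and mu: "\<And>\<xi>. 0 < mu \<xi>" and lam: "\<And>\<xi>. 0 \<le> lam \<xi>" "\<And>\<xi>. lam \<xi> \<le> mu \<xi>"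
    and T: "0 \<le> T" and K: "0 \<le> K" and C0: "0 \<le> C0"
  shows "\<exists>C\<ge>0. \<forall>\<eta> b g D M M0 M1.
     (\<forall>\<xi>. admissible b T (lam \<xi>) (C0 * (1 + mu \<xi> powr (1 / (2 * s)))) K) \<longrightarrow>
     (\<forall>t\<in>{0..T}. \<forall>\<xi>. ((\<lambda>t. D 0 t \<xi>) has_vector_derivative D 1 t \<xi>) (at t within {0..T}) \<and>
        ((\<lambda>t. D 1 t \<xi>) has_vector_derivative D 2 t \<xi>) (at t within {0..T}) \<and>
        D 2 t \<xi> = g t \<xi> - complex_of_real (b t * lam \<xi>) * D 0 t \<xi>) \<longrightarrow>
     (\<forall>t\<in>{0..T}. wbound (wt s mu \<eta>) (g t) M) \<longrightarrow>
     wbound (wt s mu \<eta>) (D 0 0) M0 \<longrightarrow> wbound (wt s mu \<eta>) (D 1 0) M1 \<longrightarrow>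
     (\<forall>t\<in>{0..T}. \<forall>i\<le>(1::nat). wbound (wt s mu (\<eta> + 1 + C0 / 2)) ((D :: nat \<Rightarrow> real \<Rightarrow> 'i \<Rightarrow> complex) i t) (C * (M0 + M1 + M)))"
proof -
  \<comment> \<open>\<open>C1\<close> is the norm of multiplication by sqrt (1 + lam K) at the cost
    d = 1 in the exponent. \<open>C2\<close> undoes the square root of the frequency-independent
    factor exp (- (C0 + 2T)) in the lower energy bound.\<close>
  define C1 where "C1 = 1 + K * (2 * s) powr (2 * s)"
  define C2 where "C2 = exp (C0 / 2 + T)"
  define C where "C = C2 * (C1 + sqrt T + 1)"
  have C1: "0 \<le> C1" using K by (simp add: C1_def)
  show ?thesis
  proof (intro exI[of _ C] conjI allI impI ballI)
    show "0 \<le> C" using C1 T by (simp add: C_def C2_def)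
    fix \<eta> :: real and b :: "real \<Rightarrow> real" and g and D :: "nat \<Rightarrow> real \<Rightarrow> 'i \<Rightarrow> complex" and M M0 M1 t and i :: nat
    assume adm: "\<forall>\<xi>. admissible b T (lam \<xi>) (C0 * (1 + mu \<xi> powr (1 / (2 * s)))) K"
      and D: "\<forall>t\<in>{0..T}. \<forall>\<xi>. ((\<lambda>t. D 0 t \<xi>) has_vector_derivative D 1 t \<xi>) (at t within {0..T}) \<and>
        ((\<lambda>t. D 1 t \<xi>) has_vector_derivative D 2 t \<xi>) (at t within {0..T}) \<and>
        D 2 t \<xi> = g t \<xi> - complex_of_real (b t * lam \<xi>) * D 0 t \<xi>"
      and g: "\<forall>t\<in>{0..T}. wbound (wt s mu \<eta>) (g t) M"
      and M0: "wbound (wt s mu \<eta>) (D 0 0) M0" and M1: "wbound (wt s mu \<eta>) (D 1 0) M1"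
      and t: "t \<in> {0..T}" and i: "i \<le> 1"
    have nn: "0 \<le> M0" "0 \<le> M1" "0 \<le> M"
      using wbound_nonneg[OF M0] wbound_nonneg[OF M1] wbound_nonneg[OF g[rule_format, OF t]] by auto
    have M0': "wbound (wt s mu (\<eta> + 1)) (\<lambda>\<xi>. complex_of_real (sqrt (1 + lam \<xi> * K)) * D 0 0 \<xi>) (C1 * M0)"
    proof -
      have "cmod (complex_of_real (sqrt (1 + lam \<xi> * K))) \<le> 1 + K * mu \<xi>" for \<xi>
      proof -
        have a: "0 \<le> lam \<xi> * K" "lam \<xi> * K \<le> K * mu \<xi>"
          using lam[of \<xi>] K by (auto simp: mult.commute mult_left_mono)
        have "sqrt x \<le> x" if "1 \<le> x" for x :: real
          using that self_le_power[of x 2] by (intro real_le_lsqrt) auto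
        hence "sqrt (1 + lam \<xi> * K) \<le> 1 + lam \<xi> * K" using a by simp
        thus ?thesis using a by simp
      qed
      from wbound_wt_mult[OF s _ mu this _ K M0, of 1] show ?thesis by (simp add: C1_def)
    qed
    \<comment> \<open>This choice turns the required comparison of \<open>w'\<close> with the
      decayed weight into an equality.\<close>
    define w' where "w' \<xi> = exp (- (C0 + 2 * T)) * wt s mu (\<eta> + 1 + C0 / 2) \<xi>" for \<xi>
    have w': "0 \<le> w' \<xi>" for \<xi> by (simp add: w'_def wt_nonneg)
    have d: "((\<lambda>t. D 0 t \<xi>) has_vector_derivative D 1 t \<xi>) (at t within {0..T})"
      "((\<lambda>t. D 1 t \<xi>) has_vector_derivative D 2 t \<xi>) (at t within {0..T})"
      "D 2 t \<xi> = g t \<xi> - complex_of_real (b t * lam \<xi>) * D 0 t \<xi>" if "t \<in> {0..T}" for t \<xi>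
      using D that by blast+
    have g': "wbound (wt s mu (\<eta> + 1)) (g t) M" if "t \<in> {0..T}" for t
      by (rule wbound_wt_mono[OF g[rule_format, OF that]]) simp
    have M1': "wbound (wt s mu (\<eta> + 1)) (D 1 0) M1"
      by (rule wbound_wt_mono[OF M1]) simp
    have "wbound w' (D i t) (C1 * M0 + M1 + sqrt T * M)"
    proof (rule energy_wbound[where l = lam and b = b and L = "\<lambda>\<xi>. C0 * (1 + mu \<xi> powr (1 / (2 * s)))"
            and w = "wt s mu (\<eta> + 1)" and K = K and g = g])
      fix \<xi>
      show "w' \<xi> \<le> wt s mu (\<eta> + 1) \<xi> * exp (- (C0 * (1 + mu \<xi> powr (1 / (2 * s)))) - 2 * T)"
      proof -
        let ?p = "mu \<xi> powr (1 / (2 * s))"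
        have "exp (- (C0 * (1 + ?p)) - 2 * T) = exp (- (C0 + 2 * T)) * exp (- (2 * (C0 / 2) * ?p))"
          by (simp add: algebra_simps flip: exp_add)
        thus ?thesis by (simp add: w'_def wt_add[of s mu "\<eta> + 1"] mult_ac)
      qed
    qed (rule lam T wt_nonneg adm[rule_format] K d g' M0' M1' w' t i | assumption)+
    hence "wbound (wt s mu (\<eta> + 1 + C0 / 2)) (\<lambda>\<xi>. 1 * D i t \<xi>) (C2 * (C1 * M0 + M1 + sqrt T * M))"
    proof (rule wbound_mult[OF wt_nonneg, rotated 2])
      fix \<xi>
      have "sqrt (w' \<xi>) = exp (- (C0 / 2 + T)) * sqrt (wt s mu (\<eta> + 1 + C0 / 2) \<xi>)"
      proof -
        have "sqrt (exp (- (C0 + 2 * T))) = exp (- (C0 / 2 + T))"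
          by (rule real_sqrt_unique) (simp_all flip: exp_double)
        thus ?thesis by (simp only: w'_def real_sqrt_mult)
      qed
      thus "sqrt (wt s mu (\<eta> + 1 + C0 / 2) \<xi>) * cmod 1 \<le> C2 * sqrt (w' \<xi>)"
        by (simp add: C2_def flip: exp_add mult.assoc)
    qed (simp add: C2_def)
    hence "wbound (wt s mu (\<eta> + 1 + C0 / 2)) (D i t) (C2 * (C1 * M0 + M1 + sqrt T * M))" by simp
    moreover have "C2 * (C1 * M0 + M1 + sqrt T * M) \<le> C * (M0 + M1 + M)"
    proof -
      have "C1 * M0 + M1 + sqrt T * M \<le> (C1 + sqrt T + 1) * (M0 + M1 + M)"
      proof -
        have "C1 * M0 \<le> C1 * (M0 + M1 + M)" "sqrt T * M \<le> sqrt T * (M0 + M1 + M)"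
          using nn C1 T by (auto intro!: mult_left_mono)
        thus ?thesis using nn by (simp add: distrib_right)
      qed
      thus ?thesis by (simp add: C_def C2_def mult.assoc)
    qed
    ultimately show "wbound (wt s mu (\<eta> + 1 + C0 / 2)) (D i t) (C * (M0 + M1 + M))"
      by (rule wbound_mono)
  qed
qed

section \<open>Approximation by moving averages\<close>


text \<open>B is the average of b over [t, t + r]. Its derivative is a difference quotient, and
  since B t is a value of b on that interval, the bounds and the oscillation of b pass to B.\<close>

lemma steklov_mean:
  fixes b :: "real \<Rightarrow> real"
  assumes b: "continuous_on {0..T + r} b" and r: "0 < r"
  shows "\<exists>B. \<forall>t\<in>{0..T}. (B has_real_derivative (b (t + r) - b t) / r) (at t within {0..T}) \<and>
           (\<exists>x\<in>{t..t + r}. B t = b x)"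
proof -
  define P where "P x = integral {0..x} b" for x
  have dP: "(P has_real_derivative b t) (at t within {0..T + r})" if "t \<in> {0..T + r}" for t
    unfolding P_def using b that by (rule integral_has_real_derivative)
  define B where "B t = (P (t + r) - P t) / r" for t
  have "(B has_real_derivative (b (t + r) - b t) / r) (at t within {0..T}) \<and> (\<exists>x\<in>{t..t + r}. B t = b x)"
    if t: "t \<in> {0..T}" for t
  proof
    have "(P has_real_derivative b (t + r)) (at (t + r) within (\<lambda>t. t + r) ` {0..T})"
      using t r by (intro DERIV_subset[OF dP]) auto
    moreover have "((\<lambda>t. t + r) has_real_derivative 1) (at t within {0..T})"
      by (auto intro!: derivative_eq_intros)
    ultimately have 1: "((\<lambda>t. P (t + r)) has_real_derivative b (t + r)) (at t within {0..T})"
      using DERIV_image_chain[of P "b (t + r)" "\<lambda>t. t + r" t "{0..T}" 1] by (simp add: o_def)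
    have 2: "(P has_real_derivative b t) (at t within {0..T})"
      using t r by (intro DERIV_subset[OF dP]) auto
    show "(B has_real_derivative (b (t + r) - b t) / r) (at t within {0..T})"
      unfolding B_def by (intro DERIV_cdivide DERIV_diff 1 2)
    have "(P has_derivative (\<lambda>y. b x * y)) (at x within {t..t + r})" if "t \<le> x" "x \<le> t + r" for x
      using DERIV_subset[OF dP, of x "{t..t + r}"] that t by (auto simp: has_field_derivative_def)
    then obtain x where "x \<in> {t<..<t + r}" "P (t + r) - P t = b x * (t + r - t)"
      using mvt_simple[of t "t + r" P "\<lambda>x y. b x * y"] r by auto
    thus "\<exists>x\<in>{t..t + r}. B t = b x"
      using r by (intro bexI[of _ x]) (auto simp: B_def)
  qed
  thus ?thesis by blast
qed

text \<open>A lower bound on b passes to the average, so both parts of the rate are bounded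
  uniformly in time and a constant rate with linear primitive is enough.\<close>

lemma admissible_steklov_pos:
  fixes b :: "real \<Rightarrow> real"
  assumes b: "continuous_on {0..T + r} b" and r: "0 < r" and T: "0 \<le> T" and l: "0 \<le> l"
    and a0: "0 < a0" "\<And>t. a0 \<le> b t" and K: "\<And>t. b t \<le> K"
    and osc: "\<And>t x. x \<in> {t..t + r} \<Longrightarrow> \<bar>b x - b t\<bar> \<le> h"
  shows "admissible b T l (T * (h / (r * a0) + sqrt l * h / sqrt a0)) K"
proof -
  obtain B where B: "\<And>t. t \<in> {0..T} \<Longrightarrow> (B has_real_derivative (b (t + r) - b t) / r) (at t within {0..T})"
     "\<And>t. t \<in> {0..T} \<Longrightarrow> \<exists>x\<in>{t..t + r}. B t = b x"
    using steklov_mean[OF b r] by blast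
  define \<theta> where "\<theta> = h / (r * a0) + sqrt l * h / sqrt a0"
  have h: "0 \<le> h" using osc[of 0 0] r by auto
  have \<theta>: "0 \<le> \<theta>" using h r a0 l by (auto simp: \<theta>_def)
  show ?thesis
    unfolding admissible_def \<theta>_def[symmetric]
  proof (rule exI[of _ B], rule exI[of _ "\<lambda>t. (b (t + r) - b t) / r"], rule exI[of _ "\<lambda>t. t * \<theta>"],
      rule exI[of _ "\<lambda>_. \<theta>"], intro ballI conjI)
    fix t assume t: "t \<in> {0..T}"
    obtain x where x: "x \<in> {t..t + r}" "B t = b x" using B(2)[OF t] by blast
    have Ba: "a0 \<le> B t" using x a0 by simp
    show "(B has_real_derivative (b (t + r) - b t) / r) (at t within {0..T})" by (rule B(1)[OF t])
    show "((\<lambda>t. t * \<theta>) has_real_derivative \<theta>) (at t within {0..T})" by (auto intro!: derivative_eq_intros)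
    show "0 < B t" using Ba a0 by simp
    show "B t \<le> K" using x K by simp
    show "0 \<le> t * \<theta>" "t * \<theta> \<le> T * \<theta>" using t \<theta> by (auto intro: mult_right_mono)
    have "\<bar>(b (t + r) - b t) / r\<bar> / B t \<le> h / r / a0"
      using osc[of "t + r" t] r Ba a0 h by (intro frac_le) (auto simp: divide_right_mono)
    moreover have "sqrt l * \<bar>B t - b t\<bar> / sqrt (B t) \<le> sqrt l * h / sqrt a0"
      using osc[OF x(1)] x(2) a0 Ba l h by (intro frac_le mult_left_mono) auto
    ultimately show "\<bar>(b (t + r) - b t) / r\<bar> / B t + sqrt l * \<bar>B t - b t\<bar> / sqrt (B t) \<le> \<theta>"
      by (simp add: \<theta>_def)
  qed
qed

text \<open>The shift by \<delta> makes the average positive. The part of the rate that comes from G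
  need not be small at any given time: its primitive is K/\<delta> times the moving average of G,
  whose values lie in [0, KG], so its total contribution is at most K * KG/\<delta>.\<close>

lemma admissible_steklov_nonneg:
  fixes b G :: "real \<Rightarrow> real"
  assumes b: "continuous_on {0..T + r} b" and G: "continuous_on {0..T + r} G" and r: "0 < r" and T: "0 \<le> T" and l: "0 \<le> l"
    and \<rho>: "0 < \<rho>" and \<delta>: "0 < \<delta>" and K0: "0 \<le> K"
    and b0: "\<And>t. 0 \<le> b t" and Kb: "\<And>t. b t \<le> Kb"
    and osc: "\<And>t x. x \<in> {t..t + r} \<Longrightarrow> \<bar>b x - b t\<bar> \<le> K * \<delta>"
    and inc: "\<And>t. \<bar>b (t + r) - b t\<bar> \<le> K * r * (b t + \<delta>) / \<rho> + K * (G (t + r) - G t)"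
    and Gb: "\<And>t. 0 \<le> G t" "\<And>t. G t \<le> KG" and Gm: "\<And>t. G t \<le> G (t + r)"
  shows "admissible b T l (T * (K * (1 + K) / \<rho> + sqrt l * (1 + K) * sqrt \<delta>) + K * KG / \<delta>) (Kb + \<delta>)"
proof -
  obtain B where B: "\<And>t. t \<in> {0..T} \<Longrightarrow> (B has_real_derivative (b (t + r) - b t) / r) (at t within {0..T})"
     "\<And>t. t \<in> {0..T} \<Longrightarrow> \<exists>x\<in>{t..t + r}. B t = b x"
    using steklov_mean[OF b r] by blast
  obtain H where H: "\<And>t. t \<in> {0..T} \<Longrightarrow> (H has_real_derivative (G (t + r) - G t) / r) (at t within {0..T})"
     "\<And>t. t \<in> {0..T} \<Longrightarrow> \<exists>x\<in>{t..t + r}. H t = G x"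
    using steklov_mean[OF G r] by blast
  define q where "q = K * (1 + K) / \<rho> + sqrt l * (1 + K) * sqrt \<delta>"
  have q: "0 \<le> q" using K0 \<rho> l \<delta> by (auto simp: q_def)
  show ?thesis
    unfolding admissible_def q_def[symmetric]
  proof (rule exI[of _ "\<lambda>t. B t + \<delta>"], rule exI[of _ "\<lambda>t. (b (t + r) - b t) / r"],
      rule exI[of _ "\<lambda>t. t * q + K / \<delta> * H t"],
      rule exI[of _ "\<lambda>t. q + K / \<delta> * ((G (t + r) - G t) / r)"], intro ballI conjI)
    fix t assume t: "t \<in> {0..T}"
    obtain x where x: "x \<in> {t..t + r}" "B t = b x" using B(2)[OF t] by blast
    obtain y where y: "H t = G y" using H(2)[OF t] by blast
    have Ba: "\<delta> \<le> B t + \<delta>" using x b0 by simp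
    show "((\<lambda>t. B t + \<delta>) has_real_derivative (b (t + r) - b t) / r) (at t within {0..T})"
      using DERIV_add[OF B(1)[OF t] DERIV_const[of \<delta>]] by simp
    have "((\<lambda>t. t * q) has_real_derivative q) (at t within {0..T})" by (auto intro!: derivative_eq_intros)
    thus "((\<lambda>t. t * q + K / \<delta> * H t) has_real_derivative q + K / \<delta> * ((G (t + r) - G t) / r)) (at t within {0..T})"
      by (intro DERIV_add DERIV_cmult H(1)[OF t])
    show "0 < B t + \<delta>" using Ba \<delta> by simp
    show "B t + \<delta> \<le> Kb + \<delta>" using x Kb by simp
    have Hb: "0 \<le> K / \<delta> * H t" "K / \<delta> * H t \<le> K / \<delta> * KG"
      using y Gb[of y] K0 \<delta> by (auto intro: mult_left_mono divide_right_mono)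
    show "0 \<le> t * q + K / \<delta> * H t" using Hb t q by simp
    have "t * q \<le> T * q" using t q by (auto intro: mult_right_mono)
    thus "t * q + K / \<delta> * H t \<le> T * q + K * KG / \<delta>" using Hb(2) by simp
    have bB: "\<bar>B t - b t\<bar> \<le> K * \<delta>" using osc[OF x(1)] x(2) by simp
    have 1: "\<bar>(b (t + r) - b t) / r\<bar> / (B t + \<delta>) \<le> K * (1 + K) / \<rho> + K / \<delta> * ((G (t + r) - G t) / r)"
    proof -
      \<comment> \<open>The increments are bounded in terms of b, but the rate divides by B +
        \<delta>. The two are comparable because |B - b| \<le> K \<delta> \<le> K (B +
        \<delta>).\<close>
      have "b t + \<delta> \<le> (1 + K) * (B t + \<delta>)"
        using bB K0 mult_left_mono[OF Ba K0] by (simp add: algebra_simps abs_le_iff)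
      hence "K * (b t + \<delta>) / \<rho> \<le> K * ((1 + K) * (B t + \<delta>)) / \<rho>"
        using K0 \<rho> by (intro divide_right_mono mult_left_mono) auto
      hence 3: "K * (b t + \<delta>) / \<rho> \<le> K * (1 + K) / \<rho> * (B t + \<delta>)" by (simp add: mult_ac)
      have 4: "K * (G (t + r) - G t) / r \<le> K / \<delta> * ((G (t + r) - G t) / r) * (B t + \<delta>)"
      proof -
        have "K * (G (t + r) - G t) / r = K / \<delta> * ((G (t + r) - G t) / r) * \<delta>" using \<delta> by simp
        also have "\<dots> \<le> K / \<delta> * ((G (t + r) - G t) / r) * (B t + \<delta>)"
          using Ba K0 \<delta> r Gm[of t] by (intro mult_left_mono) auto
        finally show ?thesis .
      qed
      have "\<bar>(b (t + r) - b t) / r\<bar> = \<bar>b (t + r) - b t\<bar> / r" using r by simp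
      also have "\<dots> \<le> (K * r * (b t + \<delta>) / \<rho> + K * (G (t + r) - G t)) / r"
        using inc[of t] r by (intro divide_right_mono) auto
      also have "\<dots> = K * (b t + \<delta>) / \<rho> + K * (G (t + r) - G t) / r"
        using r by (simp add: field_simps)
      also have "\<dots> \<le> (K * (1 + K) / \<rho> + K / \<delta> * ((G (t + r) - G t) / r)) * (B t + \<delta>)"
        using 3 4 by (simp add: distrib_right)
      finally show ?thesis using Ba \<delta> by (subst pos_divide_le_eq) auto
    qed
    have 2: "sqrt l * \<bar>B t + \<delta> - b t\<bar> / sqrt (B t + \<delta>) \<le> sqrt l * (1 + K) * sqrt \<delta>"
    proof -
      have "\<bar>B t + \<delta> - b t\<bar> \<le> (1 + K) * \<delta>" using bB \<delta> by (simp add: algebra_simps abs_le_iff)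
      hence "sqrt l * \<bar>B t + \<delta> - b t\<bar> / sqrt (B t + \<delta>) \<le> sqrt l * ((1 + K) * \<delta>) / sqrt \<delta>"
        using Ba \<delta> l K0 by (intro frac_le mult_left_mono) auto
      also have "\<dots> = sqrt l * (1 + K) * (\<delta> / sqrt \<delta>)" by simp
      also have "\<delta> / sqrt \<delta> = sqrt \<delta>" using \<delta> by (rule real_div_sqrt[OF less_imp_le])
      finally show ?thesis .
    qed
    show "\<bar>(b (t + r) - b t) / r\<bar> / (B t + \<delta>) + sqrt l * \<bar>B t + \<delta> - b t\<bar> / sqrt (B t + \<delta>)
       \<le> q + K / \<delta> * ((G (t + r) - G t) / r)"
      using 1 2 by (simp add: q_def)
  qed
qed

section \<open>Mollification\<close>


text \<open>What is kept of a mollifier is invariant under rescaling, up to the radius S. Estimates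
  proved for all such kernels, with constants free of S and k, are therefore uniform in
  \<epsilon>.\<close>

definition avg_kernel :: "real \<Rightarrow> (real \<Rightarrow> real) \<Rightarrow> bool" where
  "avg_kernel S k \<longleftrightarrow> continuous_on UNIV k \<and> (\<forall>\<tau>. 0 \<le> k \<tau>) \<and> (k has_integral 1) {-S..S} \<and> (\<forall>\<tau>. S < \<bar>\<tau>\<bar> \<longrightarrow> k \<tau> = 0)"

lemma avg_kernel_outside: "avg_kernel S k \<Longrightarrow> \<tau> \<notin> {-S..S} \<Longrightarrow> k \<tau> = 0"
proof -
  assume k: "avg_kernel S k" and "\<tau> \<notin> {-S..S}"
  hence "S < \<bar>\<tau>\<bar>" by (auto; linarith)
  with k show ?thesis by (simp add: avg_kernel_def)
qed

lemma mollifier_kernel: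
  assumes "mollifier \<psi>"
  shows "\<exists>R>0. \<forall>\<omega>>0. avg_kernel (R * \<omega>) (\<lambda>\<tau>. \<psi> (\<tau> / \<omega>) / \<omega>)"
proof -
  from assms obtain R where R: "\<And>x. R < \<bar>x\<bar> \<Longrightarrow> \<psi> x = 0" and nn: "\<And>x. 0 \<le> \<psi> x"
    and int: "(\<psi> has_integral 1) UNIV"
    and der: "\<And>k x. ((deriv ^^ k) \<psi> has_real_derivative (deriv ^^ Suc k) \<psi> x) (at x)"
    unfolding mollifier_def by blast
  \<comment> \<open>The radius provided by the definition may be any real number; the maximum makes
    it positive.\<close>
  define R' where "R' = max R 1"
  have R': "0 < R'" and z: "\<psi> x = 0" if "R' < \<bar>x\<bar>" for x using R that by (auto simp: R'_def)
  have R'0: "0 < R'" by (simp add: R'_def)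
  have cont: "continuous_on UNIV \<psi>"
    using der[of 0] by (auto intro!: DERIV_continuous_on simp: continuous_on_eq_continuous_at intro: DERIV_isCont)
  have "\<psi> = (\<lambda>x. if x \<in> {-R'..R'} then \<psi> x else 0)"
    using z by (auto simp: fun_eq_iff abs_if)
  with int have int': "(\<psi> has_integral 1) {-R'..R'}"
    using has_integral_restrict_UNIV[of "{-R'..R'}" \<psi> 1] by simp
  have "avg_kernel (R' * \<omega>) (\<lambda>\<tau>. \<psi> (\<tau> / \<omega>) / \<omega>)" if \<omega>: "0 < \<omega>" for \<omega>
    unfolding avg_kernel_def
  proof (intro conjI allI impI)
    show "continuous_on UNIV (\<lambda>\<tau>. \<psi> (\<tau> / \<omega>) / \<omega>)"
      using \<omega> by (intro continuous_intros continuous_on_compose2[OF cont]) auto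
    show "0 \<le> \<psi> (\<tau> / \<omega>) / \<omega>" for \<tau> using nn \<omega> by simp
    show "\<psi> (\<tau> / \<omega>) / \<omega> = 0" if "R' * \<omega> < \<bar>\<tau>\<bar>" for \<tau>
      using z[of "\<tau> / \<omega>"] that \<omega> by (simp add: abs_divide pos_less_divide_eq)
    have "((\<lambda>x. \<psi> ((1 / \<omega>) * x + 0)) has_integral (1 / \<bar>1 / \<omega>\<bar> ^ DIM(real)))
       ((\<lambda>x. (1 / (1 / \<omega>)) *\<^sub>R x + - ((1 / (1 / \<omega>)) *\<^sub>R 0)) ` cbox (-R') R')"
      using has_integral_affinity[of \<psi> 1 "-R'" R' "1 / \<omega>" 0] int' \<omega> by simp
    also have "((\<lambda>x. (1 / (1 / \<omega>)) *\<^sub>R x + - ((1 / (1 / \<omega>)) *\<^sub>R 0)) ` cbox (-R') R') = {- (R' * \<omega>)..R' * \<omega>}"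
      using \<omega> R'0 image_mult_atLeastAtMost[of \<omega> "-R'" R'] by (simp add: mult.commute)
    finally have "((\<lambda>x. \<psi> (x / \<omega>)) has_integral \<omega>) {- (R' * \<omega>)..R' * \<omega>}" using \<omega> by simp
    from has_integral_divide[OF this, of \<omega>]
    show "((\<lambda>\<tau>. \<psi> (\<tau> / \<omega>) / \<omega>) has_integral 1) {- (R' * \<omega>)..R' * \<omega>}" using \<omega> by simp
  qed
  with R'0 show ?thesis by blast
qed

definition moll :: "real \<Rightarrow> (real \<Rightarrow> real) \<Rightarrow> (real \<Rightarrow> real) \<Rightarrow> real \<Rightarrow> real" where
  "moll S k g t = integral {-S..S} (\<lambda>\<tau>. g (t - \<tau>) * k \<tau>)"

lemma moll_has_integral:
  assumes "avg_kernel S k" "continuous_on UNIV g"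
  shows "((\<lambda>\<tau>. g (t - \<tau>) * k \<tau>) has_integral moll S k g t) {-S..S}"
  unfolding moll_def using assms
  by (intro integrable_integral integrable_continuous_real continuous_intros continuous_on_compose2[OF assms(2)])
     (auto simp: avg_kernel_def elim: continuous_on_subset)

lemma moll_le:
  assumes k: "avg_kernel S k" and g: "continuous_on UNIV g" and h: "continuous_on UNIV h"
    and le: "\<And>\<tau>. \<tau> \<in> {-S..S} \<Longrightarrow> g (t - \<tau>) \<le> h (t' - \<tau>)"
  shows "moll S k g t \<le> moll S k h t'"
  by (rule has_integral_le[OF moll_has_integral[OF k g] moll_has_integral[OF k h]])
     (use k le in \<open>auto simp: avg_kernel_def intro: mult_right_mono\<close>)

lemma moll_const:
  assumes k: "avg_kernel S k"
  shows "moll S k (\<lambda>_. c) t = c"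
  using has_integral_mult_right[of k 1 "{-S..S}" c] k
  unfolding moll_def avg_kernel_def by (auto intro: integral_unique)

lemma moll_add:
  assumes k: "avg_kernel S k" and "continuous_on UNIV g" "continuous_on UNIV h"
  shows "moll S k (\<lambda>x. g x + h x) t = moll S k g t + moll S k h t"
  using has_integral_add[OF moll_has_integral[OF assms(1,2)] moll_has_integral[OF assms(1,3)]]
  unfolding moll_def[of _ _ "\<lambda>x. g x + h x"] by (auto simp: distrib_right intro: integral_unique)

lemma moll_cmult:
  "moll S k (\<lambda>x. c * g x) t = c * moll S k g t"
  by (simp add: moll_def mult.assoc)

lemma moll_shift: "moll S k g (t + r) = moll S k (\<lambda>x. g (x + r)) t"
  by (simp add: moll_def algebra_simps)

lemma moll_between:
  assumes "avg_kernel S k" "continuous_on UNIV g" "\<And>\<tau>. \<tau> \<in> {-S..S} \<Longrightarrow> c \<le> g (t - \<tau>) \<and> g (t - \<tau>) \<le> d"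
  shows "c \<le> moll S k g t" "moll S k g t \<le> d"
  using moll_le[OF assms(1) _ assms(2), of "\<lambda>_. c" t t] moll_le[OF assms(1,2), of "\<lambda>_. d" t t] assms(3)
  by (auto simp: moll_const[OF assms(1)])

text \<open>Averaging cannot enlarge the difference of two translates, so a modulus of continuity
  survives mollification with the same constant.\<close>

lemma moll_diff_le:
  assumes k: "avg_kernel S k" and g: "continuous_on UNIV g"
    and le: "\<And>\<tau>. \<tau> \<in> {-S..S} \<Longrightarrow> \<bar>g (t - \<tau>) - g (t' - \<tau>)\<bar> \<le> e"
  shows "\<bar>moll S k g t - moll S k g t'\<bar> \<le> e"
proof -
  have "moll S k g t \<le> moll S k (\<lambda>x. g x + e) t'" if "\<And>\<tau>. \<tau> \<in> {-S..S} \<Longrightarrow> \<bar>g (t - \<tau>) - g (t' - \<tau>)\<bar> \<le> e" for t t'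
    by (rule moll_le[OF k g]) (use that g in \<open>auto intro!: continuous_intros simp: abs_le_iff algebra_simps\<close>)
  hence "moll S k g t \<le> moll S k g t' + e" if "\<And>\<tau>. \<tau> \<in> {-S..S} \<Longrightarrow> \<bar>g (t - \<tau>) - g (t' - \<tau>)\<bar> \<le> e" for t t'
    using that by (simp add: moll_add[OF k g] moll_const[OF k])
  from this[of t t'] this[of t' t] le show ?thesis by (simp add: abs_minus_commute abs_le_iff)
qed

lemma moll_continuous:
  assumes k: "avg_kernel S k" and g: "uniformly_continuous_on UNIV g"
  shows "continuous_on UNIV (moll S k g)"
proof (rule uniformly_continuous_imp_continuous)
  note gc = uniformly_continuous_imp_continuous[OF g]
  show "uniformly_continuous_on UNIV (moll S k g)"
    unfolding uniformly_continuous_on_def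
  proof (intro allI impI)
    fix e :: real assume "0 < e"
    then obtain d where d: "0 < d" "\<And>x x'. dist x' x < d \<Longrightarrow> dist (g x') (g x) < e / 2"
      using g unfolding uniformly_continuous_on_def by (meson UNIV_I half_gt_zero)
    have "\<bar>moll S k g x' - moll S k g x\<bar> \<le> e / 2" if "dist x' x < d" for x x'
      using d(2)[of "x' - _" "x - _"] that
      by (intro moll_diff_le[OF k gc]) (simp add: dist_real_def less_imp_le)
    thus "\<exists>d>0. \<forall>x\<in>UNIV. \<forall>x'\<in>UNIV. dist x' x < d \<longrightarrow> dist (moll S k g x') (moll S k g x) < e"
      using d(1) \<open>0 < e\<close> by (intro exI[of _ d]) (fastforce simp: dist_real_def)
  qed
qed

text \<open>The kernel vanishes off [-S, S], which reduces the integral over the line to an integral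
  of a continuous function over a compact interval.\<close>

lemma reg_a_eq_moll:
  assumes "avg_kernel (R * \<omega> \<epsilon>) (\<lambda>\<tau>. \<psi> (\<tau> / \<omega> \<epsilon>) / \<omega> \<epsilon>)"
  shows "reg_a \<psi> \<omega> T a \<epsilon> t = moll (R * \<omega> \<epsilon>) (\<lambda>\<tau>. \<psi> (\<tau> / \<omega> \<epsilon>) / \<omega> \<epsilon>) (\<lambda>x. a (clamp T x)) t"
proof -
  let ?k = "\<lambda>\<tau>. \<psi> (\<tau> / \<omega> \<epsilon>) / \<omega> \<epsilon>" and ?S = "{- (R * \<omega> \<epsilon>)..R * \<omega> \<epsilon>}"
  have z: "?k \<tau> = 0" if "\<tau> \<notin> ?S" for \<tau>
    using avg_kernel_outside[OF assms that] .
  have eq: "(\<lambda>\<tau>. a (clamp T (t - \<tau>)) * ?k \<tau>) = (\<lambda>\<tau>. if \<tau> \<in> ?S then a (clamp T (t - \<tau>)) * ?k \<tau> else 0)"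
    using z by (auto simp: fun_eq_iff)
  show ?thesis
    unfolding reg_a_def moll_def by (subst eq) (rule integral_restrict_UNIV)
qed

lemma reg_f_eq:
  assumes "avg_kernel (R * \<omega> \<epsilon>) (\<lambda>\<tau>. \<psi> (\<tau> / \<omega> \<epsilon>) / \<omega> \<epsilon>)"
  shows "reg_f \<psi> \<omega> T f \<epsilon> t \<xi> = integral {- (R * \<omega> \<epsilon>)..R * \<omega> \<epsilon>}
     (\<lambda>\<tau>. f (clamp T (t - \<tau>)) \<xi> * complex_of_real (\<psi> (\<tau> / \<omega> \<epsilon>) / \<omega> \<epsilon>))"
proof -
  let ?k = "\<lambda>\<tau>. \<psi> (\<tau> / \<omega> \<epsilon>) / \<omega> \<epsilon>" and ?S = "{- (R * \<omega> \<epsilon>)..R * \<omega> \<epsilon>}"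
  have z: "?k \<tau> = 0" if "\<tau> \<notin> ?S" for \<tau>
    using avg_kernel_outside[OF assms that] .
  have eq: "(\<lambda>\<tau>. f (clamp T (t - \<tau>)) \<xi> * complex_of_real (?k \<tau>)) =
     (\<lambda>\<tau>. if \<tau> \<in> ?S then f (clamp T (t - \<tau>)) \<xi> * complex_of_real (?k \<tau>) else 0)"
    using z by (auto simp: fun_eq_iff)
  show ?thesis
    unfolding reg_f_def by (subst eq) (rule integral_restrict_UNIV)
qed


text \<open>At frequency scale 1/\<rho> the admissible error is \<delta> = \<rho> powr \<alpha>. The increments of A over a step r are
  controlled either by (A + \<delta>)/\<rho> or by those of a monotone function G of size O(\<rho>). The conditions are affine
  in the pair (A, G), hence stable under averaging of translates.\<close>

definition coeff_class :: "real \<Rightarrow> real \<Rightarrow> (real \<Rightarrow> real) \<Rightarrow> bool" where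
  "coeff_class \<alpha> K A \<longleftrightarrow> (\<forall>\<rho>. 0 < \<rho> \<and> \<rho> \<le> 1 \<longrightarrow> (\<exists>r G. 0 < r \<and> uniformly_continuous_on UNIV G \<and>
     (\<forall>x. 0 \<le> G x \<and> G x \<le> K * \<rho> \<and> G x \<le> G (x + r)) \<and>
     (\<forall>x. \<bar>A (x + r) - A x\<bar> \<le> K * r * (A x + \<rho> powr \<alpha>) / \<rho> + K * (G (x + r) - G x)) \<and>
     (\<forall>x. \<forall>h\<in>{0..r}. \<bar>A (x + h) - A x\<bar> \<le> K * \<rho> powr \<alpha>)))"

section \<open>Frequency loss for mollified coefficients\<close>

lemma admissible_mono:
  assumes "admissible b T l L K" "L \<le> L'" "K \<le> K'"
  shows "admissible b T l L' K'"
proof -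
  from assms(1) obtain B B' \<Theta> \<theta> where a: "\<forall>t\<in>{0..T}.
     (B has_real_derivative B' t) (at t within {0..T}) \<and>
     (\<Theta> has_real_derivative \<theta> t) (at t within {0..T}) \<and>
     0 < B t \<and> B t \<le> K \<and> 0 \<le> \<Theta> t \<and> \<Theta> t \<le> L \<and>
     \<bar>B' t\<bar> / B t + sqrt l * \<bar>B t - b t\<bar> / sqrt (B t) \<le> \<theta> t"
    unfolding admissible_def by blast
  show ?thesis
    unfolding admissible_def
    by (rule exI[of _ B], rule exI[of _ B'], rule exI[of _ \<Theta>], rule exI[of _ \<theta>])
       (use a order_trans[OF _ assms(2)] order_trans[OF _ assms(3)] in blast)
qed

text \<open>Replacing l by max 1 l keeps the averaging length in (0, 1] at low frequencies; the
  summand 1 on the right is the price.\<close>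

lemma max_powr_le:
  fixes l m :: real
  assumes "0 \<le> l" "l \<le> m" "e \<le> \<sigma>" "0 \<le> \<sigma>"
  shows "max 1 l powr e \<le> 1 + m powr \<sigma>"
proof (cases "l \<le> 1")
  case False
  hence "l powr e \<le> l powr \<sigma>" using assms by (intro powr_mono) auto
  also have "\<dots> \<le> m powr \<sigma>" using assms by (intro powr_mono2) auto
  finally show ?thesis using False by (simp add: max_def)
qed (simp add: max_def)

lemma sqrt_le_max_powr: "0 \<le> l \<Longrightarrow> sqrt l \<le> max 1 l powr (1 / 2)"
  by (simp add: powr_half_sqrt)

lemma moll_admissible_pos:
  assumes k: "avg_kernel S k" and A: "uniformly_continuous_on UNIV A" and T: "0 \<le> T" and l: "0 \<le> l" "l \<le> m"
    and a0: "0 < a0" "\<And>t. a0 \<le> A t" and Kb: "\<And>t. A t \<le> Kb" and H: "0 \<le> H"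
    and hoel: "\<And>x y. \<bar>A x - A y\<bar> \<le> H * \<bar>x - y\<bar> powr \<alpha>" and \<alpha>: "0 < \<alpha>" "(1 - \<alpha>) / 2 \<le> \<sigma>" "0 \<le> \<sigma>"
  shows "admissible (moll S k A) T l (T * H * (1 / a0 + 1 / sqrt a0) * (1 + m powr \<sigma>)) Kb"
proof -
  \<comment> \<open>At this length \<rho> powr \<alpha>/\<rho> and sqrt l * \<rho> powr \<alpha> are
    both at most max 1 l powr ((1 - \<alpha>)/2).\<close>
  define \<rho> where "\<rho> = max 1 l powr (- (1 / 2))"
  have \<rho>: "0 < \<rho>" by (simp add: \<rho>_def max_def)
  have Ac: "continuous_on UNIV A" by (rule uniformly_continuous_imp_continuous[OF A])
  have osc: "\<bar>moll S k A x - moll S k A t\<bar> \<le> H * \<rho> powr \<alpha>" if "x \<in> {t..t + \<rho>}" for t x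
  proof (rule moll_diff_le[OF k Ac])
    fix \<tau>
    have "\<bar>A (x - \<tau>) - A (t - \<tau>)\<bar> \<le> H * \<bar>x - t\<bar> powr \<alpha>" using hoel[of "x - \<tau>" "t - \<tau>"] by simp
    also have "\<dots> \<le> H * \<rho> powr \<alpha>" using that H \<alpha> by (intro mult_left_mono powr_mono2) auto
    finally show "\<bar>A (x - \<tau>) - A (t - \<tau>)\<bar> \<le> H * \<rho> powr \<alpha>" .
  qed
  have "admissible (moll S k A) T l (T * (H * \<rho> powr \<alpha> / (\<rho> * a0) + sqrt l * (H * \<rho> powr \<alpha>) / sqrt a0)) Kb"
    by (rule admissible_steklov_pos[OF _ \<rho> T l(1) a0(1) _ _ osc])
       (use k Ac a0 Kb in \<open>auto intro: continuous_on_subset[OF moll_continuous[OF k A]] moll_between\<close>)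
  moreover have "T * (H * \<rho> powr \<alpha> / (\<rho> * a0) + sqrt l * (H * \<rho> powr \<alpha>) / sqrt a0) \<le> T * H * (1 / a0 + 1 / sqrt a0) * (1 + m powr \<sigma>)"
  proof -
    let ?Y = "1 + m powr \<sigma>"
    have e: "\<rho> powr \<alpha> = max 1 l powr (- (\<alpha> / 2))" by (simp add: \<rho>_def powr_powr)
    have "\<rho> powr \<alpha> / \<rho> = max 1 l powr ((1 - \<alpha>) / 2)"
      unfolding e by (simp add: \<rho>_def powr_diff[symmetric] diff_divide_distrib)
    also have "\<dots> \<le> ?Y" using l \<alpha> by (intro max_powr_le) auto
    finally have 1: "\<rho> powr \<alpha> / \<rho> \<le> ?Y" .
    have "sqrt l * \<rho> powr \<alpha> \<le> max 1 l powr (1 / 2) * \<rho> powr \<alpha>"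
      by (intro mult_right_mono sqrt_le_max_powr l) auto
    also have "\<dots> = max 1 l powr ((1 - \<alpha>) / 2)"
      unfolding e by (simp add: powr_add[symmetric] diff_divide_distrib)
    also have "\<dots> \<le> ?Y" using l \<alpha> by (intro max_powr_le) auto
    finally have 2: "sqrt l * \<rho> powr \<alpha> \<le> ?Y" .
    have "H * \<rho> powr \<alpha> / (\<rho> * a0) + sqrt l * (H * \<rho> powr \<alpha>) / sqrt a0
       = H / a0 * (\<rho> powr \<alpha> / \<rho>) + H / sqrt a0 * (sqrt l * \<rho> powr \<alpha>)" by (simp add: mult_ac)
    also have "\<dots> \<le> H / a0 * ?Y + H / sqrt a0 * ?Y"
      using H a0 1 2 by (intro add_mono mult_left_mono) auto
    also have "\<dots> = H * (1 / a0 + 1 / sqrt a0) * ?Y" by (simp add: algebra_simps)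
    finally show ?thesis using T by (simp only: mult.assoc mult_left_mono)
  qed
  ultimately show ?thesis by (rule admissible_mono) simp
qed

lemma moll_admissible_nonneg:
  assumes k: "avg_kernel S k" and A: "uniformly_continuous_on UNIV A" and T: "0 \<le> T" and l: "0 \<le> l" "l \<le> m"
    and A0: "\<And>t. 0 \<le> A t" and Kb: "\<And>t. A t \<le> Kb" and K: "0 \<le> K"
    and cls: "coeff_class \<alpha> K A" and \<alpha>: "0 < \<alpha>" "\<alpha> < 2" "1 / (2 + \<alpha>) \<le> \<sigma>"
  shows "admissible (moll S k A) T l ((T * (K * (1 + K) + (1 + K)) + K\<^sup>2) * (1 + m powr \<sigma>)) (Kb + 1)"
proof -
  \<comment> \<open>Three quantities enter the loss. Equating 1/\<rho> with sqrt (l \<delta>), where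
    \<delta> = \<rho> powr \<alpha>, fixes \<rho>; the third, \<rho>/\<delta>, then has exponent
    (\<alpha> - 1)/(2 + \<alpha>), which is at most 1/(2 + \<alpha>) because \<alpha> < 2.\<close>
  define \<rho> where "\<rho> = max 1 l powr (- (1 / (2 + \<alpha>)))"
  define \<delta> where "\<delta> = \<rho> powr \<alpha>"
  have \<rho>: "0 < \<rho>" "\<rho> \<le> 1" using \<alpha> powr_mono[of "- (1 / (2 + \<alpha>))" 0 "max 1 l"] by (auto simp: \<rho>_def max_def)
  have \<delta>: "0 < \<delta>" "\<delta> \<le> 1" using \<rho> \<alpha> powr_mono2[of \<alpha> \<rho> 1] by (auto simp: \<delta>_def)
  have \<sigma>: "0 \<le> \<sigma>" using \<alpha> order_trans[of 0 "1 / (2 + \<alpha>)" \<sigma>] by simp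
  have Ac: "continuous_on UNIV A" by (rule uniformly_continuous_imp_continuous[OF A])
  obtain r G where r: "0 < r" and G: "uniformly_continuous_on UNIV G" and
    Gb: "\<And>x. 0 \<le> G x" "\<And>x. G x \<le> K * \<rho>" "\<And>x. G x \<le> G (x + r)" and
    inc: "\<And>x. \<bar>A (x + r) - A x\<bar> \<le> K * r * (A x + \<delta>) / \<rho> + K * (G (x + r) - G x)" and
    osc: "\<And>x h. h \<in> {0..r} \<Longrightarrow> \<bar>A (x + h) - A x\<bar> \<le> K * \<delta>"
    using cls \<rho> unfolding coeff_class_def \<delta>_def by metis
  have Gc: "continuous_on UNIV G" by (rule uniformly_continuous_imp_continuous[OF G])
  define b where "b = moll S k A"
  define g where "g = moll S k G"
  define q where "q = K * r / \<rho>"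
  have inc': "\<bar>A (x + r) - A x\<bar> \<le> q * (A x + \<delta>) + K * (G (x + r) - G x)" for x
    using inc[of x] by (simp add: q_def)
  have sh: "continuous_on UNIV (\<lambda>x. f (x + r))" if "continuous_on UNIV f" for f :: "real \<Rightarrow> real"
    by (intro continuous_intros continuous_on_compose2[OF that]) auto
  \<comment> \<open>Averaging commutes with affine expressions but not with the absolute value, so
    the increment bound is averaged as two one-sided inequalities.\<close>
  have bshift: "b (t + r) \<le> b t + (q * (b t + \<delta>) + K * (g (t + r) - g t))"
    and bshift': "b t \<le> b (t + r) + (q * (b t + \<delta>) + K * (g (t + r) - g t))" for t
  proof -
    let ?h = "\<lambda>x. q * (A x + \<delta>) + K * (G (x + r) - G x)"
    have hc: "continuous_on UNIV ?h" by (intro continuous_intros Ac Gc sh)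
    have hm: "moll S k ?h t = q * (b t + \<delta>) + K * (g (t + r) - g t)"
    proof -
      have "moll S k ?h t = moll S k (\<lambda>x. (q * A x + q * \<delta>) + (K * G (x + r) + (- K) * G x)) t"
        by (simp add: algebra_simps)
      also have "\<dots> = moll S k (\<lambda>x. q * A x + q * \<delta>) t + moll S k (\<lambda>x. K * G (x + r) + (- K) * G x) t"
        by (intro moll_add[OF k] continuous_intros Ac Gc sh)
      also have "moll S k (\<lambda>x. q * A x + q * \<delta>) t = moll S k (\<lambda>x. q * A x) t + moll S k (\<lambda>x. q * \<delta>) t"
        by (intro moll_add[OF k] continuous_intros Ac)
      also have "moll S k (\<lambda>x. K * G (x + r) + (- K) * G x) t = moll S k (\<lambda>x. K * G (x + r)) t + moll S k (\<lambda>x. (- K) * G x) t"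
        by (intro moll_add[OF k] continuous_intros Gc sh)
      also have "moll S k (\<lambda>x. q * A x) t + moll S k (\<lambda>x. q * \<delta>) t + (moll S k (\<lambda>x. K * G (x + r)) t + moll S k (\<lambda>x. (- K) * G x) t)
         = (q * b t + q * \<delta>) + (K * g (t + r) + (- K) * g t)"
        by (simp only: moll_cmult moll_const[OF k] b_def g_def moll_shift)
      finally show ?thesis by (simp add: algebra_simps)
    qed
    have "b (t + r) \<le> moll S k (\<lambda>x. A x + ?h x) t"
      unfolding b_def
    proof (rule moll_le[OF k Ac])
      show "A (t + r - \<tau>) \<le> A (t - \<tau>) + ?h (t - \<tau>)" for \<tau>
      proof -
        have "t + r - \<tau> = t - \<tau> + r" by simp
        thus ?thesis using inc'[of "t - \<tau>"] by (simp only:)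
      qed
    qed (intro continuous_intros Ac Gc sh)
    thus "b (t + r) \<le> b t + (q * (b t + \<delta>) + K * (g (t + r) - g t))"
      by (simp add: moll_add[OF k Ac hc] hm b_def[symmetric])
    have "b t \<le> moll S k (\<lambda>x. A (x + r) + ?h x) t"
      unfolding b_def
    proof (rule moll_le[OF k Ac])
      show "A (t - \<tau>) \<le> A (t - \<tau> + r) + ?h (t - \<tau>)" for \<tau>
        using inc'[of "t - \<tau>"] by linarith
    qed (intro continuous_intros Ac Gc sh)
    thus "b t \<le> b (t + r) + (q * (b t + \<delta>) + K * (g (t + r) - g t))"
      by (simp add: moll_add[OF k sh[OF Ac] hc] hm b_def[symmetric] moll_shift[symmetric])
  qed
  have "admissible b T l (T * (K * (1 + K) / \<rho> + sqrt l * (1 + K) * sqrt \<delta>) + K * (K * \<rho>) / \<delta>) (Kb + \<delta>)"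
  proof (rule admissible_steklov_nonneg[OF _ _ r T l(1) \<rho>(1) \<delta>(1) K])
    show "continuous_on {0..T + r} b" "continuous_on {0..T + r} g"
      unfolding b_def g_def
      by (rule continuous_on_subset[OF moll_continuous[OF k A]] continuous_on_subset[OF moll_continuous[OF k G]], simp)+
    show "0 \<le> b t" "b t \<le> Kb" "0 \<le> g t" "g t \<le> K * \<rho>" for t
      unfolding b_def g_def using A0 Kb Gb by (auto intro!: moll_between[OF k Ac] moll_between[OF k Gc])
    show "g t \<le> g (t + r)" for t
      unfolding g_def moll_shift using Gb by (intro moll_le[OF k Gc sh[OF Gc]]) auto
    show "\<bar>b x - b t\<bar> \<le> K * \<delta>" if "x \<in> {t..t + r}" for t x
      unfolding b_def
    proof (rule moll_diff_le[OF k Ac])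
      fix \<tau> show "\<bar>A (x - \<tau>) - A (t - \<tau>)\<bar> \<le> K * \<delta>"
        using osc[of "x - t" "t - \<tau>"] that by (simp add: algebra_simps)
    qed
    show "\<bar>b (t + r) - b t\<bar> \<le> K * r * (b t + \<delta>) / \<rho> + K * (g (t + r) - g t)" for t
    proof -
      have "K * r * (b t + \<delta>) / \<rho> = q * (b t + \<delta>)" by (simp add: q_def)
      thus ?thesis using bshift[of t] bshift'[of t] by linarith
    qed
  qed
  moreover have "T * (K * (1 + K) / \<rho> + sqrt l * (1 + K) * sqrt \<delta>) + K * (K * \<rho>) / \<delta>
      \<le> (T * (K * (1 + K) + (1 + K)) + K\<^sup>2) * (1 + m powr \<sigma>)"
  proof -
    let ?Y = "1 + m powr \<sigma>"
    have "1 / \<rho> = max 1 l powr (1 / (2 + \<alpha>))"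
      by (simp add: \<rho>_def powr_minus divide_inverse)
    also have "\<dots> \<le> ?Y" using l \<alpha> \<sigma> by (intro max_powr_le) auto
    finally have 1: "1 / \<rho> \<le> ?Y" .
    have sd: "sqrt \<delta> = max 1 l powr (- (\<alpha> / (2 * (2 + \<alpha>))))"
      using \<delta> by (simp add: \<delta>_def \<rho>_def powr_powr powr_half_sqrt[symmetric] mult_ac)
    have "sqrt l * sqrt \<delta> \<le> max 1 l powr (1 / 2) * sqrt \<delta>"
      using \<delta> by (intro mult_right_mono sqrt_le_max_powr l) auto
    also have "\<dots> = max 1 l powr (1 / (2 + \<alpha>))"
      unfolding sd powr_add[symmetric] using \<alpha> by (intro arg_cong[of _ _ "(powr) (max 1 l)"]) (simp add: field_simps)
    also have "\<dots> \<le> ?Y" using l \<alpha> \<sigma> by (intro max_powr_le) auto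
    finally have 2: "sqrt l * sqrt \<delta> \<le> ?Y" .
    have "\<rho> / \<delta> = max 1 l powr (- (1 / (2 + \<alpha>)) - - (\<alpha> / (2 + \<alpha>)))"
      unfolding powr_diff by (simp add: \<delta>_def \<rho>_def powr_powr)
    also have "- (1 / (2 + \<alpha>)) - - (\<alpha> / (2 + \<alpha>)) = (\<alpha> - 1) / (2 + \<alpha>)"
      by (simp add: diff_divide_distrib)
    also have "max 1 l powr ((\<alpha> - 1) / (2 + \<alpha>)) \<le> ?Y"
    proof -
      have "(\<alpha> - 1) / (2 + \<alpha>) \<le> 1 / (2 + \<alpha>)" using \<alpha> by (intro divide_right_mono) auto
      hence "(\<alpha> - 1) / (2 + \<alpha>) \<le> \<sigma>" using \<alpha> by linarith
      thus ?thesis using l \<sigma> by (intro max_powr_le) auto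
    qed
    finally have 3: "\<rho> / \<delta> \<le> ?Y" .
    have "T * (K * (1 + K) / \<rho> + sqrt l * (1 + K) * sqrt \<delta>) + K * (K * \<rho>) / \<delta>
       = T * (K * (1 + K)) * (1 / \<rho>) + T * (1 + K) * (sqrt l * sqrt \<delta>) + K\<^sup>2 * (\<rho> / \<delta>)"
      by (simp add: power2_eq_square algebra_simps add_divide_distrib)
    also have "\<dots> \<le> T * (K * (1 + K)) * ?Y + T * (1 + K) * ?Y + K\<^sup>2 * ?Y"
      using T K by (intro add_mono mult_left_mono 1 2 3) auto
    also have "\<dots> = (T * (K * (1 + K) + (1 + K)) + K\<^sup>2) * ?Y" by (simp add: algebra_simps)
    finally show ?thesis .
  qed
  ultimately show ?thesis unfolding b_def by (rule admissible_mono) (use \<delta> in simp)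
qed

section \<open>Regularity of the coefficient\<close>


lemma clamp_in: "0 \<le> T \<Longrightarrow> clamp T x \<in> {0..T}"
  by (auto simp: clamp_def)

lemma clamp_id: "x \<in> {0..T} \<Longrightarrow> clamp T x = x"
  by (auto simp: clamp_def)

lemma clamp_diff: "0 \<le> T \<Longrightarrow> \<bar>clamp T x - clamp T y\<bar> \<le> \<bar>x - y\<bar>"
  by (auto simp: clamp_def max_def min_def)

lemma clamp_mono: "x \<le> y \<Longrightarrow> clamp T x \<le> clamp T y"
  by (auto simp: clamp_def max_def min_def)

lemma hoelder_on_nonneg:
  assumes "hoelder_on \<beta> S g"
  obtains H where "0 \<le> H" "\<And>x y. x \<in> S \<Longrightarrow> y \<in> S \<Longrightarrow> \<bar>g x - g y\<bar> \<le> H * \<bar>x - y\<bar> powr \<beta>"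
proof -
  obtain C where C: "\<And>x y. x \<in> S \<Longrightarrow> y \<in> S \<Longrightarrow> \<bar>g x - g y\<bar> \<le> C * \<bar>x - y\<bar> powr \<beta>"
    using assms unfolding hoelder_on_def by blast
  show ?thesis
  proof (rule that[of "\<bar>C\<bar>"])
    fix x y assume "x \<in> S" "y \<in> S"
    from C[OF this] show "\<bar>g x - g y\<bar> \<le> \<bar>C\<bar> * \<bar>x - y\<bar> powr \<beta>"
      by (rule order_trans) (auto intro: mult_right_mono)
  qed simp
qed

lemma hoelder_uniformly_continuous:
  fixes A :: "real \<Rightarrow> real"
  assumes H: "0 \<le> H" and b: "0 < \<beta>" and hoel: "\<And>x y. \<bar>A x - A y\<bar> \<le> H * \<bar>x - y\<bar> powr \<beta>"
  shows "uniformly_continuous_on UNIV A"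
  unfolding uniformly_continuous_on_def
proof (intro allI impI)
  fix e :: real assume e: "0 < e"
  define d where "d = (e / (H + 1)) powr (1 / \<beta>)"
  have d: "0 < d" using e H by (simp add: d_def)
  have "\<bar>A x' - A x\<bar> < e" if "\<bar>x' - x\<bar> < d" for x x'
  proof -
    have "\<bar>x' - x\<bar> powr \<beta> \<le> d powr \<beta>" using that b by (intro powr_mono2) auto
    also have "\<dots> = e / (H + 1)" using e H b by (simp add: d_def powr_powr)
    finally have "H * \<bar>x' - x\<bar> powr \<beta> \<le> H * (e / (H + 1))" using H by (rule mult_left_mono)
    also have "\<dots> < e" using e H by (simp add: field_simps)
    finally show ?thesis using hoel[of x' x] by linarith
  qed
  thus "\<exists>d>0. \<forall>x\<in>UNIV. \<forall>x'\<in>UNIV. dist x' x < d \<longrightarrow> dist (A x') (A x) < e"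
    using d by (intro exI[of _ d]) (auto simp: dist_real_def)
qed

lemma C1_lipschitz:
  assumes d: "\<And>t. t \<in> {0..T} \<Longrightarrow> (a has_real_derivative a' t) (at t within {0..T})"
    and c: "continuous_on {0..T} a'"
  obtains L where "0 \<le> L" "\<And>x y. x \<in> {0..T} \<Longrightarrow> y \<in> {0..T} \<Longrightarrow> \<bar>a x - a y\<bar> \<le> L * \<bar>x - y\<bar>"
proof -
  have "bounded (a' ` {0..T})" by (intro compact_imp_bounded compact_continuous_image c) simp
  then obtain L where "\<forall>t\<in>{0..T}. \<bar>a' t\<bar> \<le> L" unfolding bounded_iff by auto
  hence L: "\<bar>a' t\<bar> \<le> L" if "t \<in> {0..T}" for t using that by blast
  have "\<bar>a x - a y\<bar> \<le> \<bar>L\<bar> * \<bar>x - y\<bar>" if "x \<in> {0..T}" "y \<in> {0..T}" for x y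
    using field_differentiable_bound[of "{0..T}" a a' "\<bar>L\<bar>" x y] d L that order_trans[OF L abs_ge_self]
    by (simp add: abs_minus_commute)
  thus ?thesis using that[of "\<bar>L\<bar>"] by simp
qed

text \<open>For \<alpha> \<ge> 1 the exponent obtained is only 1, since the constant extension may
  have a corner at an endpoint.\<close>

lemma C_alpha_clamp_hoelder:
  assumes T: "0 < T" and \<alpha>: "0 < \<alpha>" and a: "C_alpha \<alpha> T a"
  obtains H \<beta> where "0 \<le> H" "0 < \<beta>" "\<alpha> < 1 \<longrightarrow> \<beta> = \<alpha>"
    "\<And>x y. \<bar>a (clamp T x) - a (clamp T y)\<bar> \<le> H * \<bar>x - y\<bar> powr \<beta>"
proof -
  have "\<exists>H\<ge>0. \<exists>\<beta>>0. (\<alpha> < 1 \<longrightarrow> \<beta> = \<alpha>) \<and> (\<forall>x\<in>{0..T}. \<forall>y\<in>{0..T}. \<bar>a x - a y\<bar> \<le> H * \<bar>x - y\<bar> powr \<beta>)"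
  proof (cases "\<alpha> < 1")
    case True
    then obtain H where "0 \<le> H" "\<And>x y. x \<in> {0..T} \<Longrightarrow> y \<in> {0..T} \<Longrightarrow> \<bar>a x - a y\<bar> \<le> H * \<bar>x - y\<bar> powr \<alpha>"
      using a hoelder_on_nonneg[of \<alpha> "{0..T}" a] unfolding C_alpha_def by (metis not_less)
    thus ?thesis using \<alpha> by blast
  next
    case False
    then obtain a' where a': "\<And>t. t \<in> {0..T} \<Longrightarrow> (a has_real_derivative a' t) (at t within {0..T})"
      "continuous_on {0..T} a'" using a unfolding C_alpha_def by blast
    obtain L where "0 \<le> L" "\<And>x y. x \<in> {0..T} \<Longrightarrow> y \<in> {0..T} \<Longrightarrow> \<bar>a x - a y\<bar> \<le> L * \<bar>x - y\<bar>"
      by (rule C1_lipschitz[OF a']) auto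
    thus ?thesis using False by (intro exI[of _ L] conjI exI[of _ 1]) auto
  qed
  then obtain H \<beta> where H: "0 \<le> H" "0 < \<beta>" "\<alpha> < 1 \<longrightarrow> \<beta> = \<alpha>"
    "\<And>x y. x \<in> {0..T} \<Longrightarrow> y \<in> {0..T} \<Longrightarrow> \<bar>a x - a y\<bar> \<le> H * \<bar>x - y\<bar> powr \<beta>" by blast
  show ?thesis
  proof (rule that[OF H(1-3)])
    fix x y
    have "\<bar>a (clamp T x) - a (clamp T y)\<bar> \<le> H * \<bar>clamp T x - clamp T y\<bar> powr \<beta>"
      using T by (intro H clamp_in) auto
    also have "\<dots> \<le> H * \<bar>x - y\<bar> powr \<beta>"
      using clamp_diff[of T x y] T H by (intro mult_left_mono powr_mono2) auto
    finally show "\<bar>a (clamp T x) - a (clamp T y)\<bar> \<le> H * \<bar>x - y\<bar> powr \<beta>" .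
  qed
qed

text \<open>Step length \<rho> and G = 0 suffice: the oscillation over \<rho> is at most H * \<rho>
  powr \<alpha>, and nonnegativity of A allows A x to be added to \<rho> powr \<alpha>.\<close>

lemma coeff_class_hoelder:
  assumes H: "0 \<le> H" and \<alpha>: "0 < \<alpha>" and A0: "\<And>x. 0 \<le> A x"
    and hoel: "\<And>x y. \<bar>A x - A y\<bar> \<le> H * \<bar>x - y\<bar> powr \<alpha>"
  shows "coeff_class \<alpha> H A"
  unfolding coeff_class_def
proof (intro allI impI, elim conjE)
  fix \<rho> :: real assume \<rho>: "0 < \<rho>" "\<rho> \<le> 1"
  have osc: "\<bar>A (x + h) - A x\<bar> \<le> H * \<rho> powr \<alpha>" if "h \<in> {0..\<rho>}" for x h
  proof -
    have "\<bar>A (x + h) - A x\<bar> \<le> H * \<bar>h\<bar> powr \<alpha>" using hoel[of "x + h" x] by simp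
    also have "\<dots> \<le> H * \<rho> powr \<alpha>" using H \<alpha> that by (intro mult_left_mono powr_mono2) auto
    finally show ?thesis .
  qed
  have "\<bar>A (x + \<rho>) - A x\<bar> \<le> H * \<rho> * (A x + \<rho> powr \<alpha>) / \<rho> + H * (0 - 0)" for x
  proof -
    have "\<bar>A (x + \<rho>) - A x\<bar> \<le> H * \<rho> powr \<alpha>" using osc[of \<rho> x] \<rho> by simp
    also have "\<dots> \<le> H * (A x + \<rho> powr \<alpha>)" using A0 H by (intro mult_left_mono) auto
    finally show ?thesis using \<rho> by simp
  qed
  thus "\<exists>r G. 0 < r \<and> uniformly_continuous_on UNIV G \<and>
     (\<forall>x. 0 \<le> G x \<and> G x \<le> H * \<rho> \<and> G x \<le> G (x + r)) \<and>
     (\<forall>x. \<bar>A (x + r) - A x\<bar> \<le> H * r * (A x + \<rho> powr \<alpha>) / \<rho> + H * (G (x + r) - G x)) \<and>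
     (\<forall>x. \<forall>h\<in>{0..r}. \<bar>A (x + h) - A x\<bar> \<le> H * \<rho> powr \<alpha>)"
    using \<rho> H osc by (intro exI[of _ \<rho>] exI[of _ "\<lambda>_. 0"] conjI) (auto intro: uniformly_continuous_on_const)
qed

text \<open>The clamped extension is only Lipschitz at the endpoints, where Glaeser's inequality fails;
  the monotone function G charges the increments in the boundary layers of width of order \<rho>.\<close>

lemma coeff_class_C1:
  assumes T: "0 < T" and \<alpha>: "1 \<le> \<alpha>" "\<alpha> < 2"
    and d: "\<And>t. t \<in> {0..T} \<Longrightarrow> (a has_real_derivative a' t) (at t within {0..T})"
    and H: "0 \<le> H" "\<And>x y. x \<in> {0..T} \<Longrightarrow> y \<in> {0..T} \<Longrightarrow> \<bar>a' x - a' y\<bar> \<le> H * \<bar>x - y\<bar> powr (\<alpha> - 1)"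
    and L: "0 \<le> L" "\<And>x y. x \<in> {0..T} \<Longrightarrow> y \<in> {0..T} \<Longrightarrow> \<bar>a x - a y\<bar> \<le> L * \<bar>x - y\<bar>"
    and a0: "\<And>t. t \<in> {0..T} \<Longrightarrow> 0 \<le> a t"
  shows "coeff_class \<alpha> (L + H + 4) (\<lambda>x. a (clamp T x))"
  unfolding coeff_class_def
proof (intro allI impI, elim conjE)
  fix \<rho> :: real assume \<rho>: "0 < \<rho>" "\<rho> \<le> 1"
  \<comment> \<open>\<delta> is also the step length r. The extension is Lipschitz, so its
    oscillation over r is of order r, which has to stay of order \<delta>.\<close>
  define \<delta> where "\<delta> = \<rho> powr \<alpha>"
  \<comment> \<open>L and H come from the regularity of a; the 4 bounds G, which rises by at most 2
    \<rho> in each of two layers.\<close>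
  define K where "K = L + H + 4"
  \<comment> \<open>The layers have width 2 \<rho>, although the derivative bound below is available
    at distance \<rho> from the endpoints: an interval of length at most \<delta> \<le> \<rho> that
    reaches into the layer of width \<rho> then lies in the wider one, where G has slope at least
    1.\<close>
  define G where "G x = min (clamp T x) (2 * \<rho>) + max 0 (clamp T x - (T - 2 * \<rho>))" for x
  have K: "0 \<le> K" "L \<le> K" "H + L \<le> K" "4 \<le> K" "1 \<le> K" using L(1) H(1) by (auto simp: K_def)
  have \<delta>: "0 < \<delta>" "\<delta> \<le> \<rho>" using \<rho> \<alpha> powr_mono'[of 1 \<alpha> \<rho>] by (auto simp: \<delta>_def)
  have mvt: "\<exists>x. y < x \<and> x < z \<and> a z - a y = a' x * (z - y)" if "0 \<le> y" "y < z" "z \<le> T" for y z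
  proof -
    have "(a has_derivative (\<lambda>h. a' x * h)) (at x within {y..z})" if "y \<le> x" "x \<le> z" for x
      using DERIV_subset[OF d[of x], of "{y..z}"] that \<open>0 \<le> y\<close> \<open>z \<le> T\<close> by (auto simp: has_field_derivative_def)
    from mvt_simple[OF that(2) this] show ?thesis by auto
  qed
  \<comment> \<open>Glaeser's inequality at the fixed scale \<rho>: a is nonnegative at x + \<rho>
    and x - \<rho>, and between these points a' differs from a' x by at most H * \<rho> powr
    (\<alpha> - 1).\<close>
  have bd: "\<bar>a' x\<bar> * \<rho> \<le> a x + H * \<delta>" if x: "\<rho> \<le> x" "x \<le> T - \<rho>" for x
  proof -
    have hol: "\<bar>a' x' - a' x\<bar> * \<rho> \<le> H * \<delta>" if "\<bar>x' - x\<bar> \<le> \<rho>" "x' \<in> {0..T}" for x'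
    proof -
      have "\<bar>a' x' - a' x\<bar> \<le> H * \<bar>x' - x\<bar> powr (\<alpha> - 1)" using that x \<rho> by (intro H) auto
      also have "\<dots> \<le> H * \<rho> powr (\<alpha> - 1)" using H that \<alpha> by (intro mult_left_mono powr_mono2) auto
      finally have "\<bar>a' x' - a' x\<bar> * \<rho> \<le> H * \<rho> powr (\<alpha> - 1) * \<rho>" using \<rho> by (intro mult_right_mono) auto
      also have "\<dots> = H * \<delta>" using \<rho> by (simp add: \<delta>_def powr_diff)
      finally show ?thesis .
    qed
    obtain x1 where x1: "x < x1" "x1 < x + \<rho>" "a (x + \<rho>) - a x = a' x1 * \<rho>"
      using mvt[of x "x + \<rho>"] x \<rho> by auto
    obtain x2 where x2: "x - \<rho> < x2" "x2 < x" "a x - a (x - \<rho>) = a' x2 * \<rho>"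
      using mvt[of "x - \<rho>" x] x \<rho> by auto
    have "(a' x1 - a' x) * \<rho> \<le> \<bar>a' x1 - a' x\<bar> * \<rho>" "- (a' x2 - a' x) * \<rho> \<le> \<bar>a' x2 - a' x\<bar> * \<rho>"
      using \<rho> by (intro mult_right_mono; simp)+
    moreover have "\<bar>a' x1 - a' x\<bar> * \<rho> \<le> H * \<delta>" "\<bar>a' x2 - a' x\<bar> * \<rho> \<le> H * \<delta>"
      using x1 x2 x \<rho> by (auto intro!: hol)
    ultimately have "a' x1 * \<rho> \<le> a' x * \<rho> + H * \<delta>" "a' x * \<rho> - H * \<delta> \<le> a' x2 * \<rho>"
      by (simp_all add: algebra_simps)
    moreover have "0 \<le> a (x + \<rho>)" "0 \<le> a (x - \<rho>)" using x \<rho> by (auto intro!: a0)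
    ultimately have "- (a' x * \<rho>) \<le> a x + H * \<delta>" "a' x * \<rho> \<le> a x + H * \<delta>" using x1 x2 by linarith+
    thus ?thesis using \<rho> by (simp add: abs_if)
  qed
  have lip: "\<bar>a (clamp T x) - a (clamp T y)\<bar> \<le> L * \<bar>clamp T x - clamp T y\<bar>" for x y
    using T by (intro L clamp_in) auto
  have Gm: "G x \<le> G y" if "x \<le> y" for x y
    using clamp_mono[OF that, of T] by (auto simp: G_def)
  have G1: "\<bar>a (clamp T (x + \<delta>)) - a (clamp T x)\<bar>
      \<le> K * \<delta> * (a (clamp T x) + \<delta>) / \<rho> + K * (G (x + \<delta>) - G x)" for x
  proof -
    define y z where "y = clamp T x" and "z = clamp T (x + \<delta>)"
    have yz: "0 \<le> y" "y \<le> z" "z \<le> T" "z - y \<le> \<delta>"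
      using clamp_in[of T x] clamp_in[of T "x + \<delta>"] clamp_mono[of x "x + \<delta>" T] clamp_diff[of T "x + \<delta>" x] T \<delta>
      by (auto simp: y_def z_def)
    have ay: "0 \<le> a y" using yz by (intro a0) auto
    have t1: "0 \<le> K * \<delta> * (a y + \<delta>) / \<rho>" using K \<delta> \<rho> ay by simp
    have t2: "0 \<le> K * (G (x + \<delta>) - G x)" using Gm[of x "x + \<delta>"] \<delta> K by simp
    \<comment> \<open>An interval reaching into a boundary layer is charged to G by the Lipschitz
      bound. Otherwise \<open>bd\<close> applies at an intermediate point w, and the Lipschitz bound
      replaces a w by a y at a cost of order \<delta>.\<close>
    show ?thesis
    proof (cases "y = z \<or> y < \<rho> \<or> T - \<rho> < z")
      case True
      have "\<bar>a z - a y\<bar> \<le> K * (z - y)"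
        using lip[of "x + \<delta>" x] yz mult_right_mono[OF K(2), of "z - y"] by (simp add: y_def z_def)
      moreover have "z - y \<le> G (x + \<delta>) - G x"
        using True yz \<delta> \<rho> unfolding G_def y_def[symmetric] z_def[symmetric] by (auto simp: min_def max_def)
      ultimately have "\<bar>a z - a y\<bar> \<le> K * (G (x + \<delta>) - G x)"
        using mult_left_mono[of "z - y" "G (x + \<delta>) - G x" K] K by linarith
      thus ?thesis using t1 by (simp add: y_def z_def)
    next
      case False
      then obtain w where w: "y < w" "w < z" "a z - a y = a' w * (z - y)"
        using mvt[of y z] yz by auto
      have "a w \<le> a y + L * \<delta>"
      proof -
        have "\<bar>a w - a y\<bar> \<le> L * \<bar>w - y\<bar>" using w yz by (intro L) auto
        also have "\<dots> \<le> L * \<delta>" using w yz L by (intro mult_left_mono) auto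
        finally show ?thesis by linarith
      qed
      moreover have "\<bar>a' w\<bar> * \<rho> \<le> a w + H * \<delta>" using False w by (intro bd) auto
      ultimately have "\<bar>a' w\<bar> * \<rho> \<le> a y + (H + L) * \<delta>" by (simp add: algebra_simps)
      also have "\<dots> \<le> K * (a y + \<delta>)"
      proof -
        have "(H + L) * \<delta> \<le> K * \<delta>" "1 * a y \<le> K * a y"
          using K \<delta> ay by (intro mult_right_mono; simp)+
        thus ?thesis unfolding distrib_left by linarith
      qed
      finally have "\<bar>a' w\<bar> \<le> K * (a y + \<delta>) / \<rho>" using \<rho> by (simp add: pos_le_divide_eq)
      hence "\<bar>a' w\<bar> * (z - y) \<le> K * (a y + \<delta>) / \<rho> * \<delta>"
        using yz by (intro mult_mono) auto
      hence "\<bar>a z - a y\<bar> \<le> K * \<delta> * (a y + \<delta>) / \<rho>"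
        unfolding w(3) using yz by (simp add: abs_mult mult_ac)
      thus ?thesis using t2 by (simp add: y_def z_def)
    qed
  qed
  have Gu: "uniformly_continuous_on UNIV G"
  proof (rule hoelder_uniformly_continuous[of 2 1])
    show "\<bar>G x - G y\<bar> \<le> 2 * \<bar>x - y\<bar> powr 1" for x y
      using clamp_diff[of T x y] T by (auto simp: G_def min_def max_def abs_if split: if_splits)
  qed auto
  have Gb: "0 \<le> G x" "G x \<le> K * \<rho>" for x
  proof -
    have "G x \<le> 4 * \<rho>" using clamp_in[of T x] T \<rho> by (auto simp: G_def)
    also have "\<dots> \<le> K * \<rho>" using K \<rho> by (intro mult_right_mono) auto
    finally show "G x \<le> K * \<rho>" .
    show "0 \<le> G x" using clamp_in[of T x] T \<rho> by (auto simp: G_def)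
  qed
  have osc: "\<bar>a (clamp T (x + h)) - a (clamp T x)\<bar> \<le> K * \<delta>" if "h \<in> {0..\<delta>}" for x h
  proof -
    have "\<bar>a (clamp T (x + h)) - a (clamp T x)\<bar> \<le> L * \<bar>clamp T (x + h) - clamp T x\<bar>" by (rule lip)
    also have "\<dots> \<le> K * \<delta>"
      using clamp_diff[of T "x + h" x] T that K by (intro mult_mono) auto
    finally show ?thesis .
  qed
  have "0 < \<delta> \<and> uniformly_continuous_on UNIV G \<and>
     (\<forall>x. 0 \<le> G x \<and> G x \<le> K * \<rho> \<and> G x \<le> G (x + \<delta>)) \<and>
     (\<forall>x. \<bar>a (clamp T (x + \<delta>)) - a (clamp T x)\<bar> \<le> K * \<delta> * (a (clamp T x) + \<delta>) / \<rho> + K * (G (x + \<delta>) - G x)) \<and>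
     (\<forall>x. \<forall>h\<in>{0..\<delta>}. \<bar>a (clamp T (x + h)) - a (clamp T x)\<bar> \<le> K * \<delta>)"
    using \<delta>(1) Gu Gb Gm G1 osc by (intro conjI allI ballI) (auto intro: Gm)
  thus "\<exists>r G. 0 < r \<and> uniformly_continuous_on UNIV G \<and>
     (\<forall>x. 0 \<le> G x \<and> G x \<le> (L + H + 4) * \<rho> \<and> G x \<le> G (x + r)) \<and>
     (\<forall>x. \<bar>a (clamp T (x + r)) - a (clamp T x)\<bar> \<le> (L + H + 4) * r * (a (clamp T x) + \<rho> powr \<alpha>) / \<rho> + (L + H + 4) * (G (x + r) - G x)) \<and>
     (\<forall>x. \<forall>h\<in>{0..r}. \<bar>a (clamp T (x + h)) - a (clamp T x)\<bar> \<le> (L + H + 4) * \<rho> powr \<alpha>)"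
    unfolding K_def \<delta>_def by blast
qed

section \<open>Limits in the weighted spaces\<close>


lemma wt_pos: "0 < wt s mu \<eta> \<xi>"
  by (simp add: wt_def)

lemma nw_le_of_wbound: "(\<And>\<xi>. 0 \<le> w \<xi>) \<Longrightarrow> wbound w v M \<Longrightarrow> nw w v \<le> M"
  by (simp add: wbound_iff)

lemma Hw_of_wbound: "(\<And>\<xi>. 0 \<le> w \<xi>) \<Longrightarrow> wbound w v M \<Longrightarrow> Hw w v"
  by (simp add: wbound_iff)

lemma Hw_diff:
  assumes "\<And>\<xi>. 0 \<le> w \<xi>" "Hw w u" "Hw w v"
  shows "Hw w (\<lambda>\<xi>. u \<xi> - v \<xi>)"
  by (rule Hw_of_wbound[OF assms(1) wbound_diff]) (rule assms Hw_imp_wbound)+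

lemma wbound_triangle:
  assumes "\<And>\<xi>. 0 \<le> w \<xi>" "wbound w (\<lambda>\<xi>. u \<xi> - v \<xi>) M" "wbound w (\<lambda>\<xi>. v \<xi> - z \<xi>) N"
  shows "wbound w (\<lambda>\<xi>. u \<xi> - z \<xi>) (M + N)"
  using wbound_add[OF assms] by simp

text \<open>Heine-Cantor in the weighted norm: pairs of times that come arbitrarily close have
  subsequences with a common limit l, and continuity at l contradicts their staying e apart.\<close>

lemma uniform_wbound_continuity:
  fixes D :: "real \<Rightarrow> 'i \<Rightarrow> complex"
  assumes w: "\<And>\<xi>. 0 \<le> w \<xi>" and H: "\<And>t. t \<in> {0..T} \<Longrightarrow> Hw w (D t)"
    and lim: "\<And>t. t \<in> {0..T} \<Longrightarrow> ((\<lambda>t'. nw w (\<lambda>\<xi>. D t' \<xi> - D t \<xi>)) \<longlongrightarrow> 0) (at t within {0..T})"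
    and e: "0 < e"
  shows "\<exists>d>0. \<forall>t\<in>{0..T}. \<forall>t'\<in>{0..T}. \<bar>t - t'\<bar> < d \<longrightarrow> wbound w (\<lambda>\<xi>. D t \<xi> - D t' \<xi>) e"
proof (rule ccontr)
  assume "\<not> ?thesis"
  hence neg: "\<exists>t\<in>{0..T}. \<exists>t'\<in>{0..T}. \<bar>t - t'\<bar> < d \<and> \<not> wbound w (\<lambda>\<xi>. D t \<xi> - D t' \<xi>) e" if "0 < d" for d
    using that by blast
  have "\<exists>x y. x \<in> {0..T} \<and> y \<in> {0..T} \<and> \<bar>x - y\<bar> < 1 / real (Suc n) \<and> \<not> wbound w (\<lambda>\<xi>. D x \<xi> - D y \<xi>) e" for n
    using neg[of "1 / real (Suc n)"] by (simp add: Bex_def)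
  then obtain x y where xy: "\<And>n. x n \<in> {0..T}" "\<And>n. y n \<in> {0..T}" "\<And>n. \<bar>x n - y n\<bar> < 1 / real (Suc n)"
    "\<And>n. \<not> wbound w (\<lambda>\<xi>. D (x n) \<xi> - D (y n) \<xi>) e"
    by metis
  have "seq_compact {0..T}" using compact_Icc by (rule compact_imp_seq_compact)
  then obtain l r where l: "l \<in> {0..T}" and r: "strict_mono r" and xl: "(x \<circ> r) \<longlonglongrightarrow> l"
    using xy(1) by (metis seq_compactE)
  have "(\<lambda>n. \<bar>x (r n) - y (r n)\<bar>) \<longlonglongrightarrow> 0"
  proof (rule tendsto_sandwich[of "\<lambda>_. 0" _ _ "\<lambda>n. 1 / real (Suc n)"])
    show "\<forall>\<^sub>F n in sequentially. \<bar>x (r n) - y (r n)\<bar> \<le> 1 / real (Suc n)"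
    proof (intro always_eventually allI)
      fix n
      have "1 / real (Suc (r n)) \<le> 1 / real (Suc n)"
        using seq_suble[OF r, of n] by (intro divide_left_mono) auto
      thus "\<bar>x (r n) - y (r n)\<bar> \<le> 1 / real (Suc n)" using xy(3)[of "r n"] by linarith
    qed
    show "(\<lambda>n. 1 / real (Suc n)) \<longlonglongrightarrow> 0"
      using LIMSEQ_inverse_real_of_nat by (simp only: inverse_eq_divide)
  qed auto
  hence "(\<lambda>n. x (r n) - y (r n)) \<longlonglongrightarrow> 0" by (simp add: tendsto_rabs_zero_iff)
  from tendsto_diff[OF xl this] have yl: "(y \<circ> r) \<longlonglongrightarrow> l" by (simp add: o_def)
  have "eventually (\<lambda>t'. nw w (\<lambda>\<xi>. D t' \<xi> - D l \<xi>) < e / 2) (at l within {0..T})"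
    using order_tendstoD(2)[OF lim[OF l], of "e / 2"] e by simp
  then obtain d where d: "0 < d" "\<And>t. t \<in> {0..T} \<Longrightarrow> t \<noteq> l \<Longrightarrow> dist t l < d \<Longrightarrow> nw w (\<lambda>\<xi>. D t \<xi> - D l \<xi>) < e / 2"
    unfolding eventually_at by blast
  have near: "wbound w (\<lambda>\<xi>. D t \<xi> - D l \<xi>) (e / 2)" if "t \<in> {0..T}" "dist t l < d" for t
  proof (cases "t = l")
    case False
    have "wbound w (\<lambda>\<xi>. D t \<xi> - D l \<xi>) (nw w (\<lambda>\<xi>. D t \<xi> - D l \<xi>))"
      by (intro Hw_imp_wbound Hw_diff w H that(1) l)
    thus ?thesis by (rule wbound_mono) (use d(2)[OF that(1) False that(2)] in simp)
  qed (use e in \<open>simp add: wbound_zero\<close>)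
  have "eventually (\<lambda>n. dist ((x \<circ> r) n) l < d) sequentially" "eventually (\<lambda>n. dist ((y \<circ> r) n) l < d) sequentially"
    using tendstoD[OF xl d(1)] tendstoD[OF yl d(1)] .
  hence "eventually (\<lambda>n. False) sequentially"
  proof eventually_elim
    case (elim n)
    have "wbound w (\<lambda>\<xi>. D (x (r n)) \<xi> - D (y (r n)) \<xi>) (e / 2 + e / 2)"
      using near[OF xy(1)[of "r n"]] near[OF xy(2)[of "r n"]] elim
      by (intro wbound_triangle[OF w]) (auto intro: wbound_diff_commute)
    with xy(4)[of "r n"] show False by simp
  qed
  thus False by simp
qed

text \<open>By the reverse triangle inequality the norm is a continuous function of time on a
  compact interval.\<close>

lemma wbound_uniform:
  fixes D :: "real \<Rightarrow> 'i \<Rightarrow> complex"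
  assumes w: "\<And>\<xi>. 0 \<le> w \<xi>" and H: "\<And>t. t \<in> {0..T} \<Longrightarrow> Hw w (D t)"
    and lim: "\<And>t. t \<in> {0..T} \<Longrightarrow> ((\<lambda>t'. nw w (\<lambda>\<xi>. D t' \<xi> - D t \<xi>)) \<longlongrightarrow> 0) (at t within {0..T})"
  shows "\<exists>M. \<forall>t\<in>{0..T}. wbound w (D t) M"
proof -
  have "continuous_on {0..T} (\<lambda>t. nw w (D t))"
    unfolding continuous_on_def
  proof
    fix t assume t: "t \<in> {0..T}"
    have b: "\<bar>nw w (D t') - nw w (D t)\<bar> \<le> nw w (\<lambda>\<xi>. D t' \<xi> - D t \<xi>)" if t': "t' \<in> {0..T}" for t'
    proof -
      have d: "wbound w (\<lambda>\<xi>. D t' \<xi> - D t \<xi>) (nw w (\<lambda>\<xi>. D t' \<xi> - D t \<xi>))"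
        by (intro Hw_imp_wbound Hw_diff w H t t')
      have "wbound w (\<lambda>\<xi>. D t \<xi> + (D t' \<xi> - D t \<xi>)) (nw w (D t) + nw w (\<lambda>\<xi>. D t' \<xi> - D t \<xi>))"
        by (intro wbound_add w d Hw_imp_wbound H t)
      moreover have "wbound w (\<lambda>\<xi>. D t' \<xi> - (D t' \<xi> - D t \<xi>)) (nw w (D t') + nw w (\<lambda>\<xi>. D t' \<xi> - D t \<xi>))"
        by (intro wbound_diff w d Hw_imp_wbound H t')
      ultimately show ?thesis using nw_le_of_wbound[OF w] by (simp add: abs_le_iff) force
    qed
    show "((\<lambda>t. nw w (D t)) \<longlongrightarrow> nw w (D t)) (at t within {0..T})"
      by (rule Lim_null_comparison[OF _ lim[OF t], of "\<lambda>t'. nw w (D t') - nw w (D t)", THEN LIM_zero_cancel])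
         (use b in \<open>auto simp: eventually_at_filter\<close>)
  qed
  hence "bounded ((\<lambda>t. nw w (D t)) ` {0..T})"
    by (intro compact_imp_bounded compact_continuous_image) auto
  then obtain M where "\<forall>t\<in>{0..T}. \<bar>nw w (D t)\<bar> \<le> M" unfolding bounded_iff by auto
  hence "wbound w (D t) M" if "t \<in> {0..T}" for t
    using that by (intro wbound_mono[OF Hw_imp_wbound[OF w H[OF that]]]) force
  thus ?thesis by blast
qed

lemma component_le:
  assumes "0 < w \<xi>" "wbound w v e"
  shows "cmod (v \<xi>) \<le> e / sqrt (w \<xi>)"
  using wbound_component[OF assms(2), of \<xi>] assms(1) by (simp add: pos_le_divide_eq mult.commute)

lemma component_continuous:
  fixes D :: "real \<Rightarrow> 'i \<Rightarrow> complex"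
  assumes w: "0 < w \<xi>"
    and uc: "\<And>e. 0 < e \<Longrightarrow> \<exists>d>0. \<forall>t\<in>{0..T}. \<forall>t'\<in>{0..T}. \<bar>t - t'\<bar> < d \<longrightarrow> wbound w (\<lambda>\<xi>. D t \<xi> - D t' \<xi>) e"
  shows "continuous_on {0..T} (\<lambda>t. D t \<xi>)"
  unfolding continuous_on_iff
proof (intro ballI allI impI)
  fix t e :: real assume t: "t \<in> {0..T}" and e: "0 < e"
  define e' where "e' = e / 2 * sqrt (w \<xi>)"
  have e': "0 < e'" using e w by (simp add: e'_def)
  obtain d where d: "0 < d" "\<And>t t'. t \<in> {0..T} \<Longrightarrow> t' \<in> {0..T} \<Longrightarrow> \<bar>t - t'\<bar> < d \<Longrightarrow> wbound w (\<lambda>\<xi>. D t \<xi> - D t' \<xi>) e'"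
    using uc[OF e'] by blast
  have "dist (D t' \<xi>) (D t \<xi>) < e" if "t' \<in> {0..T}" "dist t' t < d" for t'
    using component_le[OF w d(2)[OF that(1) t]] that e w by (simp add: e'_def dist_norm)
  thus "\<exists>d>0. \<forall>x'\<in>{0..T}. dist x' t < d \<longrightarrow> dist (D x' \<xi>) (D t \<xi>) < e" using d(1) by blast
qed

text \<open>A positive weight makes the norm dominate each single coefficient, so differentiability
  in norm descends to the ordinary derivatives that the mode estimates require.\<close>

lemma ck_family_component_derivative:
  assumes w: "\<And>\<xi>. 0 < w \<xi>" and D: "ck_family w T k D" and p: "p < k" and t: "t \<in> {0..T}"
  shows "((\<lambda>t. D p t \<xi>) has_vector_derivative D (Suc p) t \<xi>) (at t within {0..T})"
  unfolding has_vector_derivative_def has_derivative_within_alt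
proof (intro conjI allI impI)
  show "bounded_linear (\<lambda>x. x *\<^sub>R D (Suc p) t \<xi>)" by (rule bounded_linear_scaleR_left)
  have w': "\<And>\<xi>. 0 \<le> w \<xi>" using w less_imp_le by blast
  have H: "Hw w (D q t)" if "q \<le> k" "t \<in> {0..T}" for q t
    using D that unfolding ck_family_def by blast
  let ?q = "\<lambda>h \<xi>. (D p (t + h) \<xi> - D p t \<xi>) / complex_of_real h - D (Suc p) t \<xi>"
  have lim: "((\<lambda>h. nw w (?q h)) \<longlongrightarrow> 0) (at 0 within {h. t + h \<in> {0..T}})"
    using D p t unfolding ck_family_def by blast
  fix e :: real assume e: "0 < e"
  have "0 < e * sqrt (w \<xi>)" using e w[of \<xi>] by simp
  from order_tendstoD(2)[OF lim this] obtain d where d: "0 < d"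
    "\<And>h. t + h \<in> {0..T} \<Longrightarrow> h \<noteq> 0 \<Longrightarrow> dist h 0 < d \<Longrightarrow> nw w (?q h) < e * sqrt (w \<xi>)"
    unfolding eventually_at by blast
  have "cmod (D p y \<xi> - D p t \<xi> - (y - t) *\<^sub>R D (Suc p) t \<xi>) \<le> e * \<bar>y - t\<bar>"
    if y: "y \<in> {0..T}" "\<bar>y - t\<bar> < d" for y
  proof (cases "y = t")
    case False
    define h where "h = y - t"
    have h: "h \<noteq> 0" "t + h = y" using False by (auto simp: h_def)
    have "wbound w (\<lambda>\<xi>. inverse (complex_of_real h) * (D p (t + h) \<xi> - D p t \<xi>)) (cmod (inverse (complex_of_real h)) * nw w (\<lambda>\<xi>. D p (t + h) \<xi> - D p t \<xi>))"
      using y t p h by (intro wbound_scale Hw_imp_wbound Hw_diff w' H) auto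
    hence "Hw w (?q h)"
      using t p by (intro Hw_diff w' H) (auto intro: Hw_of_wbound[OF w'] simp: divide_inverse mult.commute)
    hence "wbound w (?q h) (nw w (?q h))" by (rule Hw_imp_wbound[OF w'])
    hence "cmod (?q h \<xi>) \<le> nw w (?q h) / sqrt (w \<xi>)" by (rule component_le[of w \<xi>, OF w])
    also have "\<dots> \<le> e" using d(2)[of h] h y w[of \<xi>] by (simp add: h_def pos_divide_le_eq)
    finally have "\<bar>h\<bar> * cmod (?q h \<xi>) \<le> \<bar>h\<bar> * e" by (rule mult_left_mono) simp
    hence "cmod (complex_of_real h * ?q h \<xi>) \<le> e * \<bar>h\<bar>" by (simp only: norm_mult norm_of_real mult.commute)
    moreover have "complex_of_real h * ?q h \<xi> = D p y \<xi> - D p t \<xi> - h *\<^sub>R D (Suc p) t \<xi>"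
      using h by (simp add: field_simps scaleR_conv_of_real)
    ultimately show ?thesis by (simp add: h_def)
  qed simp
  thus "\<exists>d>0. \<forall>y\<in>{0..T}. norm (y - t) < d \<longrightarrow>
      norm (D p y \<xi> - D p t \<xi> - (y - t) *\<^sub>R D (Suc p) t \<xi>) \<le> e * norm (y - t)"
    using d(1) by (intro exI[of _ d]) auto
qed

text \<open>The hypotheses are uniform in t because the limit arguments below produce moduli that
  are uniform over [0, T].\<close>

lemma ck_familyI:
  assumes w: "\<And>\<xi>. 0 \<le> w \<xi>"
    and b: "\<And>p t. p \<le> k \<Longrightarrow> t \<in> {0..T} \<Longrightarrow> wbound w (D p t) M"
    and uc: "\<And>p e. p \<le> k \<Longrightarrow> 0 < e \<Longrightarrow> \<exists>d>0. \<forall>t\<in>{0..T}. \<forall>t'\<in>{0..T}. \<bar>t - t'\<bar> < d \<longrightarrow> wbound w (\<lambda>\<xi>. D p t \<xi> - D p t' \<xi>) e"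
    and der: "\<And>p e. p < k \<Longrightarrow> 0 < e \<Longrightarrow> \<exists>d>0. \<forall>t\<in>{0..T}. \<forall>h. h \<noteq> 0 \<longrightarrow> \<bar>h\<bar> < d \<longrightarrow> t + h \<in> {0..T} \<longrightarrow>
        wbound w (\<lambda>\<xi>. (D p (t + h) \<xi> - D p t \<xi>) / complex_of_real h - D (Suc p) t \<xi>) e"
  shows "ck_family w T k D"
  unfolding ck_family_def
proof (intro conjI allI impI ballI)
  show "Hw w (D p t)" if "p \<le> k" "t \<in> {0..T}" for p t using Hw_of_wbound[OF w b[OF that]] .
  show "((\<lambda>t'. nw w (\<lambda>\<xi>. D p t' \<xi> - D p t \<xi>)) \<longlongrightarrow> 0) (at t within {0..T})" if p: "p \<le> k" and t: "t \<in> {0..T}" for p t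
  proof (rule tendstoI)
    fix e :: real assume e: "0 < e"
    then obtain d where d: "0 < d" "\<And>t t'. t \<in> {0..T} \<Longrightarrow> t' \<in> {0..T} \<Longrightarrow> \<bar>t - t'\<bar> < d \<Longrightarrow> wbound w (\<lambda>\<xi>. D p t \<xi> - D p t' \<xi>) (e / 2)"
      using uc[OF p, of "e / 2"] by auto
    have "dist (nw w (\<lambda>\<xi>. D p t' \<xi> - D p t \<xi>)) 0 < e" if "t' \<in> {0..T}" "dist t' t < d" for t'
      using nw_le_of_wbound[OF w d(2)[OF that(1) t]] that e nw_nonneg[of w "\<lambda>\<xi>. D p t' \<xi> - D p t \<xi>", OF w] by (simp add: dist_real_def)
    thus "\<forall>\<^sub>F t' in at t within {0..T}. dist (nw w (\<lambda>\<xi>. D p t' \<xi> - D p t \<xi>)) 0 < e"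
      unfolding eventually_at using d(1) by blast
  qed
  show "((\<lambda>h. nw w (\<lambda>\<xi>. (D p (t + h) \<xi> - D p t \<xi>) / complex_of_real h - D (Suc p) t \<xi>)) \<longlongrightarrow> 0)
      (at 0 within {h. t + h \<in> {0..T}})" if p: "p < k" and t: "t \<in> {0..T}" for p t
  proof (rule tendstoI)
    let ?q = "\<lambda>h \<xi>. (D p (t + h) \<xi> - D p t \<xi>) / complex_of_real h - D (Suc p) t \<xi>"
    fix e :: real assume e: "0 < e"
    then obtain d where d: "0 < d" "\<And>h. h \<noteq> 0 \<Longrightarrow> \<bar>h\<bar> < d \<Longrightarrow> t + h \<in> {0..T} \<Longrightarrow> wbound w (?q h) (e / 2)"
      using der[OF p, of "e / 2"] t by auto
    have "dist (nw w (?q h)) 0 < e" if "t + h \<in> {0..T}" "h \<noteq> 0" "dist h 0 < d" for h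
      using nw_le_of_wbound[OF w d(2)[OF that(2) _ that(1)]] that e nw_nonneg[of w "?q h", OF w] by (simp add: dist_real_def)
    thus "\<forall>\<^sub>F h in at 0 within {h. t + h \<in> {0..T}}. dist (nw w (?q h)) 0 < e"
      unfolding eventually_at using d(1) by blast
  qed
qed

text \<open>For fixed n the error of the difference quotient is controlled by X' n s - X' n t for s
  between t and t + h. Three thirds of e cover the approximation of V' at s, its modulus of
  continuity and its approximation at t; the bound is kept as n grows with h fixed.\<close>

lemma uniform_limit_derivative:
  fixes X X' :: "nat \<Rightarrow> real \<Rightarrow> 'i \<Rightarrow> complex"
  assumes w: "\<And>\<xi>. 0 < w \<xi>"
    and der: "\<And>n t \<xi>. t \<in> {0..T} \<Longrightarrow> ((\<lambda>t. X n t \<xi>) has_vector_derivative X' n t \<xi>) (at t within {0..T})"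
    and X: "\<And>t \<xi>. t \<in> {0..T} \<Longrightarrow> (\<lambda>n. X n t \<xi>) \<longlonglongrightarrow> V t \<xi>"
    and X': "\<And>t \<xi>. t \<in> {0..T} \<Longrightarrow> (\<lambda>n. X' n t \<xi>) \<longlonglongrightarrow> V' t \<xi>"
    and unif: "\<And>e. 0 < e \<Longrightarrow> \<forall>\<^sub>F n in sequentially. \<forall>t\<in>{0..T}. wbound w (\<lambda>\<xi>. X' n t \<xi> - V' t \<xi>) e"
    and uc: "\<And>e. 0 < e \<Longrightarrow> \<exists>d>0. \<forall>t\<in>{0..T}. \<forall>t'\<in>{0..T}. \<bar>t - t'\<bar> < d \<longrightarrow> wbound w (\<lambda>\<xi>. V' t \<xi> - V' t' \<xi>) e"
    and e: "0 < e"
  shows "\<exists>d>0. \<forall>t\<in>{0..T}. \<forall>h. h \<noteq> 0 \<longrightarrow> \<bar>h\<bar> < d \<longrightarrow> t + h \<in> {0..T} \<longrightarrow>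
        wbound w (\<lambda>\<xi>. (V (t + h) \<xi> - V t \<xi>) / complex_of_real h - V' t \<xi>) e"
proof -
  have w': "\<And>\<xi>. 0 \<le> w \<xi>" using w less_imp_le by blast
  obtain d where d: "0 < d" "\<And>t t'. t \<in> {0..T} \<Longrightarrow> t' \<in> {0..T} \<Longrightarrow> \<bar>t - t'\<bar> < d \<Longrightarrow> wbound w (\<lambda>\<xi>. V' t \<xi> - V' t' \<xi>) (e / 3)"
    using uc[of "e / 3"] e by auto
  have "wbound w (\<lambda>\<xi>. (V (t + h) \<xi> - V t \<xi>) / complex_of_real h - V' t \<xi>) e"
    if t: "t \<in> {0..T}" and h: "h \<noteq> 0" "\<bar>h\<bar> < d" "t + h \<in> {0..T}" for t h
  proof (rule wbound_tendsto[where F = sequentially])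
    show "(\<lambda>n. (X n (t + h) \<xi> - X n t \<xi>) / complex_of_real h - X' n t \<xi>)
      \<longlonglongrightarrow> (V (t + h) \<xi> - V t \<xi>) / complex_of_real h - V' t \<xi>" for \<xi>
      using h by (intro tendsto_intros X X' t) auto
    have "\<forall>\<^sub>F n in sequentially. \<forall>t\<in>{0..T}. wbound w (\<lambda>\<xi>. X' n t \<xi> - V' t \<xi>) (e / 3)"
      using unif[of "e / 3"] e by simp
    thus "\<forall>\<^sub>F n in sequentially. wbound w (\<lambda>\<xi>. (X n (t + h) \<xi> - X n t \<xi>) / complex_of_real h - X' n t \<xi>) e"
    proof eventually_elim
      case (elim n)
      \<comment> \<open>The ordered endpoints treat positive and negative h together.\<close>
      define l r where "l = min t (t + h)" and "r = max t (t + h)"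
      have lr: "l \<le> r" "{l..r} \<subseteq> {0..T}" "r - l = \<bar>h\<bar>" "\<And>s. s \<in> {l..r} \<Longrightarrow> \<bar>s - t\<bar> < d"
        using t h by (auto simp: l_def r_def)
      \<comment> \<open>Subtracting the linear motion with velocity X' n t leaves a function with
        derivative X' n s - X' n t, so the mean value bound measures exactly the error of the
        difference quotient.\<close>
      define D where "D s \<xi> = X n s \<xi> - s *\<^sub>R X' n t \<xi>" for s \<xi>
      have "wbound w (\<lambda>\<xi>. D r \<xi> - D l \<xi>) (e * (r - l))"
      proof (rule wbound_mvt[OF w' lr(1)])
        fix s \<xi> assume s: "s \<in> {l..r}"
        have "((\<lambda>s. X n s \<xi>) has_vector_derivative X' n s \<xi>) (at s within {l..r})"
          using s lr(2) by (intro has_vector_derivative_within_subset[OF der]) auto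
        thus "((\<lambda>s. D s \<xi>) has_vector_derivative X' n s \<xi> - X' n t \<xi>) (at s within {l..r})"
          unfolding D_def by (auto intro!: derivative_eq_intros)
      next
        fix s assume s: "s \<in> {l..r}"
        have s0: "s \<in> {0..T}" using s lr(2) by blast
        have "wbound w (\<lambda>\<xi>. X' n s \<xi> - X' n t \<xi>) (e / 3 + (e / 3 + e / 3))"
          by (intro wbound_triangle[where w = w and u = "X' n s" and v = "V' s", OF w']
              wbound_triangle[where w = w and u = "V' s" and v = "V' t", OF w']
              d(2) wbound_diff_commute[of w "X' n t" "V' t"] elim[rule_format] s0 t lr(4)[OF s])
        thus "wbound w (\<lambda>\<xi>. X' n s \<xi> - X' n t \<xi>) e" by simp
      qed
      from wbound_scale[OF w' this, of "inverse (complex_of_real (r - l))"]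
      have "wbound w (\<lambda>\<xi>. inverse (complex_of_real (r - l)) * (D r \<xi> - D l \<xi>))
          (cmod (inverse (complex_of_real (r - l))) * (e * (r - l)))" .
      moreover have "cmod (inverse (complex_of_real (r - l))) * (e * (r - l)) = e"
        unfolding lr(3) using h by (simp add: norm_inverse)
      moreover have "inverse (complex_of_real (r - l)) * (D r \<xi> - D l \<xi>)
           = (X n (t + h) \<xi> - X n t \<xi>) / complex_of_real h - X' n t \<xi>" for \<xi>
        using h by (cases "0 < h") (auto simp: l_def r_def D_def min_def max_def scaleR_conv_of_real field_simps)
      ultimately show ?case by (simp only:)
    qed
  qed simp
  thus ?thesis using d(1) by blast
qed

text \<open>Two classical solutions may belong to different weights. A single coefficient of their
  difference solves a homogeneous equation with zero data, where the weights no longer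
  enter.\<close>

lemma classical_solution_unique:
  assumes T: "0 < T" and lam: "\<And>\<xi>. 0 \<le> lam \<xi>" and a: "\<And>t. t \<in> {0..T} \<Longrightarrow> \<bar>a t\<bar> \<le> K"
    and V: "classical_solution s lam c T a f u0 u1 V" and W: "classical_solution s lam c T a f u0 u1 W"
    and t: "t \<in> {0..T}"
  shows "W 0 t = V 0 t"
proof
  fix \<xi>
  define D where "D p t = W p t \<xi> - V p t \<xi>" for p t
  obtain \<eta>1 \<eta>2 where ck: "ck_family (wt s (mu_of lam c) \<eta>1) T 2 V" "ck_family (wt s (mu_of lam c) \<eta>2) T 2 W"
    using V W unfolding classical_solution_def by blast
  have der: "(D p has_vector_derivative D (Suc p) t) (at t within {0..T})" if "p < 2" "t \<in> {0..T}" for p t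
    unfolding D_def using that
    by (intro has_vector_derivative_diff ck_family_component_derivative[OF wt_pos ck(1)] ck_family_component_derivative[OF wt_pos ck(2)])
  have eq: "D 2 t = 0 - complex_of_real (a t * lam \<xi>) * D 0 t" if "t \<in> {0..T}" for t
  proof -
    have "V 2 t \<xi> + complex_of_real (a t * lam \<xi>) * V 0 t \<xi> = f t \<xi>" "W 2 t \<xi> + complex_of_real (a t * lam \<xi>) * W 0 t \<xi> = f t \<xi>"
      using V W that unfolding classical_solution_def by blast+
    thus ?thesis unfolding D_def by (simp add: algebra_simps)
  qed
  have init: "D 0 0 = 0" "D 1 0 = 0" using V W by (auto simp: classical_solution_def D_def)
  \<comment> \<open>For the constant energy coefficient 1 this bounds sqrt lam * |1 - a|. The
    resulting growth is too large for a weighted estimate, but any finite factor gives uniqueness in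
    one mode.\<close>
  define q where "q = sqrt (lam \<xi>) * (1 + K)"
  have K: "0 \<le> K" using a[OF t] by linarith
  have q: "0 \<le> q" using lam[of \<xi>] K by (simp add: q_def)
  have adm: "admissible a T (lam \<xi>) (T * q) 1"
    unfolding admissible_def
  proof (rule exI[of _ "\<lambda>_. 1"], rule exI[of _ "\<lambda>_. 0"], rule exI[of _ "\<lambda>t. t * q"], rule exI[of _ "\<lambda>_. q"], intro ballI conjI)
    fix t assume t: "t \<in> {0..T}"
    show "((\<lambda>t. t * q) has_real_derivative q) (at t within {0..T})" by (auto intro!: derivative_eq_intros)
    show "0 \<le> t * q" "t * q \<le> T * q" using t q by (auto intro: mult_right_mono)
    have "sqrt (lam \<xi>) * \<bar>1 - a t\<bar> \<le> q"
      unfolding q_def using a[OF t] lam[of \<xi>] by (intro mult_left_mono) auto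
    thus "\<bar>0\<bar> / 1 + sqrt (lam \<xi>) * \<bar>1 - a t\<bar> / sqrt 1 \<le> q" by simp
  qed auto
  have d0: "(D 0 has_vector_derivative D 1 t) (at t within {0..T})"
    and d1: "(D 1 has_vector_derivative D 2 t) (at t within {0..T})" if "t \<in> {0..T}" for t
    using der[of 0 t] der[of 1 t] that by (simp_all add: numeral_2_eq_2)
  obtain E E' where E: "\<And>t. t \<in> {0..T} \<Longrightarrow> (E has_real_derivative E' t) (at t within {0..T}) \<and> E' t \<le> (cmod 0)\<^sup>2 \<and>
      exp (- (T * q) - 2 * T) * ((cmod (D 0 t))\<^sup>2 + (cmod (D 1 t))\<^sup>2) \<le> E t"
    and "E 0 \<le> (1 + lam \<xi> * 1) * (cmod (D 0 0))\<^sup>2 + (cmod (D 1 0))\<^sup>2"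
    using mode_energy[OF lam adm less_imp_le[OF T] d0 d1 eq] by blast
  hence E0: "E 0 \<le> 0" unfolding init by simp
  have "E t \<le> 0"
  proof (cases "t = 0")
    case False
    hence "0 < t" using t by simp
    moreover have "(E has_derivative (\<lambda>x. E' s * x)) (at s within {0..t})" if "0 \<le> s" "s \<le> t" for s
      using DERIV_subset[OF E[THEN conjunct1], of s "{0..t}"] that t by (auto simp: has_field_derivative_def)
    ultimately obtain x where "x \<in> {0<..<t}" "E t - E 0 = E' x * (t - 0)"
      using mvt_simple[of 0 t E "\<lambda>s x. E' s * x"] by blast
    thus ?thesis using E[of x] E0 t mult_nonpos_nonneg[of "E' x" t] by auto
  qed (use E0 in simp)
  with E[OF t] have "exp (- (T * q) - 2 * T) * ((cmod (D 0 t))\<^sup>2 + (cmod (D 1 t))\<^sup>2) \<le> 0" by linarith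
  hence "(cmod (D 0 t))\<^sup>2 + (cmod (D 1 t))\<^sup>2 \<le> 0" by (simp add: mult_le_0_iff)
  hence "(cmod (D 0 t))\<^sup>2 \<le> 0" using zero_le_power2[of "cmod (D 1 t)"] by linarith
  thus "W 0 t \<xi> = V 0 t \<xi>" by (simp add: D_def)
qed


section \<open>Stability estimate and passage to the limit\<close>

lemma wbound_wt_lam:
  assumes s: "0 < s" and mu: "\<And>\<xi>. 0 < mu \<xi>" and lam: "\<And>\<xi>. 0 \<le> lam \<xi>" "\<And>\<xi>. lam \<xi> \<le> mu \<xi>"
    and r: "\<bar>r\<bar> \<le> B" and v: "wbound (wt s mu \<eta>) v M"
  shows "wbound (wt s mu (\<eta> + 1)) (\<lambda>\<xi>. complex_of_real (r * lam \<xi>) * v \<xi>) (B * (2 * s) powr (2 * s) * M)"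
proof -
  have "cmod (complex_of_real (r * lam \<xi>)) \<le> 0 + B * mu \<xi>" for \<xi>
    using lam[of \<xi>] r mult_mono[of "\<bar>r\<bar>" B "lam \<xi>" "mu \<xi>"] by (simp add: norm_mult)
  from wbound_wt_mult[OF s _ mu this _ _ v, of 1] r show ?thesis by simp
qed

text \<open>The difference of the solutions for \<epsilon> and \<epsilon>' solves the equation with
  coefficient b \<epsilon>, zero data and source g \<epsilon> - g \<epsilon>' - (b \<epsilon> - b
  \<epsilon>') lam u \<epsilon>'. The a priori bound on u \<epsilon>' makes this source small; its
  factor lam is why differences are measured in a weaker space than the solutions.\<close>

lemma wave_convergence:
  fixes lam mu :: "'i \<Rightarrow> real" and u :: "real \<Rightarrow> nat \<Rightarrow> real \<Rightarrow> 'i \<Rightarrow> complex" and g :: "real \<Rightarrow> real \<Rightarrow> 'i \<Rightarrow> complex"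
  assumes T: "0 < T" and s: "0 < s" and mu: "\<And>\<xi>. 0 < mu \<xi>" and lam: "\<And>\<xi>. 0 \<le> lam \<xi>" "\<And>\<xi>. lam \<xi> \<le> mu \<xi>"
    and \<eta>0: "0 < \<eta>0" and C0: "0 \<le> C0" and K: "0 \<le> K"
    and adm: "\<And>\<epsilon> \<xi>. \<epsilon> \<in> {0<..1} \<Longrightarrow> admissible (b \<epsilon>) T (lam \<xi>) (C0 * (1 + mu \<xi> powr (1 / (2 * s)))) K"
    and bK: "\<And>\<epsilon> t. \<epsilon> \<in> {0<..1} \<Longrightarrow> \<bar>b \<epsilon> t\<bar> \<le> Kb" and aK: "\<And>t. t \<in> {0..T} \<Longrightarrow> \<bar>a t\<bar> \<le> Kb"
    and ac: "continuous_on {0..T} a"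
    and gM: "\<And>\<epsilon> t. \<epsilon> \<in> {0<..1} \<Longrightarrow> t \<in> {0..T} \<Longrightarrow> wbound (wt s mu \<eta>0) (g \<epsilon> t) Mf"
    and fuc: "\<And>e. 0 < e \<Longrightarrow> \<exists>d>0. \<forall>t\<in>{0..T}. \<forall>t'\<in>{0..T}. \<bar>t - t'\<bar> < d \<longrightarrow> wbound (wt s mu \<eta>0) (\<lambda>\<xi>. f t \<xi> - f t' \<xi>) e"
    and conv: "\<And>e. 0 < e \<Longrightarrow> \<exists>\<delta>>0. \<forall>\<epsilon>. 0 < \<epsilon> \<and> \<epsilon> < \<delta> \<longrightarrow> (\<forall>t\<in>{0..T}. \<bar>b \<epsilon> t - a t\<bar> \<le> e \<and> wbound (wt s mu \<eta>0) (\<lambda>\<xi>. g \<epsilon> t \<xi> - f t \<xi>) e)"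
    and M0: "wbound (wt s mu \<eta>0) u0 M0" and M1: "wbound (wt s mu \<eta>0) u1 M1"
    and d0: "\<And>\<epsilon> t \<xi>. \<epsilon> \<in> {0<..1} \<Longrightarrow> t \<in> {0..T} \<Longrightarrow> ((\<lambda>t. u \<epsilon> 0 t \<xi>) has_vector_derivative u \<epsilon> 1 t \<xi>) (at t within {0..T})"
    and d1: "\<And>\<epsilon> t \<xi>. \<epsilon> \<in> {0<..1} \<Longrightarrow> t \<in> {0..T} \<Longrightarrow> ((\<lambda>t. u \<epsilon> 1 t \<xi>) has_vector_derivative u \<epsilon> 2 t \<xi>) (at t within {0..T})"
    and eq: "\<And>\<epsilon> t \<xi>. \<epsilon> \<in> {0<..1} \<Longrightarrow> t \<in> {0..T} \<Longrightarrow> u \<epsilon> 2 t \<xi> = g \<epsilon> t \<xi> - complex_of_real (b \<epsilon> t * lam \<xi>) * u \<epsilon> 0 t \<xi>"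
    and init: "\<And>\<epsilon>. \<epsilon> \<in> {0<..1} \<Longrightarrow> u \<epsilon> 0 0 = u0" "\<And>\<epsilon>. \<epsilon> \<in> {0<..1} \<Longrightarrow> u \<epsilon> 1 0 = u1"
  shows "\<exists>V. (\<exists>\<eta>>0. ck_family (wt s mu \<eta>) T 2 V) \<and>
     (\<forall>t\<in>{0..T}. \<forall>\<xi>. V 2 t \<xi> + complex_of_real (a t * lam \<xi>) * V 0 t \<xi> = f t \<xi>) \<and>
     V 0 0 = u0 \<and> V 1 0 = u1 \<and> converges_C2 s mu T u V"
proof -
  let ?W = "wt s mu"
  define Q where "Q = (2 * s) powr (2 * s)"
  have Q: "0 \<le> Q" by (simp add: Q_def)
  have z: "0 \<in> {0..T}" using T by simp
  have Kb: "0 \<le> Kb" using aK[OF z] by linarith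
  note lamb = wbound_wt_lam[OF s mu lam, folded Q_def]
  from energy_wt[OF s mu lam less_imp_le[OF T] K C0] obtain C where C_energy: "0 \<le> C \<and> (\<forall>\<eta> b g D M M0 M1.
     (\<forall>\<xi>. admissible b T (lam \<xi>) (C0 * (1 + mu \<xi> powr (1 / (2 * s)))) K) \<longrightarrow>
     (\<forall>t\<in>{0..T}. \<forall>\<xi>. ((\<lambda>t. D 0 t \<xi>) has_vector_derivative D 1 t \<xi>) (at t within {0..T}) \<and>
        ((\<lambda>t. D 1 t \<xi>) has_vector_derivative D 2 t \<xi>) (at t within {0..T}) \<and>
        D 2 t \<xi> = g t \<xi> - complex_of_real (b t * lam \<xi>) * D 0 t \<xi>) \<longrightarrow>
     (\<forall>t\<in>{0..T}. wbound (?W \<eta>) (g t) M) \<longrightarrow>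
     wbound (?W \<eta>) (D 0 0) M0 \<longrightarrow> wbound (?W \<eta>) (D 1 0) M1 \<longrightarrow>
     (\<forall>t\<in>{0..T}. \<forall>i\<le>(1::nat). wbound (?W (\<eta> + 1 + C0 / 2)) ((D :: nat \<Rightarrow> real \<Rightarrow> 'i \<Rightarrow> complex) i t) (C * (M0 + M1 + M))))" ..
  note C = conjunct1[OF C_energy] and energy = conjunct2[OF C_energy, rule_format]
  \<comment> \<open>\<open>\<eta>1\<close> serves the solutions and their first derivatives,
    \<open>\<eta>1 + 1\<close> the second derivatives and the source of a difference. One more
    energy estimate leads to \<open>\<eta>2\<close> for differences, and a multiplication by lam to
    \<open>\<eta>3\<close> for their second derivatives. \<open>\<eta>4\<close> allows a last one,
    in the modulus of continuity of \<open>V 2\<close>.\<close>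
  define \<eta>1 where "\<eta>1 = \<eta>0 + 1 + C0 / 2"
  define \<eta>2 where "\<eta>2 = \<eta>1 + 1 + 1 + C0 / 2"
  define \<eta>3 where "\<eta>3 = \<eta>2 + 1"
  define \<eta>4 where "\<eta>4 = \<eta>3 + 1"
  have \<eta>: "\<eta>0 \<le> \<eta>1" "\<eta>1 + 1 \<le> \<eta>3" "\<eta>1 \<le> \<eta>3" "\<eta>2 \<le> \<eta>3" "\<eta>0 \<le> \<eta>1 + 1" "\<eta>0 \<le> \<eta>4" "\<eta>3 \<le> \<eta>4" "0 < \<eta>4" "0 < \<eta>3" "\<eta>1 + 1 \<le> \<eta>2 + 1"
    using C0 \<eta>0 by (auto simp: \<eta>1_def \<eta>2_def \<eta>3_def \<eta>4_def)
  define M' where "M' = C * (M0 + M1 + Mf)"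
  have half: "1/2 \<in> {0<..1::real}" by simp
  have Mf: "0 \<le> Mf" using wbound_nonneg[OF gM[OF half z]] .
  have M': "0 \<le> M'" using C Mf wbound_nonneg[OF M0] wbound_nonneg[OF M1] by (simp add: M'_def)
  have B1: "wbound (?W \<eta>1) (u \<epsilon> i t) M'" if "\<epsilon> \<in> {0<..1}" "t \<in> {0..T}" "i \<le> 1" for \<epsilon> t i
    unfolding M'_def \<eta>1_def
  proof (rule energy[where D = "u \<epsilon>" and b = "b \<epsilon>" and g = "g \<epsilon>"])
    show "wbound (?W \<eta>0) (u \<epsilon> 0 0) M0" "wbound (?W \<eta>0) (u \<epsilon> 1 0) M1"
      unfolding init[OF that(1)] by (rule M0 M1)+
  qed (intro conjI adm gM d0 d1 eq that; assumption)+
  have B2: "wbound (?W (\<eta>1 + 1)) (u \<epsilon> 2 t) (Mf + Kb * Q * M')" if "\<epsilon> \<in> {0<..1}" "t \<in> {0..T}" for \<epsilon> t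
  proof -
    have "u \<epsilon> 2 t = (\<lambda>\<xi>. g \<epsilon> t \<xi> - complex_of_real (b \<epsilon> t * lam \<xi>) * u \<epsilon> 0 t \<xi>)"
      by (rule ext) (rule eq[OF that])
    thus ?thesis
      by (simp only:) (intro wbound_diff[OF wt_nonneg] wbound_wt_mono[OF gM[OF that] \<eta>(5)] lamb bK B1 that; simp)
  qed
  define M2 where "M2 = M' + Mf + Kb * Q * M'"
  have nnq: "0 \<le> Kb * Q * M'" using Kb Q M' by simp
  have M2: "0 \<le> M2" "M' \<le> M2" "Mf + Kb * Q * M' \<le> M2" using M' Mf nnq by (auto simp: M2_def)
  have UB: "wbound (?W \<eta>3) (u \<epsilon> p t) M2" if "\<epsilon> \<in> {0<..1}" "t \<in> {0..T}" "p \<le> 2" for \<epsilon> t p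
  proof (cases "p = 2")
    case True
    thus ?thesis using wbound_mono[OF wbound_wt_mono[OF B2[OF that(1,2)] \<eta>(2)] M2(3)] by simp
  next
    case False
    hence "p \<le> 1" using that by simp
    thus ?thesis using wbound_mono[OF wbound_wt_mono[OF B1[OF that(1,2)] \<eta>(3)] M2(2)] by simp
  qed
  \<comment> \<open>If coefficients and sources differ by at most \<beta>, the source of the
    difference is at most \<beta> * G0. In \<open>C3\<close> the first summand is the energy bound
    and the second recovers the second derivative from the equation.\<close>
  define G0 where "G0 = 1 + Q * M'"
  have G0: "0 \<le> G0" using Q M' by (simp add: G0_def)
  define C3 where "C3 = C * G0 + (G0 + Kb * Q * (C * G0))"
  have C3: "0 \<le> C3" using C G0 Kb Q by (simp add: C3_def)
  have diff: "wbound (?W \<eta>3) (\<lambda>\<xi>. u \<epsilon> p t \<xi> - u \<epsilon>' p t \<xi>) (C3 * \<beta>)"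
    if e: "\<epsilon> \<in> {0<..1}" "\<epsilon>' \<in> {0<..1}" and \<beta>: "0 \<le> \<beta>"
      and near: "\<And>t. t \<in> {0..T} \<Longrightarrow> \<bar>b \<epsilon> t - b \<epsilon>' t\<bar> \<le> \<beta> \<and> wbound (?W \<eta>0) (\<lambda>\<xi>. g \<epsilon> t \<xi> - g \<epsilon>' t \<xi>) \<beta>"
      and t: "t \<in> {0..T}" and p: "p \<le> 2" for \<epsilon> \<epsilon>' \<beta> t p
  proof -
    define G where "G t \<xi> = (g \<epsilon> t \<xi> - g \<epsilon>' t \<xi>) - complex_of_real ((b \<epsilon> t - b \<epsilon>' t) * lam \<xi>) * u \<epsilon>' 0 t \<xi>" for t \<xi>
    define D where "D p t \<xi> = u \<epsilon> p t \<xi> - u \<epsilon>' p t \<xi>" for p t \<xi>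
    have G: "wbound (?W (\<eta>1 + 1)) (G t) (\<beta> * G0)" if t: "t \<in> {0..T}" for t
    proof -
      have "wbound (?W (\<eta>1 + 1)) (G t) (\<beta> + \<beta> * Q * M')"
        unfolding G_def
        by (intro wbound_diff[OF wt_nonneg] wbound_wt_mono[OF conjunct2[OF near[OF t]] \<eta>(5)] lamb conjunct1[OF near[OF t]] B1 e t) simp
      thus ?thesis by (simp add: G0_def algebra_simps)
    qed
    have Deq: "D 2 t \<xi> = G t \<xi> - complex_of_real (b \<epsilon> t * lam \<xi>) * D 0 t \<xi>" if "t \<in> {0..T}" for t \<xi>
      unfolding D_def G_def by (simp add: eq[OF e(1) that] eq[OF e(2) that] algebra_simps)
    have D1: "\<forall>t\<in>{0..T}. \<forall>i\<le>1. wbound (?W \<eta>2) (D i t) (C * (0 + 0 + \<beta> * G0))"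
      unfolding \<eta>2_def
    proof (intro ballI allI impI, rule energy[where D = D and b = "b \<epsilon>" and g = G])
      fix t \<xi> assume t: "t \<in> {0..T}"
      show "((\<lambda>t. D 0 t \<xi>) has_vector_derivative D 1 t \<xi>) (at t within {0..T}) \<and>
        ((\<lambda>t. D 1 t \<xi>) has_vector_derivative D 2 t \<xi>) (at t within {0..T}) \<and>
        D 2 t \<xi> = G t \<xi> - complex_of_real (b \<epsilon> t * lam \<xi>) * D 0 t \<xi>"
        by (intro conjI Deq t) (unfold D_def, (intro has_vector_derivative_diff d0 d1 e t)+)
    next
      show "wbound (?W (\<eta>1 + 1)) (D 0 0) 0" "wbound (?W (\<eta>1 + 1)) (D 1 0) 0"
        unfolding D_def init[OF e(1)] init[OF e(2)] by (simp_all add: wbound_zero)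
    qed (intro adm e G; assumption)+
    have "wbound (?W \<eta>3) (D p t) (C3 * \<beta>)"
    proof (cases "p = 2")
      case True
      have "wbound (?W \<eta>3) (D 2 t) (\<beta> * G0 + Kb * Q * (C * (0 + 0 + \<beta> * G0)))"
      proof -
        have "D 2 t = (\<lambda>\<xi>. G t \<xi> - complex_of_real (b \<epsilon> t * lam \<xi>) * D 0 t \<xi>)"
          by (rule ext) (rule Deq[OF t])
        thus ?thesis
          unfolding \<eta>3_def
          by (simp only:) (intro wbound_diff[OF wt_nonneg] wbound_wt_mono[OF G[OF t] \<eta>(10)] lamb bK D1[rule_format] e t; simp)
      qed
      moreover have "\<beta> * G0 + Kb * Q * (C * (0 + 0 + \<beta> * G0)) \<le> C3 * \<beta>"
        using \<beta> C G0 by (simp add: C3_def algebra_simps)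
      ultimately show ?thesis using True wbound_mono by blast
    next
      case False
      hence "p \<le> 1" using p by simp
      moreover have "C * (0 + 0 + \<beta> * G0) \<le> C3 * \<beta>"
      proof -
        have "0 \<le> (G0 + Kb * Q * (C * G0)) * \<beta>" using \<beta> C G0 Kb Q by simp
        thus ?thesis by (simp add: C3_def algebra_simps)
      qed
      ultimately show ?thesis using wbound_mono[OF wbound_wt_mono[OF D1[rule_format, OF t] \<eta>(4)]] by blast
    qed
    thus ?thesis by (simp add: D_def[abs_def])
  qed
  have cauchy: "\<exists>\<delta>>0. \<forall>\<epsilon> \<epsilon>'. 0 < \<epsilon> \<and> \<epsilon> < \<delta> \<and> 0 < \<epsilon>' \<and> \<epsilon>' < \<delta> \<longrightarrow>
     (\<forall>t\<in>{0..T}. \<forall>p\<le>2. wbound (?W \<eta>3) (\<lambda>\<xi>. u \<epsilon> p t \<xi> - u \<epsilon>' p t \<xi>) e)" if e: "0 < e" for e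
  proof -
    define \<beta> where "\<beta> = e / (C3 + 1)"
    have \<beta>: "0 < \<beta>" "C3 * \<beta> \<le> e" using e C3 by (auto simp: \<beta>_def field_simps)
    obtain \<delta> where \<delta>: "0 < \<delta>" "\<And>\<epsilon> t. 0 < \<epsilon> \<Longrightarrow> \<epsilon> < \<delta> \<Longrightarrow> t \<in> {0..T} \<Longrightarrow> \<bar>b \<epsilon> t - a t\<bar> \<le> \<beta> / 2 \<and> wbound (?W \<eta>0) (\<lambda>\<xi>. g \<epsilon> t \<xi> - f t \<xi>) (\<beta> / 2)"
      using conv[of "\<beta> / 2"] \<beta> by auto
    have "wbound (?W \<eta>3) (\<lambda>\<xi>. u \<epsilon> p t \<xi> - u \<epsilon>' p t \<xi>) e"
      if "0 < \<epsilon>" "\<epsilon> < min \<delta> 1" "0 < \<epsilon>'" "\<epsilon>' < min \<delta> 1" "t \<in> {0..T}" "p \<le> 2" for \<epsilon> \<epsilon>' t p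
    proof (rule wbound_mono[OF diff \<beta>(2)])
      fix t assume t: "t \<in> {0..T}"
      have 1: "\<bar>b \<epsilon> t - a t\<bar> \<le> \<beta> / 2" "wbound (?W \<eta>0) (\<lambda>\<xi>. g \<epsilon> t \<xi> - f t \<xi>) (\<beta> / 2)"
        and 2: "\<bar>b \<epsilon>' t - a t\<bar> \<le> \<beta> / 2" "wbound (?W \<eta>0) (\<lambda>\<xi>. g \<epsilon>' t \<xi> - f t \<xi>) (\<beta> / 2)"
        using \<delta>(2)[of \<epsilon> t] \<delta>(2)[of \<epsilon>' t] that t by auto
      have "wbound (?W \<eta>0) (\<lambda>\<xi>. g \<epsilon> t \<xi> - g \<epsilon>' t \<xi>) (\<beta> / 2 + \<beta> / 2)"
        by (rule wbound_triangle[OF wt_nonneg 1(2) wbound_diff_commute[OF 2(2)]])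
      moreover have "\<bar>b \<epsilon> t - b \<epsilon>' t\<bar> \<le> \<beta>" using 1(1) 2(1) by linarith
      ultimately show "\<bar>b \<epsilon> t - b \<epsilon>' t\<bar> \<le> \<beta> \<and> wbound (?W \<eta>0) (\<lambda>\<xi>. g \<epsilon> t \<xi> - g \<epsilon>' t \<xi>) \<beta>" by simp
    qed (use that \<beta> in auto)
    thus ?thesis using \<delta>(1) by (intro exI[of _ "min \<delta> 1"]) auto
  qed
  \<comment> \<open>The limit is built along this null sequence and afterwards recognised as the
    limit of the whole net.\<close>
  define \<kappa> where "\<kappa> n = 1 / real (Suc n)" for n
  have \<kappa>: "\<kappa> n \<in> {0<..1}" for n by (simp add: \<kappa>_def)
  have \<kappa>_lim: "\<kappa> \<longlonglongrightarrow> 0"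
    unfolding \<kappa>_def using LIMSEQ_inverse_real_of_nat by (simp only: inverse_eq_divide)
  have \<kappa>_ev: "\<forall>\<^sub>F n in sequentially. 0 < \<kappa> n \<and> \<kappa> n < \<delta>" if "0 < \<delta>" for \<delta>
    using order_tendstoD(2)[OF \<kappa>_lim that] \<kappa> by (auto elim: eventually_mono)
  \<comment> \<open>Outside [0, T], or for p > 2, the value of \<open>lim\<close> is unspecified and
    nothing is claimed about it.\<close>
  define V where "V p t \<xi> = lim (\<lambda>n. u (\<kappa> n) p t \<xi>)" for p t \<xi>
  have Xlim: "(\<lambda>n. u (\<kappa> n) p t \<xi>) \<longlonglongrightarrow> V p t \<xi>" if t: "t \<in> {0..T}" and p: "p \<le> 2" for p t \<xi>
  proof -
    have "Cauchy (\<lambda>n. u (\<kappa> n) p t \<xi>)"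
      unfolding Cauchy_def
    proof (intro allI impI)
      fix e :: real assume e: "0 < e"
      define e' where "e' = e / 2 * sqrt (?W \<eta>3 \<xi>)"
      have e': "0 < e'" using e wt_pos[of s mu \<eta>3 \<xi>] by (simp add: e'_def)
      obtain \<delta> where \<delta>: "0 < \<delta>" "\<And>\<epsilon> \<epsilon>'. 0 < \<epsilon> \<Longrightarrow> \<epsilon> < \<delta> \<Longrightarrow> 0 < \<epsilon>' \<Longrightarrow> \<epsilon>' < \<delta> \<Longrightarrow> wbound (?W \<eta>3) (\<lambda>\<xi>. u \<epsilon> p t \<xi> - u \<epsilon>' p t \<xi>) e'"
        using cauchy[OF e'] t p by blast
      obtain N where N: "\<And>n. N \<le> n \<Longrightarrow> 0 < \<kappa> n \<and> \<kappa> n < \<delta>"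
        using \<kappa>_ev[OF \<delta>(1)] unfolding eventually_sequentially by blast
      have "dist (u (\<kappa> m) p t \<xi>) (u (\<kappa> n) p t \<xi>) < e" if "N \<le> m" "N \<le> n" for m n
        using component_le[OF wt_pos \<delta>(2)[of "\<kappa> m" "\<kappa> n"], of \<xi>] N[OF that(1)] N[OF that(2)] e wt_pos[of s mu \<eta>3 \<xi>]
        by (simp add: e'_def dist_norm)
      thus "\<exists>M. \<forall>m\<ge>M. \<forall>n\<ge>M. dist (u (\<kappa> m) p t \<xi>) (u (\<kappa> n) p t \<xi>) < e" by blast
    qed
    thus ?thesis unfolding V_def using Cauchy_convergent convergent_LIMSEQ_iff by blast
  qed
  \<comment> \<open>With \<epsilon> fixed, \<epsilon>' runs along \<kappa> in the Cauchy estimate;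
    the threshold \<delta> for \<epsilon> is unaffected, so the full net converges.\<close>
  have near: "\<exists>\<delta>>0. \<forall>\<epsilon>. 0 < \<epsilon> \<and> \<epsilon> < \<delta> \<longrightarrow> (\<forall>t\<in>{0..T}. \<forall>p\<le>2. wbound (?W \<eta>3) (\<lambda>\<xi>. u \<epsilon> p t \<xi> - V p t \<xi>) e)"
    if e: "0 < e" for e
  proof -
    obtain \<delta> where \<delta>: "0 < \<delta>" "\<And>\<epsilon> \<epsilon>' t p. 0 < \<epsilon> \<Longrightarrow> \<epsilon> < \<delta> \<Longrightarrow> 0 < \<epsilon>' \<Longrightarrow> \<epsilon>' < \<delta> \<Longrightarrow> t \<in> {0..T} \<Longrightarrow> p \<le> 2 \<Longrightarrow> wbound (?W \<eta>3) (\<lambda>\<xi>. u \<epsilon> p t \<xi> - u \<epsilon>' p t \<xi>) e"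
      using cauchy[OF e] by blast
    have "wbound (?W \<eta>3) (\<lambda>\<xi>. u \<epsilon> p t \<xi> - V p t \<xi>) e" if "0 < \<epsilon>" "\<epsilon> < \<delta>" "t \<in> {0..T}" "p \<le> 2" for \<epsilon> t p
    proof (rule wbound_tendsto[where F = sequentially])
      show "(\<lambda>n. u \<epsilon> p t \<xi> - u (\<kappa> n) p t \<xi>) \<longlonglongrightarrow> u \<epsilon> p t \<xi> - V p t \<xi>" for \<xi>
        by (intro tendsto_intros Xlim that)
      show "\<forall>\<^sub>F n in sequentially. wbound (?W \<eta>3) (\<lambda>\<xi>. u \<epsilon> p t \<xi> - u (\<kappa> n) p t \<xi>) e"
        using \<kappa>_ev[OF \<delta>(1)] by eventually_elim (use \<delta>(2) that in blast)
    qed simp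
    thus ?thesis using \<delta>(1) by blast
  qed
  have conv_C2: "converges_C2 s mu T u V"
    unfolding converges_C2_def
  proof (rule exI[of _ \<eta>3], intro conjI allI impI)
    show "0 < \<eta>3" by (rule \<eta>)
    fix e :: real assume e: "0 < e"
    obtain \<delta> where \<delta>: "0 < \<delta>" "\<And>\<epsilon> t p. 0 < \<epsilon> \<Longrightarrow> \<epsilon> < \<delta> \<Longrightarrow> t \<in> {0..T} \<Longrightarrow> p \<le> 2 \<Longrightarrow> wbound (?W \<eta>3) (\<lambda>\<xi>. u \<epsilon> p t \<xi> - V p t \<xi>) (e / 2)"
      using near[of "e / 2"] e by auto
    have "Hw (?W \<eta>3) (\<lambda>\<xi>. u \<epsilon> p t \<xi> - V p t \<xi>)" "nw (?W \<eta>3) (\<lambda>\<xi>. u \<epsilon> p t \<xi> - V p t \<xi>) < e"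
      if "0 < \<epsilon>" "\<epsilon> < \<delta>" "t \<in> {0..T}" "p \<le> 2" for \<epsilon> t p
      using Hw_of_wbound[OF wt_nonneg \<delta>(2)[OF that]] nw_le_of_wbound[OF wt_nonneg \<delta>(2)[OF that]] e by auto
    thus "\<exists>\<delta>>0. \<forall>\<epsilon>. 0 < \<epsilon> \<and> \<epsilon> < \<delta> \<longrightarrow> (\<forall>t\<in>{0..T}. \<forall>k\<le>2. Hw (?W \<eta>3) (\<lambda>\<xi>. u \<epsilon> k t \<xi> - V k t \<xi>) \<and>
           nw (?W \<eta>3) (\<lambda>\<xi>. u \<epsilon> k t \<xi> - V k t \<xi>) < e)"
      using \<delta>(1) by blast
  qed
  have VB: "wbound (?W \<eta>3) (V p t) M2" if "t \<in> {0..T}" "p \<le> 2" for t p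
    by (rule wbound_tendsto[OF Xlim[OF that]]) (use UB \<kappa> that in auto)
  have der: "((\<lambda>t. u (\<kappa> n) p t \<xi>) has_vector_derivative u (\<kappa> n) (Suc p) t \<xi>) (at t within {0..T})"
    if "p < 2" "t \<in> {0..T}" for n p t \<xi>
  proof -
    have "p = 0 \<or> p = 1" using that by auto
    thus ?thesis using d0[OF \<kappa> that(2), of n \<xi>] d1[OF \<kappa> that(2), of n \<xi>] by (auto simp: numeral_2_eq_2)
  qed
  \<comment> \<open>The uniform bound on the next derivative makes the approximants equi-Lipschitz
    in norm, and the limit inherits the constant.\<close>
  have lip1: "wbound (?W \<eta>3) (\<lambda>\<xi>. V p t' \<xi> - V p t \<xi>) (M2 * (t' - t))"
    if "t \<in> {0..T}" "t' \<in> {0..T}" "t \<le> t'" "p < 2" for t t' p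
  proof (rule wbound_tendsto[where F = sequentially])
    show "(\<lambda>n. u (\<kappa> n) p t' \<xi> - u (\<kappa> n) p t \<xi>) \<longlonglongrightarrow> V p t' \<xi> - V p t \<xi>" for \<xi>
      by (intro tendsto_intros Xlim) (use that in auto)
    have sub: "{t..t'} \<subseteq> {0..T}" using that by auto
    have "wbound (?W \<eta>3) (\<lambda>\<xi>. u (\<kappa> n) p t' \<xi> - u (\<kappa> n) p t \<xi>) (M2 * (t' - t))" for n
    proof (rule wbound_mvt[OF wt_nonneg that(3)])
      fix x assume x: "x \<in> {t..t'}"
      hence x': "x \<in> {0..T}" using sub by blast
      show "((\<lambda>t. u (\<kappa> n) p t \<xi>) has_vector_derivative u (\<kappa> n) (Suc p) x \<xi>) (at x within {t..t'})" for \<xi>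
        by (rule has_vector_derivative_within_subset[OF der[OF that(4) x'] sub])
      show "wbound (?W \<eta>3) (u (\<kappa> n) (Suc p) x) M2" using that(4) by (intro UB \<kappa> x') simp
    qed
    thus "\<forall>\<^sub>F n in sequentially. wbound (?W \<eta>3) (\<lambda>\<xi>. u (\<kappa> n) p t' \<xi> - u (\<kappa> n) p t \<xi>) (M2 * (t' - t))" by simp
  qed simp
  have lip: "wbound (?W \<eta>3) (\<lambda>\<xi>. V p t \<xi> - V p t' \<xi>) (M2 * \<bar>t - t'\<bar>)"
    if "t \<in> {0..T}" "t' \<in> {0..T}" "p < 2" for t t' p
    using lip1[OF that(1,2) _ that(3)] lip1[OF that(2,1) _ that(3)] by (cases "t \<le> t'") (auto intro: wbound_diff_commute)
  have Veq: "V 2 t \<xi> = f t \<xi> - complex_of_real (a t * lam \<xi>) * V 0 t \<xi>" if t: "t \<in> {0..T}" for t \<xi>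
  proof (rule LIMSEQ_unique[OF Xlim[OF t order_refl]])
    have b: "(\<lambda>n. b (\<kappa> n) t) \<longlonglongrightarrow> a t"
    proof (rule tendstoI)
      fix e :: real assume e: "0 < e"
      then obtain \<delta> where \<delta>: "0 < \<delta>" "\<And>\<epsilon>. 0 < \<epsilon> \<Longrightarrow> \<epsilon> < \<delta> \<Longrightarrow> \<bar>b \<epsilon> t - a t\<bar> \<le> e / 2" using conv[of "e / 2"] t by auto
      show "\<forall>\<^sub>F n in sequentially. dist (b (\<kappa> n) t) (a t) < e"
        using \<kappa>_ev[OF \<delta>(1)] by eventually_elim (use \<delta>(2) e in \<open>force simp: dist_real_def\<close>)
    qed
    have g: "(\<lambda>n. g (\<kappa> n) t \<xi>) \<longlonglongrightarrow> f t \<xi>"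
    proof (rule tendstoI)
      fix e :: real assume e: "0 < e"
      define e' where "e' = e / 2 * sqrt (?W \<eta>0 \<xi>)"
      have e': "0 < e'" using e wt_pos[of s mu \<eta>0 \<xi>] by (simp add: e'_def)
      obtain \<delta> where \<delta>: "0 < \<delta>" "\<And>\<epsilon>. 0 < \<epsilon> \<Longrightarrow> \<epsilon> < \<delta> \<Longrightarrow> wbound (?W \<eta>0) (\<lambda>\<xi>. g \<epsilon> t \<xi> - f t \<xi>) e'"
        using conv[OF e'] t by blast
      show "\<forall>\<^sub>F n in sequentially. dist (g (\<kappa> n) t \<xi>) (f t \<xi>) < e"
        using \<kappa>_ev[OF \<delta>(1)]
      proof eventually_elim
        case (elim n)
        thus ?case using component_le[OF wt_pos \<delta>(2)[of "\<kappa> n"], of \<xi>] e wt_pos[of s mu \<eta>0 \<xi>] by (simp add: e'_def dist_norm)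
      qed
    qed
    have "(\<lambda>n. g (\<kappa> n) t \<xi> - complex_of_real (b (\<kappa> n) t * lam \<xi>) * u (\<kappa> n) 0 t \<xi>)
        \<longlonglongrightarrow> f t \<xi> - complex_of_real (a t * lam \<xi>) * V 0 t \<xi>"
      by (intro tendsto_intros b g Xlim t) simp
    thus "(\<lambda>n. u (\<kappa> n) 2 t \<xi>) \<longlonglongrightarrow> f t \<xi> - complex_of_real (a t * lam \<xi>) * V 0 t \<xi>"
      by (simp add: eq[OF \<kappa> t])
  qed
  have Vuc: "\<exists>d>0. \<forall>t\<in>{0..T}. \<forall>t'\<in>{0..T}. \<bar>t - t'\<bar> < d \<longrightarrow> wbound (?W \<eta>4) (\<lambda>\<xi>. V p t \<xi> - V p t' \<xi>) e"
    if p: "p \<le> 2" and e: "0 < e" for p e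
  proof (cases "p = 2")
    case False
    hence p: "p < 2" using p by simp
    define d where "d = e / (M2 + 1)"
    have d: "0 < d" using e M2 by (simp add: d_def)
    have "wbound (?W \<eta>4) (\<lambda>\<xi>. V p t \<xi> - V p t' \<xi>) e" if "t \<in> {0..T}" "t' \<in> {0..T}" "\<bar>t - t'\<bar> < d" for t t'
    proof (rule wbound_wt_mono[OF wbound_mono[OF lip[OF that(1,2) p]] \<eta>(7)])
      have "M2 * \<bar>t - t'\<bar> \<le> M2 * d" using that M2 by (intro mult_left_mono) auto
      also have "\<dots> \<le> e" using e M2 by (simp add: d_def field_simps)
      finally show "M2 * \<bar>t - t'\<bar> \<le> e" .
    qed
    thus ?thesis using d by blast
  next
    case True
    \<comment> \<open>No third derivative is bounded uniformly, so the modulus of \<open>V 2\<close>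
      is read off the equation, split into the increments of f, of a and of \<open>V 0\<close>.
      \<open>P\<close> is the bound for lam * V 0 in the weaker norm.\<close>
    define P where "P = Q * M2"
    have P: "0 \<le> P" using Q M2 by (simp add: P_def)
    obtain d1 where d1: "0 < d1" "\<And>t t'. t \<in> {0..T} \<Longrightarrow> t' \<in> {0..T} \<Longrightarrow> \<bar>t - t'\<bar> < d1 \<Longrightarrow> wbound (?W \<eta>0) (\<lambda>\<xi>. f t \<xi> - f t' \<xi>) (e / 3)"
      using fuc[of "e / 3"] e by auto
    have "uniformly_continuous_on {0..T} a" by (intro compact_uniformly_continuous ac) simp
    moreover define e2 where "e2 = e / (3 * (P + 1))"
    have e2: "0 < e2" "e2 * P \<le> e / 3" using e P by (auto simp: e2_def field_simps)
    ultimately obtain d2 where d2: "0 < d2" "\<And>t t'. t \<in> {0..T} \<Longrightarrow> t' \<in> {0..T} \<Longrightarrow> dist t t' < d2 \<Longrightarrow> dist (a t) (a t') < e2"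
      unfolding uniformly_continuous_on_def by metis
    define d3 where "d3 = e / (3 * (Kb * P + 1))"
    have R: "0 \<le> Kb * P" using Kb P by simp
    have "x * (e / (3 * (x + 1))) \<le> e / 3" if "0 \<le> x" for x
      using e that by (simp add: field_simps)
    from this[OF R] have d3: "0 < d3" "Kb * P * d3 \<le> e / 3" using e R by (auto simp: d3_def)
    have "wbound (?W \<eta>4) (\<lambda>\<xi>. V 2 t \<xi> - V 2 t' \<xi>) e"
      if t: "t \<in> {0..T}" "t' \<in> {0..T}" "\<bar>t - t'\<bar> < min d1 (min d2 d3)" for t t'
    proof -
      have a1: "wbound (?W \<eta>4) (\<lambda>\<xi>. f t \<xi> - f t' \<xi>) (e / 3)"
        using wbound_wt_mono[OF d1(2)[OF t(1,2)] \<eta>(6)] t by simp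
      have "\<bar>a t - a t'\<bar> \<le> e2" using d2(2)[OF t(1,2)] t by (simp add: dist_real_def)
      from lamb[OF this VB[OF t(2), of 0]]
      have a2: "wbound (?W \<eta>4) (\<lambda>\<xi>. complex_of_real ((a t - a t') * lam \<xi>) * V 0 t' \<xi>) (e2 * P)"
        by (simp add: \<eta>4_def P_def mult.assoc)
      from lamb[OF aK[OF t(1)] lip[OF t(1,2), of 0]]
      have a3: "wbound (?W \<eta>4) (\<lambda>\<xi>. complex_of_real (a t * lam \<xi>) * (V 0 t \<xi> - V 0 t' \<xi>)) (Kb * P * \<bar>t - t'\<bar>)"
        by (simp add: \<eta>4_def P_def mult.assoc)
      have "wbound (?W \<eta>4) (\<lambda>\<xi>. ((f t \<xi> - f t' \<xi>) - complex_of_real ((a t - a t') * lam \<xi>) * V 0 t' \<xi>) - complex_of_real (a t * lam \<xi>) * (V 0 t \<xi> - V 0 t' \<xi>))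
          (e / 3 + e2 * P + Kb * P * \<bar>t - t'\<bar>)"
        by (intro wbound_diff[OF wt_nonneg] a1 a2 a3)
      moreover have "(\<lambda>\<xi>. ((f t \<xi> - f t' \<xi>) - complex_of_real ((a t - a t') * lam \<xi>) * V 0 t' \<xi>) - complex_of_real (a t * lam \<xi>) * (V 0 t \<xi> - V 0 t' \<xi>))
          = (\<lambda>\<xi>. V 2 t \<xi> - V 2 t' \<xi>)"
        by (rule ext) (simp add: Veq[OF t(1)] Veq[OF t(2)] algebra_simps)
      ultimately have "wbound (?W \<eta>4) (\<lambda>\<xi>. V 2 t \<xi> - V 2 t' \<xi>) (e / 3 + e2 * P + Kb * P * \<bar>t - t'\<bar>)"
        by (simp only:)
      moreover have "e / 3 + e2 * P + Kb * P * \<bar>t - t'\<bar> \<le> e"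
      proof -
        have "Kb * P * \<bar>t - t'\<bar> \<le> Kb * P * d3" using t Kb P by (intro mult_left_mono) auto
        thus ?thesis using e2 d3 by linarith
      qed
      ultimately show ?thesis by (rule wbound_mono)
    qed
    thus ?thesis using True d1(1) d2(1) d3(1) by (intro exI[of _ "min d1 (min d2 d3)"]) auto
  qed
  have "ck_family (?W \<eta>4) T 2 V"
  proof (rule ck_familyI[OF wt_nonneg])
    show "wbound (?W \<eta>4) (V p t) M2" if "p \<le> 2" "t \<in> {0..T}" for p t
      by (rule wbound_wt_mono[OF VB[OF that(2,1)] \<eta>(7)])
    show "\<exists>d>0. \<forall>t\<in>{0..T}. \<forall>t'\<in>{0..T}. \<bar>t - t'\<bar> < d \<longrightarrow> wbound (?W \<eta>4) (\<lambda>\<xi>. V p t \<xi> - V p t' \<xi>) e"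
      if "p \<le> 2" "0 < e" for p e by (rule Vuc[OF that])
    show "\<exists>d>0. \<forall>t\<in>{0..T}. \<forall>h. h \<noteq> 0 \<longrightarrow> \<bar>h\<bar> < d \<longrightarrow> t + h \<in> {0..T} \<longrightarrow>
        wbound (?W \<eta>4) (\<lambda>\<xi>. (V p (t + h) \<xi> - V p t \<xi>) / complex_of_real h - V (Suc p) t \<xi>) e"
      if p: "p < 2" and e: "0 < e" for p e
    proof (rule uniform_limit_derivative[OF wt_pos der[OF p] _ _ _ _ e])
      show "(\<lambda>n. u (\<kappa> n) p t \<xi>) \<longlonglongrightarrow> V p t \<xi>" "(\<lambda>n. u (\<kappa> n) (Suc p) t \<xi>) \<longlonglongrightarrow> V (Suc p) t \<xi>"
        if "t \<in> {0..T}" for t \<xi> using p by (intro Xlim that; simp)+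
      show "\<exists>d>0. \<forall>t\<in>{0..T}. \<forall>t'\<in>{0..T}. \<bar>t - t'\<bar> < d \<longrightarrow> wbound (?W \<eta>4) (\<lambda>\<xi>. V (Suc p) t \<xi> - V (Suc p) t' \<xi>) e"
        if "0 < e" for e using p by (intro Vuc that) simp
      show "\<forall>\<^sub>F n in sequentially. \<forall>t\<in>{0..T}. wbound (?W \<eta>4) (\<lambda>\<xi>. u (\<kappa> n) (Suc p) t \<xi> - V (Suc p) t \<xi>) e"
        if e: "0 < e" for e
      proof -
        obtain \<delta> where \<delta>: "0 < \<delta>" "\<And>\<epsilon> t p. 0 < \<epsilon> \<Longrightarrow> \<epsilon> < \<delta> \<Longrightarrow> t \<in> {0..T} \<Longrightarrow> p \<le> 2 \<Longrightarrow> wbound (?W \<eta>3) (\<lambda>\<xi>. u \<epsilon> p t \<xi> - V p t \<xi>) e"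
          using near[OF e] by blast
        show ?thesis using \<kappa>_ev[OF \<delta>(1)]
        proof eventually_elim
          case (elim n)
          show ?case using p elim by (intro ballI wbound_wt_mono[OF \<delta>(2) \<eta>(7)]) auto
        qed
      qed
    qed
  qed
  moreover have "V 0 0 = u0" "V 1 0 = u1"
  proof -
    have "V 0 0 \<xi> = u0 \<xi>" "V 1 0 \<xi> = u1 \<xi>" for \<xi>
      using LIMSEQ_unique[OF Xlim[OF z, of 0 \<xi>], of "u0 \<xi>"] LIMSEQ_unique[OF Xlim[OF z, of 1 \<xi>], of "u1 \<xi>"]
      by (simp_all add: init[OF \<kappa>, unfolded One_nat_def] init[OF \<kappa>])
    thus "V 0 0 = u0" "V 1 0 = u1" by auto
  qed
  ultimately show ?thesis using \<eta>(8) Veq conv_C2 by (intro exI[of _ V]) auto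
qed

section \<open>Convergence of the very weak solution\<close>


lemma clamp_near:
  assumes "0 \<le> T" "t \<in> {0..T}" "\<tau> \<in> {-S..S}"
  shows "\<bar>clamp T (t - \<tau>) - t\<bar> \<le> S"
proof -
  have "\<bar>\<tau>\<bar> \<le> S" using assms(3) by (auto simp: abs_le_iff)
  thus ?thesis using clamp_diff[OF assms(1), of "t - \<tau>" t] by (simp add: clamp_id[OF assms(2)])
qed

lemma reg_f_component_continuous:
  fixes f :: "real \<Rightarrow> 'i \<Rightarrow> complex"
  assumes "0 \<le> T" "continuous_on {0..T} (\<lambda>t. f t \<xi>)"
  shows "continuous_on {l..r} (\<lambda>\<tau>. f (clamp T (t - \<tau>)) \<xi>)"
proof (rule continuous_on_compose2[OF assms(2)])
  show "continuous_on {l..r} (\<lambda>\<tau>. clamp T (t - \<tau>))"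
    unfolding clamp_def by (intro continuous_intros)
qed (use clamp_in[OF assms(1)] in blast)

lemma reg_f_wbound:
  fixes f :: "real \<Rightarrow> 'i \<Rightarrow> complex"
  assumes w: "\<And>\<xi>. 0 \<le> w \<xi>" and T: "0 \<le> T"
    and k: "avg_kernel (R * \<omega> \<epsilon>) (\<lambda>\<tau>. \<psi> (\<tau> / \<omega> \<epsilon>) / \<omega> \<epsilon>)"
    and fc: "\<And>\<xi>. continuous_on {0..T} (\<lambda>t. f t \<xi>)"
    and b: "\<And>t. t \<in> {0..T} \<Longrightarrow> wbound w (f t) M"
  shows "wbound w (reg_f \<psi> \<omega> T f \<epsilon> t) M"
proof -
  have "0 \<le> M" using wbound_nonneg[OF b, of 0] T by simp
  hence "wbound w (\<lambda>\<xi>. integral {- (R * \<omega> \<epsilon>)..R * \<omega> \<epsilon>} (\<lambda>\<tau>. f (clamp T (t - \<tau>)) \<xi> * complex_of_real (\<psi> (\<tau> / \<omega> \<epsilon>) / \<omega> \<epsilon>))) M"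
    using k T clamp_in[OF T]
    by (intro wbound_average[OF w reg_f_component_continuous[OF T fc]] b) (auto simp: avg_kernel_def elim: continuous_on_subset)
  thus ?thesis by (simp only: reg_f_eq[where R = R and \<omega> = \<omega> and \<epsilon> = \<epsilon> and \<psi> = \<psi>, OF k, abs_def])
qed

text \<open>Since the kernel has mass one, the error is an average of f at a clamped shifted time
  minus f t, and clamping moves this time no further than R * \<omega> \<epsilon> from t.\<close>

lemma reg_f_near:
  fixes f :: "real \<Rightarrow> 'i \<Rightarrow> complex"
  assumes w: "\<And>\<xi>. 0 \<le> w \<xi>" and T: "0 \<le> T"
    and k: "avg_kernel (R * \<omega> \<epsilon>) (\<lambda>\<tau>. \<psi> (\<tau> / \<omega> \<epsilon>) / \<omega> \<epsilon>)"
    and fc: "\<And>\<xi>. continuous_on {0..T} (\<lambda>t. f t \<xi>)"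
    and b: "\<And>t t'. t \<in> {0..T} \<Longrightarrow> t' \<in> {0..T} \<Longrightarrow> \<bar>t - t'\<bar> < d \<Longrightarrow> wbound w (\<lambda>\<xi>. f t \<xi> - f t' \<xi>) e"
    and d: "R * \<omega> \<epsilon> < d" and e: "0 \<le> e" and t: "t \<in> {0..T}"
  shows "wbound w (\<lambda>\<xi>. reg_f \<psi> \<omega> T f \<epsilon> t \<xi> - f t \<xi>) e"
proof -
  let ?S = "R * \<omega> \<epsilon>" and ?k = "\<lambda>\<tau>. \<psi> (\<tau> / \<omega> \<epsilon>) / \<omega> \<epsilon>"
  have kc: "continuous_on {-?S..?S} ?k" and ki: "(?k has_integral 1) {-?S..?S}" and k0: "\<And>\<tau>. 0 \<le> ?k \<tau>"
    using k by (auto simp: avg_kernel_def elim: continuous_on_subset)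
  have avg: "wbound w (\<lambda>\<xi>. integral {-?S..?S} (\<lambda>\<tau>. (f (clamp T (t - \<tau>)) \<xi> - f t \<xi>) * complex_of_real (?k \<tau>))) e"
  proof (rule wbound_average[OF w _ kc k0 ki _ e])
    show "continuous_on {-?S..?S} (\<lambda>\<tau>. f (clamp T (t - \<tau>)) \<xi> - f t \<xi>)" for \<xi>
      by (intro continuous_intros reg_f_component_continuous[OF T fc])
    show "wbound w (\<lambda>\<xi>. f (clamp T (t - \<tau>)) \<xi> - f t \<xi>) e" if "\<tau> \<in> {-?S..?S}" for \<tau>
      using clamp_near[OF T t that] d by (intro b clamp_in T t) auto
  qed
  have "integral {-?S..?S} (\<lambda>\<tau>. (f (clamp T (t - \<tau>)) \<xi> - f t \<xi>) * complex_of_real (?k \<tau>)) = reg_f \<psi> \<omega> T f \<epsilon> t \<xi> - f t \<xi>" for \<xi>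
  proof (rule integral_unique)
    have "((\<lambda>\<tau>. f (clamp T (t - \<tau>)) \<xi> * complex_of_real (?k \<tau>)) has_integral reg_f \<psi> \<omega> T f \<epsilon> t \<xi>) {-?S..?S}"
      unfolding reg_f_eq[where R = R and \<omega> = \<omega> and \<epsilon> = \<epsilon> and \<psi> = \<psi>, OF k]
      by (intro integrable_integral integrable_continuous_real continuous_on_mult reg_f_component_continuous[OF T fc] continuous_on_of_real kc)
    moreover have "((\<lambda>\<tau>. complex_of_real (?k \<tau>)) has_integral complex_of_real 1) {-?S..?S}"
      using has_integral_linear[OF ki bounded_linear_of_real] by (simp only: o_def)
    from has_integral_mult_right[OF this, of "f t \<xi>"]
    have "((\<lambda>\<tau>. f t \<xi> * complex_of_real (?k \<tau>)) has_integral f t \<xi>) {-?S..?S}" by simp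
    ultimately show "((\<lambda>\<tau>. (f (clamp T (t - \<tau>)) \<xi> - f t \<xi>) * complex_of_real (?k \<tau>)) has_integral reg_f \<psi> \<omega> T f \<epsilon> t \<xi> - f t \<xi>) {-?S..?S}"
      unfolding left_diff_distrib by (rule has_integral_diff)
  qed
  with avg show ?thesis by (simp only:)
qed

text \<open>Both parts of the theorem end here and differ in how \<open>adm\<close> is obtained. Its
  constants do not depend on the kernel, hence not on \<epsilon>.\<close>

lemma conclusion_of_admissible:
  fixes lam :: "'i \<Rightarrow> real" and f :: "real \<Rightarrow> 'i \<Rightarrow> complex" and u :: "real \<Rightarrow> nat \<Rightarrow> real \<Rightarrow> 'i \<Rightarrow> complex"
  assumes lam: "\<And>\<xi>. 0 \<le> lam \<xi>" and c: "0 < c" and T: "0 < T" and s: "0 < s" and psi: "mollifier \<psi>"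
    and omega_pos: "\<And>\<epsilon>. 0 < \<epsilon> \<Longrightarrow> 0 < \<omega> \<epsilon>" and omega_lim: "(\<omega> \<longlongrightarrow> 0) (at_right 0)"
    and u0: "Hneg s (mu_of lam c) u0" and u1: "Hneg s (mu_of lam c) u1"
    and f: "\<exists>\<eta>>0. ck_family (wt s (mu_of lam c) \<eta>) T 0 (\<lambda>p. f)"
    and vws: "very_weak_solution s lam c T \<psi> \<omega> a f u0 u1 u"
    and uc: "uniformly_continuous_on UNIV (\<lambda>x. a (clamp T x))" and Kb: "\<And>x. \<bar>a (clamp T x)\<bar> \<le> Kb"
    and C0: "0 \<le> C0" and K: "0 \<le> K"
    and adm: "\<And>S k \<xi>. avg_kernel S k \<Longrightarrow> admissible (moll S k (\<lambda>x. a (clamp T x))) T (lam \<xi>) (C0 * (1 + mu_of lam c \<xi> powr (1 / (2 * s)))) K"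
  shows "conclusion_4p5 s lam c T a f u0 u1 u"
proof -
  let ?mu = "mu_of lam c" and ?A = "\<lambda>x. a (clamp T x)"
  let ?W = "wt s ?mu"
  have mu: "0 < ?mu \<xi>" "lam \<xi> \<le> ?mu \<xi>" for \<xi> using lam[of \<xi>] c by (auto simp: mu_of_def)
  have T0: "0 \<le> T" using T by simp
  have Ac: "continuous_on UNIV ?A" by (rule uniformly_continuous_imp_continuous[OF uc])
  obtain \<eta>f where \<eta>f: "0 < \<eta>f" and ckf: "ck_family (?W \<eta>f) T 0 (\<lambda>p. f)" using f by blast
  obtain \<eta>u where \<eta>u: "0 < \<eta>u" and Hu0: "Hw (?W \<eta>u) u0" using u0 unfolding Hneg_def by blast
  obtain \<eta>v where \<eta>v: "0 < \<eta>v" and Hu1: "Hw (?W \<eta>v) u1" using u1 unfolding Hneg_def by blast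
  \<comment> \<open>The sum dominates all three exponents, so one weight serves the source and both
    initial values.\<close>
  define \<eta>0 where "\<eta>0 = \<eta>f + \<eta>u + \<eta>v"
  have \<eta>: "\<eta>f \<le> \<eta>0" "\<eta>u \<le> \<eta>0" "\<eta>v \<le> \<eta>0" "0 < \<eta>0" using \<eta>f \<eta>u \<eta>v by (auto simp: \<eta>0_def)
  have fH: "\<And>t. t \<in> {0..T} \<Longrightarrow> Hw (?W \<eta>f) (f t)"
    and fl: "\<And>t. t \<in> {0..T} \<Longrightarrow> ((\<lambda>t'. nw (?W \<eta>f) (\<lambda>\<xi>. f t' \<xi> - f t \<xi>)) \<longlongrightarrow> 0) (at t within {0..T})"
    using ckf unfolding ck_family_def by auto
  have fuc: "\<exists>d>0. \<forall>t\<in>{0..T}. \<forall>t'\<in>{0..T}. \<bar>t - t'\<bar> < d \<longrightarrow> wbound (?W \<eta>0) (\<lambda>\<xi>. f t \<xi> - f t' \<xi>) e" if "0 < e" for e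
    using uniform_wbound_continuity[OF wt_nonneg fH fl that] wbound_wt_mono[OF _ \<eta>(1)] by blast
  obtain Mf where Mf: "\<And>t. t \<in> {0..T} \<Longrightarrow> wbound (?W \<eta>0) (f t) Mf"
    using wbound_uniform[OF wt_nonneg fH fl] wbound_wt_mono[OF _ \<eta>(1)] by blast
  have fc: "continuous_on {0..T} (\<lambda>t. f t \<xi>)" for \<xi> by (rule component_continuous[OF wt_pos fuc])
  obtain R where R: "0 < R" and kernel: "\<And>w. 0 < w \<Longrightarrow> avg_kernel (R * w) (\<lambda>\<tau>. \<psi> (\<tau> / w) / w)"
    using mollifier_kernel[OF psi] by blast
  have k: "avg_kernel (R * \<omega> \<epsilon>) (\<lambda>\<tau>. \<psi> (\<tau> / \<omega> \<epsilon>) / \<omega> \<epsilon>)" if "0 < \<epsilon>" for \<epsilon>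
    using kernel[OF omega_pos[OF that]] .
  note ra = reg_a_eq_moll[where R = R and \<omega> = \<omega> and \<psi> = \<psi>, OF k]
  have raK: "\<bar>reg_a \<psi> \<omega> T a \<epsilon> t\<bar> \<le> Kb" if "0 < \<epsilon>" for \<epsilon> t
  proof -
    have "- Kb \<le> ?A (t - \<tau>) \<and> ?A (t - \<tau>) \<le> Kb" for \<tau> using Kb[of "t - \<tau>"] by (simp add: abs_le_iff)
    from moll_between[OF k[OF that] Ac this] show ?thesis unfolding ra[OF that] by (simp add: abs_le_iff)
  qed
  have cka: "continuous_on {0..T} a"
    using continuous_on_cong[of "{0..T}" "{0..T}" ?A a] continuous_on_subset[OF Ac, of "{0..T}"] by (simp add: clamp_id)
  have conv: "\<exists>\<delta>>0. \<forall>\<epsilon>. 0 < \<epsilon> \<and> \<epsilon> < \<delta> \<longrightarrow> (\<forall>t\<in>{0..T}. \<bar>reg_a \<psi> \<omega> T a \<epsilon> t - a t\<bar> \<le> e \<and>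
      wbound (?W \<eta>0) (\<lambda>\<xi>. reg_f \<psi> \<omega> T f \<epsilon> t \<xi> - f t \<xi>) e)" if e: "0 < e" for e
  proof -
    obtain d1 where d1: "0 < d1" "\<And>t t'. t \<in> {0..T} \<Longrightarrow> t' \<in> {0..T} \<Longrightarrow> \<bar>t - t'\<bar> < d1 \<Longrightarrow> wbound (?W \<eta>0) (\<lambda>\<xi>. f t \<xi> - f t' \<xi>) e"
      using fuc[OF e] by blast
    obtain d2 where d2: "0 < d2" "\<forall>x\<in>UNIV. \<forall>x'\<in>UNIV. dist x' x < d2 \<longrightarrow> dist (?A x') (?A x) < e"
      using uc[unfolded uniformly_continuous_on_def, THEN spec, THEN mp, OF e] by (elim exE conjE)
    have "0 < min d1 d2 / R" using d1 d2 R by simp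
    from order_tendstoD(2)[OF omega_lim this] obtain \<delta> where \<delta>: "0 < \<delta>" "\<And>\<epsilon>. 0 < \<epsilon> \<Longrightarrow> \<epsilon> < \<delta> \<Longrightarrow> \<omega> \<epsilon> < min d1 d2 / R"
      unfolding eventually_at_right_field by blast
    have "\<bar>reg_a \<psi> \<omega> T a \<epsilon> t - a t\<bar> \<le> e \<and> wbound (?W \<eta>0) (\<lambda>\<xi>. reg_f \<psi> \<omega> T f \<epsilon> t \<xi> - f t \<xi>) e"
      if \<epsilon>: "0 < \<epsilon>" "\<epsilon> < \<delta>" and t: "t \<in> {0..T}" for \<epsilon> t
    proof
      have small: "R * \<omega> \<epsilon> < d1" "R * \<omega> \<epsilon> < d2"
        using \<delta>(2)[OF \<epsilon>] R by (auto simp: pos_less_divide_eq mult.commute)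
      show "wbound (?W \<eta>0) (\<lambda>\<xi>. reg_f \<psi> \<omega> T f \<epsilon> t \<xi> - f t \<xi>) e"
        by (rule reg_f_near[where R = R and \<omega> = \<omega> and \<psi> = \<psi>, OF wt_nonneg T0 k[OF \<epsilon>(1)] fc d1(2) small(1) less_imp_le[OF e] t])
      have "a t - e \<le> ?A (t - \<tau>) \<and> ?A (t - \<tau>) \<le> a t + e" if "\<tau> \<in> {-(R * \<omega> \<epsilon>)..R * \<omega> \<epsilon>}" for \<tau>
      proof -
        have "dist (t - \<tau>) t < d2" using that small by (auto simp: dist_real_def)
        from d2(2)[rule_format, OF UNIV_I UNIV_I this] show ?thesis unfolding dist_real_def clamp_id[OF t] by linarith
      qed
      from moll_between[OF k[OF \<epsilon>(1)] Ac this]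
      show "\<bar>reg_a \<psi> \<omega> T a \<epsilon> t - a t\<bar> \<le> e" unfolding ra[OF \<epsilon>(1)] by (simp add: abs_le_iff)
    qed
    thus ?thesis using \<delta>(1) by blast
  qed
  \<comment> \<open>Each regularised solution may come with its own weight. It is used only to
    differentiate single coefficients; the common weight comes from the energy estimate.\<close>
  have ck: "\<exists>\<eta>. ck_family (?W \<eta>) T 2 (u \<epsilon>)" if "\<epsilon> \<in> {0<..1}" for \<epsilon>
    using vws that unfolding very_weak_solution_def cinf_family_def by blast
  have der: "((\<lambda>t. u \<epsilon> p t \<xi>) has_vector_derivative u \<epsilon> (Suc p) t \<xi>) (at t within {0..T})"
    if e: "\<epsilon> \<in> {0<..1}" and t: "t \<in> {0..T}" and p: "p < 2" for \<epsilon> t \<xi> p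
  proof -
    obtain \<eta> where "ck_family (?W \<eta>) T 2 (u \<epsilon>)" using ck[OF e] by blast
    thus ?thesis by (rule ck_family_component_derivative[where w = "?W \<eta>", OF wt_pos _ p t])
  qed
  have eqs: "u \<epsilon> 2 t \<xi> + complex_of_real (reg_a \<psi> \<omega> T a \<epsilon> t * lam \<xi>) * u \<epsilon> 0 t \<xi> = reg_f \<psi> \<omega> T f \<epsilon> t \<xi>"
    if "\<epsilon> \<in> {0<..1}" "t \<in> {0..T}" for \<epsilon> t \<xi>
    using vws that unfolding very_weak_solution_def by blast
  have "\<exists>V. (\<exists>\<eta>>0. ck_family (?W \<eta>) T 2 V) \<and>
     (\<forall>t\<in>{0..T}. \<forall>\<xi>. V 2 t \<xi> + complex_of_real (a t * lam \<xi>) * V 0 t \<xi> = f t \<xi>) \<and>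
     V 0 0 = u0 \<and> V 1 0 = u1 \<and> converges_C2 s ?mu T u V"
  proof (rule wave_convergence[where ?\<eta>0.0 = \<eta>0 and Kb = Kb and b = "reg_a \<psi> \<omega> T a" and g = "reg_f \<psi> \<omega> T f"])
    show "admissible (reg_a \<psi> \<omega> T a \<epsilon>) T (lam \<xi>) (C0 * (1 + ?mu \<xi> powr (1 / (2 * s)))) K" if "\<epsilon> \<in> {0<..1}" for \<epsilon> \<xi>
    proof -
      have e: "0 < \<epsilon>" using that by simp
      have "reg_a \<psi> \<omega> T a \<epsilon> = moll (R * \<omega> \<epsilon>) (\<lambda>\<tau>. \<psi> (\<tau> / \<omega> \<epsilon>) / \<omega> \<epsilon>) ?A" by (rule ext) (rule ra[OF e])
      thus ?thesis using adm[OF k[OF e]] by simp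
    qed
    show "\<bar>reg_a \<psi> \<omega> T a \<epsilon> t\<bar> \<le> Kb" if "\<epsilon> \<in> {0<..1}" for \<epsilon> t using that by (intro raK) simp
    show "\<bar>a t\<bar> \<le> Kb" if "t \<in> {0..T}" for t using Kb[of t] by (simp add: clamp_id[OF that])
    show "wbound (?W \<eta>0) (reg_f \<psi> \<omega> T f \<epsilon> t) Mf" if "\<epsilon> \<in> {0<..1}" for \<epsilon> t
      by (rule reg_f_wbound[where R = R and \<omega> = \<omega> and \<psi> = \<psi>, OF wt_nonneg T0 k fc Mf]) (use that in auto)
    show "wbound (?W \<eta>0) u0 (nw (?W \<eta>u) u0)" by (rule wbound_wt_mono[OF Hw_imp_wbound[OF wt_nonneg Hu0] \<eta>(2)])
    show "wbound (?W \<eta>0) u1 (nw (?W \<eta>v) u1)" by (rule wbound_wt_mono[OF Hw_imp_wbound[OF wt_nonneg Hu1] \<eta>(3)])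
    fix \<epsilon> :: real assume e: "\<epsilon> \<in> {0<..1}"
    show "u \<epsilon> 0 0 = u0" "u \<epsilon> 1 0 = u1" using vws e unfolding very_weak_solution_def by blast+
    fix t :: real and \<xi> assume t: "t \<in> {0..T}"
    show "((\<lambda>t. u \<epsilon> 0 t \<xi>) has_vector_derivative u \<epsilon> 1 t \<xi>) (at t within {0..T})" using der[OF e t, of 0] by simp
    show "((\<lambda>t. u \<epsilon> 1 t \<xi>) has_vector_derivative u \<epsilon> 2 t \<xi>) (at t within {0..T})"
      using der[OF e t, of 1] by (simp add: numeral_2_eq_2)
    show "u \<epsilon> 2 t \<xi> = reg_f \<psi> \<omega> T f \<epsilon> t \<xi> - complex_of_real (reg_a \<psi> \<omega> T a \<epsilon> t * lam \<xi>) * u \<epsilon> 0 t \<xi>"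
      unfolding eqs[OF e t, symmetric] by simp
  qed (use T s mu lam \<eta> C0 K cka fuc conv in auto)
  then obtain V where V: "classical_solution s lam c T a f u0 u1 V" "converges_C2 s ?mu T u V"
    unfolding classical_solution_def by blast
  have "W 0 t = V 0 t" if "classical_solution s lam c T a f u0 u1 W" "t \<in> {0..T}" for W t
    using classical_solution_unique[OF T lam _ V(1) that, of Kb] Kb by (metis clamp_id)
  thus ?thesis unfolding conclusion_4p5_def using V by blast
qed

lemma clamp_hoelder_bounded:
  assumes T: "0 < T" and H: "0 \<le> H" "0 < \<beta>"
    and hoel: "\<And>x y. \<bar>a (clamp T x) - a (clamp T y)\<bar> \<le> H * \<bar>x - y\<bar> powr \<beta>"
  shows "\<bar>a (clamp T x)\<bar> \<le> \<bar>a 0\<bar> + H * T powr \<beta>"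
proof -
  have c: "clamp T x \<in> {0..T}" using T by (intro clamp_in) simp
  have "\<bar>a (clamp T x) - a 0\<bar> \<le> H * \<bar>clamp T x - 0\<bar> powr \<beta>"
    using hoel[of "clamp T x" 0] T by (simp add: clamp_id[OF c] clamp_id)
  also have "\<dots> \<le> H * T powr \<beta>" using c H by (intro mult_left_mono powr_mono2) auto
  finally show ?thesis by linarith
qed

theorem theorem4p5:
  fixes lam :: "'i::countable \<Rightarrow> real"
    and c T s :: real
    and a :: "real \<Rightarrow> real"
    and f :: "real \<Rightarrow> 'i \<Rightarrow> complex"
    and u0 u1 :: "'i \<Rightarrow> complex"
    and \<psi> \<omega> :: "real \<Rightarrow> real"
    and u :: "real \<Rightarrow> nat \<Rightarrow> real \<Rightarrow> 'i \<Rightarrow> complex"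
  assumes lam_nonneg: "\<forall>\<xi>. 0 \<le> lam \<xi>"
    and c_pos: "0 < c"
    and T_pos: "0 < T"
    and psi: "mollifier \<psi>"
    and omega_pos: "\<forall>\<epsilon>>0. 0 < \<omega> \<epsilon>"
    and omega_lim: "(\<omega> \<longlongrightarrow> 0) (at_right 0)"
    and u0: "Hneg s (mu_of lam c) u0"
    and u1: "Hneg s (mu_of lam c) u1"
    and f: "\<exists>\<eta>>0. ck_family (wt s (mu_of lam c) \<eta>) T 0 (\<lambda>p. f)"
    and vws: "very_weak_solution s lam c T \<psi> \<omega> a f u0 u1 u"
  shows "(\<forall>\<alpha> a0. 0 < \<alpha> \<and> \<alpha> < 1 \<and> C_alpha \<alpha> T a \<and> 0 < a0 \<and> (\<forall>t\<in>{0..T}. a0 \<le> a t) \<and>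
            1 \<le> s \<and> s < 1 + \<alpha> / (1 - \<alpha>) \<longrightarrow> conclusion_4p5 s lam c T a f u0 u1 u) \<and>
         (\<forall>\<alpha>. 0 < \<alpha> \<and> \<alpha> < 2 \<and> C_alpha \<alpha> T a \<and> (\<forall>t\<in>{0..T}. 0 \<le> a t) \<and>
            1 \<le> s \<and> s < 1 + \<alpha> / 2 \<longrightarrow> conclusion_4p5 s lam c T a f u0 u1 u)"
proof (intro conjI allI impI; elim conjE)
  let ?mu = "mu_of lam c" and ?A = "\<lambda>x. a (clamp T x)"
  have lam: "0 \<le> lam \<xi>" "lam \<xi> \<le> ?mu \<xi>" for \<xi> using lam_nonneg c_pos by (auto simp: mu_of_def)
  have T0: "0 \<le> T" using T_pos by simp
  note reduce = conclusion_of_admissible[OF lam(1) c_pos T_pos _ psi omega_pos[rule_format] omega_lim u0 u1 f vws]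
  {
    fix \<alpha> a0 :: real
    assume \<alpha>: "0 < \<alpha>" "\<alpha> < 1" and C: "C_alpha \<alpha> T a" and a0: "0 < a0" "\<forall>t\<in>{0..T}. a0 \<le> a t"
      and s: "1 \<le> s" "s < 1 + \<alpha> / (1 - \<alpha>)"
    obtain H \<beta> where H: "0 \<le> H" "0 < \<beta>" "\<alpha> < 1 \<longrightarrow> \<beta> = \<alpha>" "\<And>x y. \<bar>?A x - ?A y\<bar> \<le> H * \<bar>x - y\<bar> powr \<beta>"
      by (rule C_alpha_clamp_hoelder[OF T_pos \<alpha>(1) C]) blast
    have \<beta>: "\<beta> = \<alpha>" using H(3) \<alpha> by simp
    have uc: "uniformly_continuous_on UNIV ?A" by (rule hoelder_uniformly_continuous[OF H(1,2,4)])
    note bd = clamp_hoelder_bounded[OF T_pos H(1,2,4)]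
    define Kb where "Kb = \<bar>a 0\<bar> + H * T powr \<beta>"
    have Kb: "0 \<le> Kb" using H(1) by (simp add: Kb_def)
    \<comment> \<open>In this form the upper bound on s says that the loss exponent (1 - \<alpha>)/2
      is below the exponent 1/(2s) of the weights.\<close>
    have "1 + \<alpha> / (1 - \<alpha>) = 1 / (1 - \<alpha>)" using \<alpha> by (simp add: field_simps)
    with s \<alpha> have "s * (1 - \<alpha>) < 1" by (simp add: pos_less_divide_eq)
    hence \<sigma>: "(1 - \<alpha>) / 2 \<le> 1 / (2 * s)" using s by (simp add: field_simps)
    show "conclusion_4p5 s lam c T a f u0 u1 u"
    proof (rule reduce[OF _ _ uc bd _ Kb])
      fix S k \<xi> assume k: "avg_kernel S k"
      show "admissible (moll S k ?A) T (lam \<xi>) (T * H * (1 / a0 + 1 / sqrt a0) * (1 + ?mu \<xi> powr (1 / (2 * s)))) Kb"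
      proof (rule moll_admissible_pos[OF k uc T0 lam a0(1) _ _ H(1) H(4)[unfolded \<beta>] \<alpha>(1) \<sigma>])
        show "a0 \<le> ?A t" for t using a0(2) clamp_in[OF T0, of t] by blast
        show "?A t \<le> Kb" for t using bd[of t] by (simp add: Kb_def abs_le_iff)
      qed (use s in simp)
    qed (use s H a0 T0 in auto)
  }
  {
    fix \<alpha> :: real
    assume \<alpha>: "0 < \<alpha>" "\<alpha> < 2" and C: "C_alpha \<alpha> T a" and a0: "\<forall>t\<in>{0..T}. 0 \<le> a t"
      and s: "1 \<le> s" "s < 1 + \<alpha> / 2"
    obtain H \<beta> where H: "0 \<le> H" "0 < \<beta>" "\<alpha> < 1 \<longrightarrow> \<beta> = \<alpha>" "\<And>x y. \<bar>?A x - ?A y\<bar> \<le> H * \<bar>x - y\<bar> powr \<beta>"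
      by (rule C_alpha_clamp_hoelder[OF T_pos \<alpha>(1) C]) blast
    have uc: "uniformly_continuous_on UNIV ?A" by (rule hoelder_uniformly_continuous[OF H(1,2,4)])
    note bd = clamp_hoelder_bounded[OF T_pos H(1,2,4)]
    define Kb where "Kb = \<bar>a 0\<bar> + H * T powr \<beta>"
    have Kb: "0 \<le> Kb + 1" using H(1) by (simp add: Kb_def)
    have A0: "0 \<le> ?A t" for t using a0 clamp_in[OF T0, of t] by blast
    \<comment> \<open>The upper bound on s reads 2s < 2 + \<alpha>, so the loss exponent 1/(2 +
      \<alpha>) is covered by the weights.\<close>
    have \<sigma>: "1 / (2 + \<alpha>) \<le> 1 / (2 * s)" using s by (intro divide_left_mono) auto
    have "\<exists>K\<ge>0. coeff_class \<alpha> K ?A"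
    proof (cases "\<alpha> < 1")
      case True
      with H show ?thesis using coeff_class_hoelder[OF H(1) \<alpha>(1), of ?A] A0 by blast
    next
      case False
      then obtain a' where a': "\<And>t. t \<in> {0..T} \<Longrightarrow> (a has_real_derivative a' t) (at t within {0..T})"
        "continuous_on {0..T} a'" "hoelder_on (\<alpha> - 1) {0..T} a'" using C unfolding C_alpha_def by blast
      obtain L where L: "0 \<le> L" "\<And>x y. x \<in> {0..T} \<Longrightarrow> y \<in> {0..T} \<Longrightarrow> \<bar>a x - a y\<bar> \<le> L * \<bar>x - y\<bar>"
        by (rule C1_lipschitz[OF a'(1,2)]) auto
      obtain H' where H': "0 \<le> H'" "\<And>x y. x \<in> {0..T} \<Longrightarrow> y \<in> {0..T} \<Longrightarrow> \<bar>a' x - a' y\<bar> \<le> H' * \<bar>x - y\<bar> powr (\<alpha> - 1)"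
        by (rule hoelder_on_nonneg[OF a'(3)]) auto
      have "coeff_class \<alpha> (L + H' + 4) ?A"
        using False by (intro coeff_class_C1[OF T_pos _ \<alpha>(2) a'(1) H' L]) (use a0 in auto)
      thus ?thesis using L H' by (intro exI[of _ "L + H' + 4"]) auto
    qed
    then obtain K where K: "0 \<le> K" "coeff_class \<alpha> K ?A" by blast
    show "conclusion_4p5 s lam c T a f u0 u1 u"
    proof (rule reduce[OF _ _ uc bd _ Kb])
      fix S k \<xi> assume k: "avg_kernel S k"
      show "admissible (moll S k ?A) T (lam \<xi>) ((T * (K * (1 + K) + (1 + K)) + K\<^sup>2) * (1 + ?mu \<xi> powr (1 / (2 * s)))) (Kb + 1)"
      proof (rule moll_admissible_nonneg[OF k uc T0 lam A0 _ K \<alpha> \<sigma>])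
        show "?A t \<le> Kb" for t using bd[of t] by (simp add: Kb_def abs_le_iff)
      qed
    qed (use s K T0 in auto)
  }
qed

end
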